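(* Let $\mathcal G$ be a connected and compact metric graph with vertex set $\mathsf V$, a (possibly empty) set $\mathsf V_D\subset\mathsf V$ of Dirichlet vertices, each of degree one, and real coupling constants $(\alpha_{\mathsf v})_{\mathsf v\in\mathsf V\setminus\mathsf V_D}$. Let $-\Delta$ be the Laplacian with Dirichlet conditions at the vertices in $\mathsf V_D$ and $\delta$-coupling conditions with constants $\alpha_{\mathsf v}$ at all other vertices (where $\alpha_{\mathsf v}=0$ means standard conditions). Then: (a) If $\mathcal G$ is a tree and $\mathsf V_D=\emptyset$, there exist a strictly increasing infinite sequence $(\lambda_k)_{k\in\mathbb N}$ of eigenvalues of $-\Delta$ of multiplicity one and a sequence $(\psi_k)_{k\in\mathbb N}$ of corresponding eigenfunctions such that no $\psi_k$ vanishes at any vertex of $\mathcal G$. (b) If $\mathsf V_D\neq\emptyset$, there exist a strictly increasing infinite sequence $(\lambda_k)_{k\in\mathbb N}$ of eigenvalues of $-\Delta$ and a sequence $(\psi_k)_{k\in\mathbb N}$ of corresponding eigenfunctions with full support, i.e. no $\psi_k$ vanishes identically on any edge of $\mathcal G$.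
   Context: Metric graphs: a compact metric graph $\mathcal G=(\mathsf G,\ell)$ consists of a finite combinatorial graph $\mathsf G$ with vertex set $\mathsf V$ and non-empty edge set $\mathsf E$ (without loops; parallel edges allowed) in which each edge $\mathsf e$ is identified with an interval $[0,\ell_{\mathsf e}]$, $\ell_{\mathsf e}\in(0,\infty)$; the endpoints $0$ and $\ell_{\mathsf e}$ are identified with the initial and the terminal vertex of $\mathsf e$. It is connected (a tree) if $\mathsf G$ is. $\mathsf E_{\mathsf v}$ denotes the set of edges incident to $\mathsf v$, and the degree of $\mathsf v$ is the number of these edges. Laplacian: $-\Delta$ acts edgewise as $-\frac{\mathrm d^2}{\mathrm dx_{\mathsf e}^2}$ in $L^2(\mathcal G)=\bigoplus_{\mathsf e}L^2(0,\ell_{\mathsf e})$ on functions $f$ that are edgewise in the Sobolev space $H^2(0,\ell_{\mathsf e})$ and satisfy: at each Dirichlet vertex $f(\mathsf v)=0$; at each vertex with $\delta$-coupling condition with constant $\alpha_{\mathsf v}\in\mathbb R$, $f$ is continuous at $\mathsf v$ and $\sum_{\mathsf e\in\mathsf E_{\mathsf v}}\partial_{\mathsf e}f(\mathsf v)=\alpha_{\mathsf v}f(\mathsf v)$, where $\partial_{\mathsf e}f(\mathsf v)$ is the outward derivative, i.e. $-f_{\mathsf e}'(0)$ if $\mathsf v$ is the initial vertex of $\mathsf e$ and $f_{\mathsf e}'(\ell_{\mathsf e})$ if $\mathsf v$ is the terminal vertex. This operator is self-adjoint with purely discrete spectrum, bounded from below. *)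

theory Defs
  imports "HOL-Analysis.Analysis" "Graph_Theory.Digraph_Component"
begin

section \<open>Compact metric graphs\<close>

text \<open>
  The arc \<open>e\<close> is identified with the interval from \<open>0\<close> to \<open>len e\<close>, its tail being the initial
  vertex and its head the terminal vertex. Parallel arcs (in either direction) are allowed.
\<close>

locale compact_metric_graph = fin_digraph G + loopfree_digraph G
  for G :: "('v, 'e) pre_digraph" and len :: "'e \<Rightarrow> real" +
  assumes arcs_nonempty: "arcs G \<noteq> {}"
    and len_pos: "e \<in> arcs G \<Longrightarrow> 0 < len e"

definition incident_arcs :: "('v, 'e) pre_digraph \<Rightarrow> 'v \<Rightarrow> 'e set" where
  "incident_arcs G v = in_arcs G v \<union> out_arcs G v"

text \<open>As there are no loops, every incident arc contributes one to the degree.\<close>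

definition vertex_degree :: "('v, 'e) pre_digraph \<Rightarrow> 'v \<Rightarrow> nat" where
  "vertex_degree G v = card (incident_arcs G v)"

text \<open>
  The orientation of the arcs only fixes coordinates, so cycles must ignore it. The library
  constant \<open>forest\<close> only excludes directed cycles and is not suitable here. Two parallel arcs
  form a cycle of length two.
\<close>

definition undirected_cycle :: "('v, 'e) pre_digraph \<Rightarrow> 'v list \<Rightarrow> 'e list \<Rightarrow> bool" where
  "undirected_cycle G vs es \<longleftrightarrow>
     es \<noteq> [] \<and> length vs = length es \<and> set es \<subseteq> arcs G \<and> distinct es \<and> distinct vs \<and>
     (\<forall>i < length es.
        {tail G (es ! i), head G (es ! i)} = {vs ! i, vs ! (Suc i mod length es)})"

definition undirected_tree :: "('v, 'e) pre_digraph \<Rightarrow> bool" where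
  "undirected_tree G \<longleftrightarrow>
     Digraph_Component.connected G \<and> \<not> (\<exists>vs es. undirected_cycle G vs es)"


section \<open>Sobolev functions on an interval\<close>

definition square_integrable :: "real \<Rightarrow> (real \<Rightarrow> complex) \<Rightarrow> bool" where
  "square_integrable l f \<longleftrightarrow>
     f \<in> borel_measurable (lebesgue_on {0<..<l}) \<and>
     integrable (lebesgue_on {0<..<l}) (\<lambda>x. (norm (f x))\<^sup>2)"

definition test_function :: "real \<Rightarrow> (real \<Rightarrow> real) \<Rightarrow> bool" where
  "test_function l \<phi> \<longleftrightarrow>
     \<phi> C1_differentiable_on UNIV \<and> closure {x. \<phi> x \<noteq> 0} \<subseteq> {0<..<l}"

definition weak_derivative :: "real \<Rightarrow> (real \<Rightarrow> complex) \<Rightarrow> (real \<Rightarrow> complex) \<Rightarrow> bool" where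
  "weak_derivative l f g \<longleftrightarrow>
     square_integrable l f \<and> square_integrable l g \<and>
     (\<forall>\<phi>. test_function l \<phi> \<longrightarrow>
        (LINT x|lebesgue_on {0<..<l}. deriv \<phi> x *\<^sub>R f x) =
        - (LINT x|lebesgue_on {0<..<l}. \<phi> x *\<^sub>R g x))"

definition sobolev_H2 :: "real \<Rightarrow> (real \<Rightarrow> complex) \<Rightarrow> bool" where
  "sobolev_H2 l f \<longleftrightarrow> (\<exists>g h. weak_derivative l f g \<and> weak_derivative l g h)"


section \<open>The Laplacian with Dirichlet and delta-coupling conditions\<close>

text \<open>
  A function on the graph is a family \<open>f\<close> indexed by the arcs; only the values \<open>f e x\<close> with
  \<open>e \<in> arcs G\<close> and \<open>x \<in> {0..len e}\<close> matter. In the domain of the Laplacian the class of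
  \<open>f e\<close> in \<open>H\<^sup>2\<close> is given by its representative that is continuous on the closed interval.
  By the Sobolev embedding this representative is unique and continuously differentiable up to
  the endpoints, so that traces are values and one-sided derivatives at the endpoints.
\<close>

definition trace_at :: "('v, 'e) pre_digraph \<Rightarrow> ('e \<Rightarrow> real) \<Rightarrow>
    ('e \<Rightarrow> real \<Rightarrow> complex) \<Rightarrow> 'e \<Rightarrow> 'v \<Rightarrow> complex" where
  "trace_at G len f e v = (if v = tail G e then f e 0 else f e (len e))"

definition outward_derivative :: "('v, 'e) pre_digraph \<Rightarrow> ('e \<Rightarrow> real) \<Rightarrow>
    ('e \<Rightarrow> real \<Rightarrow> complex) \<Rightarrow> 'e \<Rightarrow> 'v \<Rightarrow> complex" where
  "outward_derivative G len f e v =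
     (if v = tail G e then - vector_derivative (f e) (at 0 within {0..len e})
      else vector_derivative (f e) (at (len e) within {0..len e}))"

definition vanishes_at :: "('v, 'e) pre_digraph \<Rightarrow> ('e \<Rightarrow> real) \<Rightarrow>
    ('e \<Rightarrow> real \<Rightarrow> complex) \<Rightarrow> 'v \<Rightarrow> bool" where
  "vanishes_at G len f v \<longleftrightarrow> (\<forall>e \<in> incident_arcs G v. trace_at G len f e v = 0)"

definition delta_condition :: "('v, 'e) pre_digraph \<Rightarrow> ('e \<Rightarrow> real) \<Rightarrow> real \<Rightarrow>
    ('e \<Rightarrow> real \<Rightarrow> complex) \<Rightarrow> 'v \<Rightarrow> bool" where
  "delta_condition G len a f v \<longleftrightarrow>
     (\<exists>c. (\<forall>e \<in> incident_arcs G v. trace_at G len f e v = c) \<and>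
          (\<Sum>e \<in> incident_arcs G v. outward_derivative G len f e v) = of_real a * c)"

definition laplacian_domain :: "('v, 'e) pre_digraph \<Rightarrow> ('e \<Rightarrow> real) \<Rightarrow> 'v set \<Rightarrow>
    ('v \<Rightarrow> real) \<Rightarrow> ('e \<Rightarrow> real \<Rightarrow> complex) set" where
  "laplacian_domain G len VD \<alpha> =
     {f. (\<forall>e \<in> arcs G. sobolev_H2 (len e) (f e) \<and> continuous_on {0..len e} (f e)) \<and>
         (\<forall>v \<in> VD. vanishes_at G len f v) \<and>
         (\<forall>v \<in> verts G - VD. delta_condition G len (\<alpha> v) f v)}"

text \<open>
  The graph of the operator: \<open>f\<close> lies in its domain and is mapped to (the class of) \<open>g\<close>.
  The sign is that of minus the second derivative.
\<close>

definition neg_laplacian :: "('v, 'e) pre_digraph \<Rightarrow> ('e \<Rightarrow> real) \<Rightarrow> 'v set \<Rightarrow>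
    ('v \<Rightarrow> real) \<Rightarrow> ('e \<Rightarrow> real \<Rightarrow> complex) \<Rightarrow> ('e \<Rightarrow> real \<Rightarrow> complex) \<Rightarrow> bool" where
  "neg_laplacian G len VD \<alpha> f g \<longleftrightarrow>
     f \<in> laplacian_domain G len VD \<alpha> \<and>
     (\<forall>e \<in> arcs G. \<exists>f'. weak_derivative (len e) (f e) f' \<and>
                        weak_derivative (len e) f' (\<lambda>x. - g e x))"

definition eigenspace :: "('v, 'e) pre_digraph \<Rightarrow> ('e \<Rightarrow> real) \<Rightarrow> 'v set \<Rightarrow>
    ('v \<Rightarrow> real) \<Rightarrow> complex \<Rightarrow> ('e \<Rightarrow> real \<Rightarrow> complex) set" where
  "eigenspace G len VD \<alpha> \<mu> = {f. neg_laplacian G len VD \<alpha> f (\<lambda>e x. \<mu> * f e x)}"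

definition eigenfunction :: "('v, 'e) pre_digraph \<Rightarrow> ('e \<Rightarrow> real) \<Rightarrow> 'v set \<Rightarrow>
    ('v \<Rightarrow> real) \<Rightarrow> complex \<Rightarrow> ('e \<Rightarrow> real \<Rightarrow> complex) \<Rightarrow> bool" where
  "eigenfunction G len VD \<alpha> \<mu> f \<longleftrightarrow>
     f \<in> eigenspace G len VD \<alpha> \<mu> \<and> (\<exists>e \<in> arcs G. \<exists>x \<in> {0..len e}. f e x \<noteq> 0)"

text \<open>
  Multiplicity one: the eigenspace, whose elements are identified if they agree on the graph,
  is spanned by a single nonzero element. The operator is self-adjoint, so there is no
  distinction between geometric and algebraic multiplicity.
\<close>

definition simple_eigenvalue :: "('v, 'e) pre_digraph \<Rightarrow> ('e \<Rightarrow> real) \<Rightarrow> 'v set \<Rightarrow>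
    ('v \<Rightarrow> real) \<Rightarrow> complex \<Rightarrow> bool" where
  "simple_eigenvalue G len VD \<alpha> \<mu> \<longleftrightarrow>
     (\<exists>f. eigenfunction G len VD \<alpha> \<mu> f \<and>
        (\<forall>g \<in> eigenspace G len VD \<alpha> \<mu>.
           \<exists>c. \<forall>e \<in> arcs G. \<forall>x \<in> {0..len e}. g e x = c * f e x))"

definition full_support :: "('v, 'e) pre_digraph \<Rightarrow> ('e \<Rightarrow> real) \<Rightarrow>
    ('e \<Rightarrow> real \<Rightarrow> complex) \<Rightarrow> bool" where
  "full_support G len f \<longleftrightarrow> (\<forall>e \<in> arcs G. \<exists>x \<in> {0..len e}. f e x \<noteq> 0)"

end

theory Submission
  imports Defs
begin

text \<open>
  By simultaneous Diophantine approximation there are arbitrarily large \<open>K\<close> for which all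
  \<open>K * len e\<close> are close to multiples of \<open>2 * pi\<close>. At \<open>k = K + s\<close> the graph then behaves like
  the same graph at the bounded frequency \<open>s\<close>, with the couplings \<open>\<alpha> v / k\<close> almost switched off, so
  that the ground state of the graph with standard conditions reappears at arbitrarily high energy.

  On a tree without Dirichlet vertices that ground state is the constant at \<open>s = 0\<close>. All phases are
  small there, hence the logarithmic derivative at a root vertex is a continuous function of \<open>k\<close>,
  it changes sign, and the solution never vanishes at a vertex. With Dirichlet vertices, eliminating
  the arcs yields a quadratic form on the vertex values that is positive definite for small \<open>s\<close>
  and indefinite once the longest arc is almost a half wave. At the first \<open>s\<close> where it degenerates,
  all \<open>sin (k * len e)\<close> are still positive, so the null vector is positive by Perron--Frobenius.
\<close>

section \<open>Connectivity and trees\<close>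

text \<open>No spectral theory enters: eigenvalues above every bound are constructed one at a time,
  together with their eigenfunctions. Recurrence is only approximate, so what is needed is a sign
  change that survives small errors in phases and couplings, across a window of frequencies whose
  width does not depend on \<open>K\<close>. On a tree the window is symmetric about
  \<open>K\<close>, and the errors are small compared with the change of every phase. With Dirichlet
  vertices the ground state lies strictly above zero, so the window starts slightly above
  \<open>K\<close> and ends before any phase reaches pi, where the vertex form becomes singular. Two
  complications remain. If an arc joins two Dirichlet vertices, the form has no free variable;
  degree one and connectedness then leave a single interval, which is treated by explicit sines. And
  multiplicity one concerns every weak eigenfunction, so the tree case also needs the regularity
  statement that weak solutions on an arc are trigonometric.\<close>

lemma connected_closed_verts:
  assumes "Digraph_Component.connected G" "r \<in> W" "r \<in> verts G"
    and closed: "\<And>e. e \<in> arcs G \<Longrightarrow> tail G e \<in> W \<longleftrightarrow> head G e \<in> W"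
  shows "verts G \<subseteq> W"
proof
  fix x assume "x \<in> verts G"
  \<comment> \<open>Connectedness means reachability in the symmetrised graph, so the induction
    along walks may traverse arcs in both directions.\<close>
  then have "(r, x) \<in> rtrancl_on (verts G) (parcs (mk_symmetric G))"
    using assms(1,3) unfolding connected_def strongly_connected_def reachable_def
    by (simp add: mk_symmetric_def arcs_ends_conv)
  then show "x \<in> W"
    by (induct rule: rtrancl_on_induct) (use assms(2) closed in \<open>auto simp: mk_symmetric_def\<close>)
qed

lemma connected_cut_arc:
  assumes "Digraph_Component.connected G" "W \<inter> verts G \<noteq> {}" "\<not> verts G \<subseteq> W"
  obtains e w v where "e \<in> arcs G" "{tail G e, head G e} = {w, v}" "w \<in> W" "v \<notin> W"
proof -
  obtain r where r: "r \<in> W" "r \<in> verts G" using assms(2) by auto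
  have "\<exists>e\<in>arcs G. (tail G e \<in> W) \<noteq> (head G e \<in> W)"
    using connected_closed_verts[OF assms(1) r] assms(3) by blast
  then obtain e where e: "e \<in> arcs G" "(tail G e \<in> W) \<noteq> (head G e \<in> W)" by blast
  show ?thesis
  proof (cases "tail G e \<in> W")
    case True
    then show ?thesis using that[of e "tail G e" "head G e"] e by auto
  next
    case False
    then show ?thesis using that[of e "head G e" "tail G e"] e by auto
  qed
qed

lemma incident_arcs_iff:
  "e \<in> incident_arcs G v \<longleftrightarrow> e \<in> arcs G \<and> v \<in> {tail G e, head G e}"
  by (auto simp: incident_arcs_def in_arcs_def out_arcs_def)

lemma connected_incident_arc:
  assumes "Digraph_Component.connected G" "loopfree_digraph G" "arcs G \<noteq> {}" "v \<in> verts G"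
  obtains e where "e \<in> incident_arcs G v"
proof -
  interpret loopfree_digraph G by fact
  obtain e where e: "e \<in> arcs G" using assms(3) by auto
  then have "tail G e \<noteq> head G e" "tail G e \<in> verts G" "head G e \<in> verts G"
    using no_loops by auto
  then have "\<not> verts G \<subseteq> {v}" by auto
  moreover have "{v} \<inter> verts G \<noteq> {}" using assms(4) by auto
  ultimately obtain e w v' where "e \<in> arcs G" "{tail G e, head G e} = {w, v'}" "w \<in> {v}" "v' \<notin> {v}"
    using connected_cut_arc[OF assms(1)] by metis
  then show ?thesis using that[of e] by (auto simp: incident_arcs_iff)
qed

text \<open>Each step attaches a new leaf \<open>v\<close> to an old vertex \<open>w\<close>,
  starting from \<open>r\<close>. Rule induction therefore removes the last leaf and never the root,
  which is the order in which solutions are eliminated.\<close>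

inductive grown_tree :: "('v, 'e) pre_digraph \<Rightarrow> 'v \<Rightarrow> 'v set \<Rightarrow> 'e set \<Rightarrow> bool"
  for G :: "('v, 'e) pre_digraph" and r :: 'v where
  root: "grown_tree G r {r} {}"
| grow: "grown_tree G r W F \<Longrightarrow> e \<in> arcs G \<Longrightarrow> {tail G e, head G e} = {w, v} \<Longrightarrow> w \<in> W \<Longrightarrow> v \<notin> W
    \<Longrightarrow> grown_tree G r (insert v W) (insert e F)"

lemma grown_treeD:
  assumes "grown_tree G r W F"
  shows "finite W" "finite F" "r \<in> W" "F \<subseteq> arcs G" "\<And>e. e \<in> F \<Longrightarrow> tail G e \<in> W \<and> head G e \<in> W"
proof -
  have "finite W \<and> finite F \<and> r \<in> W \<and> F \<subseteq> arcs G \<and> (\<forall>e\<in>F. tail G e \<in> W \<and> head G e \<in> W)"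
    using assms by induct (auto simp: doubleton_eq_iff)
  then show "finite W" "finite F" "r \<in> W" "F \<subseteq> arcs G" "\<And>e. e \<in> F \<Longrightarrow> tail G e \<in> W \<and> head G e \<in> W"
    by auto
qed

lemma grown_tree_subset_verts:
  assumes "grown_tree G r W F" "wf_digraph G" "r \<in> verts G"
  shows "W \<subseteq> verts G"
  using assms
proof (induct)
  case (grow W F e w v)
  interpret wf_digraph G by fact
  show ?case using grow tail_in_verts[OF grow(3)] head_in_verts[OF grow(3)]
    by (auto simp: doubleton_eq_iff)
qed auto

text \<open>A grown tree with the most vertices must span: otherwise connectedness yields an arc
  leaving it, and attaching that arc would give a larger one.\<close>

lemma spanning_grown_tree:
  assumes "Digraph_Component.connected G" "fin_digraph G" "r \<in> verts G"
  obtains F where "grown_tree G r (verts G) F"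
proof -
  interpret fin_digraph G by fact
  have sub: "W \<subseteq> verts G" if "grown_tree G r W F" for W F
    using grown_tree_subset_verts[OF that] assms(3) wf_digraph_axioms by auto
  define P where "P = (\<lambda>n. \<exists>W F. grown_tree G r W F \<and> card W = n)"
  have "P 1" unfolding P_def using grown_tree.root[of G r] by (intro exI[of _ "{r}"]) auto
  moreover have bd: "\<forall>n. P n \<longrightarrow> n \<le> card (verts G)"
    unfolding P_def using card_mono[OF finite_verts sub] by auto
  ultimately obtain n where "P n" and mx: "\<And>m. P m \<Longrightarrow> m \<le> n"
    using GreatestI_nat[of P 1 "card (verts G)"] Greatest_le_nat[of P _ "card (verts G)"] by blast
  then obtain W F where WF: "grown_tree G r W F" "card W = n" unfolding P_def by auto
  have "verts G \<subseteq> W"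
  proof (rule ccontr)
    assume *: "\<not> verts G \<subseteq> W"
    have "W \<inter> verts G \<noteq> {}" using grown_treeD(3)[OF WF(1)] assms(3) by auto
    then obtain e w v where "e \<in> arcs G" "{tail G e, head G e} = {w, v}" "w \<in> W" "v \<notin> W"
      using connected_cut_arc[OF assms(1) _ *] by metis
    then have "grown_tree G r (insert v W) (insert e F)" "card (insert v W) = Suc n"
      using grown_tree.grow[OF WF(1)] WF(2) grown_treeD(1)[OF WF(1)] by simp_all
    then have "P (Suc n)" unfolding P_def by blast
    then show False using mx by fastforce
  qed
  then show ?thesis using that WF(1) sub[OF WF(1)] by (metis subset_antisym)
qed

section \<open>Paths in grown trees and the cycles that they close\<close>

definition undirected_path :: "('v, 'e) pre_digraph \<Rightarrow> 'v list \<Rightarrow> 'e list \<Rightarrow> bool" where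
  "undirected_path G vs es \<longleftrightarrow> length vs = Suc (length es) \<and> distinct vs \<and> distinct es \<and>
     (\<forall>i < length es. {tail G (es ! i), head G (es ! i)} = {vs ! i, vs ! Suc i})"

lemma undirected_path_rev:
  assumes "undirected_path G vs es"
  shows "undirected_path G (rev vs) (rev es)"
  unfolding undirected_path_def
proof (intro conjI allI impI)
  fix i assume i: "i < length (rev es)"
  let ?j = "length es - Suc i"
  have "{tail G (es ! ?j), head G (es ! ?j)} = {vs ! ?j, vs ! Suc ?j}"
    using assms i by (simp add: undirected_path_def)
  moreover have "Suc ?j = length es - i" using i by simp
  moreover have "rev vs ! i = vs ! (length es - i)" "rev vs ! Suc i = vs ! ?j"
    using assms i by (simp_all add: undirected_path_def rev_nth)
  ultimately show "{tail G (rev es ! i), head G (rev es ! i)} = {rev vs ! i, rev vs ! Suc i}"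
    using i by (simp add: rev_nth insert_commute)
qed (use assms in \<open>auto simp: undirected_path_def\<close>)

lemma undirected_path_Cons:
  assumes "undirected_path G vs es" "{tail G e, head G e} = {hd vs, v}" "v \<notin> set vs" "e \<notin> set es"
  shows "undirected_path G (v # vs) (e # es)"
  unfolding undirected_path_def
proof (intro conjI allI impI)
  fix i assume "i < length (e # es)"
  then show "{tail G ((e # es) ! i), head G ((e # es) ! i)} = {(v # vs) ! i, (v # vs) ! Suc i}"
    using assms by (cases i; cases vs) (auto simp: undirected_path_def)
qed (use assms in \<open>auto simp: undirected_path_def\<close>)

text \<open>With reversal available, the only new paths to build are those starting at the new leaf:
  its arc is prepended to a path from its attachment vertex.\<close>

lemma grown_tree_path:
  assumes "grown_tree G r W F" "x \<in> W" "y \<in> W"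
  shows "\<exists>vs es. undirected_path G vs es \<and> set vs \<subseteq> W \<and> set es \<subseteq> F \<and> hd vs = x \<and> last vs = y"
  using assms
proof (induct arbitrary: x y)
  case root
  then show ?case by (intro exI[of _ "[r]"] exI[of _ "[]"]) (auto simp: undirected_path_def)
next
  case (grow W F e w v)
  have eF: "e \<notin> F" using grown_treeD(5)[OF grow(1)] grow(4,6) by (metis doubleton_eq_iff)
  have to_new: "\<exists>vs es. undirected_path G vs es \<and> set vs \<subseteq> insert v W \<and> set es \<subseteq> insert e F \<and>
    hd vs = v \<and> last vs = y" if y: "y \<in> W" for y
  proof -
    obtain vs es where p: "undirected_path G vs es" "set vs \<subseteq> W" "set es \<subseteq> F" "hd vs = w" "last vs = y"
      using grow(2)[OF grow(5) y] by auto
    then have "vs \<noteq> []" by (auto simp: undirected_path_def)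
    moreover have "undirected_path G (v # vs) (e # es)"
      using p grow(4,6) eF by (intro undirected_path_Cons) auto
    ultimately show ?thesis using p by (intro exI[of _ "v # vs"] exI[of _ "e # es"]) auto
  qed
  consider "x \<in> W" "y \<in> W" | "x = v" "y \<in> W" | "x \<in> W" "y = v" | "x = v" "y = v"
    using grow(7,8) by auto
  then show ?case
  proof cases
    case 1
    then obtain vs es where "undirected_path G vs es" "set vs \<subseteq> W" "set es \<subseteq> F" "hd vs = x" "last vs = y"
      using grow(2) by blast
    then show ?thesis by (intro exI[of _ vs] exI[of _ es]) auto
  next
    case 2
    then show ?thesis using to_new by auto
  next
    case 3
    then obtain vs es where p: "undirected_path G vs es" "set vs \<subseteq> insert v W" "set es \<subseteq> insert e F"
      "hd vs = v" "last vs = x" using to_new by metis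
    moreover from p(1) have "vs \<noteq> []" by (auto simp: undirected_path_def)
    ultimately show ?thesis using 3(2) undirected_path_rev[OF p(1)]
      by (intro exI[of _ "rev vs"] exI[of _ "rev es"]) (simp add: hd_rev last_rev)
  next
    case 4
    then show ?thesis by (intro exI[of _ "[v]"] exI[of _ "[]"]) (auto simp: undirected_path_def)
  qed
qed

lemma undirected_path_close:
  assumes p: "undirected_path G vs es" "set es \<subseteq> arcs G"
    and e: "e \<in> arcs G" "e \<notin> set es" "{tail G e, head G e} = {hd vs, last vs}"
  shows "undirected_cycle G vs (es @ [e])"
proof -
  have len: "length vs = Suc (length es)" using p(1) by (simp add: undirected_path_def)
  then have "vs \<noteq> []" by auto
  have "{tail G ((es @ [e]) ! i), head G ((es @ [e]) ! i)} = {vs ! i, vs ! (Suc i mod length (es @ [e]))}"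
    if "i < length (es @ [e])" for i
  proof (cases "i = length es")
    case True
    then show ?thesis using e(3) len \<open>vs \<noteq> []\<close> by (simp add: hd_conv_nth last_conv_nth insert_commute)
  next
    case False
    then show ?thesis using that p(1) by (simp add: undirected_path_def nth_append)
  qed
  moreover have "distinct (es @ [e])" "distinct vs" "set (es @ [e]) \<subseteq> arcs G"
    using p e by (auto simp: undirected_path_def)
  ultimately show ?thesis unfolding undirected_cycle_def using len by simp
qed

text \<open>An arc outside a spanning tree would close the tree path between its ends to a cycle, of
  length two if it is parallel to a tree arc. So the spanning tree already uses every arc.\<close>

lemma undirected_tree_grown:
  assumes "undirected_tree G" "fin_digraph G" "r \<in> verts G"
  shows "grown_tree G r (verts G) (arcs G)"
proof -
  interpret fin_digraph G by fact
  obtain F where F: "grown_tree G r (verts G) F"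
    using spanning_grown_tree[of G r] assms unfolding undirected_tree_def by blast
  have "arcs G \<subseteq> F"
  proof
    fix e assume e: "e \<in> arcs G"
    obtain vs es where p: "undirected_path G vs es" "set es \<subseteq> F" "hd vs = tail G e" "last vs = head G e"
      using grown_tree_path[OF F tail_in_verts[OF e] head_in_verts[OF e]] by blast
    show "e \<in> F"
    proof (rule ccontr)
      assume "e \<notin> F"
      then have "undirected_cycle G vs (es @ [e])"
        using p e grown_treeD(4)[OF F] by (intro undirected_path_close) (simp_all, blast+)
      then show False using assms(1) by (auto simp: undirected_tree_def)
    qed
  qed
  then show ?thesis using F grown_treeD(4)[OF F] by (metis subset_antisym)
qed

section \<open>Pruning a tree\<close>

text \<open>
  Here \<open>u\<close> is the value of an arc function with frequency \<open>k\<close> at one end of the arc, \<open>q\<close> its outward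
  derivative there divided by \<open>k\<close>, and \<open>u'\<close>, \<open>q'\<close> are the same data at the other end, where
  \<open>\<theta>\<close> is \<open>k\<close> times the length. Outward derivatives make the relation independent of the orientation.
\<close>

definition arc_relation :: "real \<Rightarrow> complex \<Rightarrow> complex \<Rightarrow> complex \<Rightarrow> complex \<Rightarrow> bool" where
  "arc_relation \<theta> u q u' q' \<longleftrightarrow>
     u' = of_real (cos \<theta>) * u - of_real (sin \<theta>) * q \<and>
     q' = - of_real (sin \<theta>) * u - of_real (cos \<theta>) * q"

text \<open>The matrix taking \<open>(u, q)\<close> to \<open>(u', q')\<close> is a reflection,
  hence its own inverse.\<close>

lemma arc_relation_sym:
  assumes "arc_relation \<theta> u q u' q'"
  shows "arc_relation \<theta> u' q' u q"
proof -
  define c s where "c = complex_of_real (cos \<theta>)" and "s = complex_of_real (sin \<theta>)"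
  have 1: "c * c + s * s = 1"
    unfolding c_def s_def of_real_mult[symmetric] of_real_add[symmetric]
    by (metis of_real_1 power2_eq_square sin_cos_squared_add2)
  have "u' = c * u - s * q" "q' = - s * u - c * q"
    using assms unfolding arc_relation_def c_def s_def by auto
  moreover have "u = c * (c * u - s * q) - s * (- s * u - c * q)"
    "q = - s * (c * u - s * q) - c * (- s * u - c * q)"
    using 1 by algebra+
  ultimately show ?thesis unfolding arc_relation_def c_def s_def by blast
qed

text \<open>Stated relative to a subtree \<open>(W, F)\<close> so that it makes sense after a leaf
  is removed. As \<open>q\<close> is the outward derivative over the frequency \<open>k\<close>, the
  role of \<open>\<beta> v\<close> is that of \<open>\<alpha> v / k\<close>.\<close>

definition discrete_solution :: "('v, 'e) pre_digraph \<Rightarrow> ('e \<Rightarrow> real) \<Rightarrow> 'v set \<Rightarrow> 'e set \<Rightarrow>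
    ('v \<Rightarrow> real) \<Rightarrow> ('v \<Rightarrow> complex) \<Rightarrow> ('e \<Rightarrow> 'v \<Rightarrow> complex) \<Rightarrow> bool" where
  "discrete_solution G \<theta> W F \<beta> u q \<longleftrightarrow>
     (\<forall>e\<in>F. arc_relation (\<theta> e) (u (tail G e)) (q e (tail G e)) (u (head G e)) (q e (head G e))) \<and>
     (\<forall>v\<in>W. (\<Sum>e\<in>F \<inter> incident_arcs G v. q e v) = of_real (\<beta> v) * u v)"

text \<open>Transport of a Pruefer angle: if \<open>q = t * u\<close> at one end of an arc, then
  \<open>q' = - tan (\<theta> + arctan t) * u'\<close> at the other. The denominators are cleared so
  that the factor relating \<open>u'\<close> to \<open>u\<close> is visible.\<close>

lemma tan_arctan_shift:
  fixes \<theta> t :: real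
  assumes "cos (\<theta> + arctan t) \<noteq> 0"
  shows "cos \<theta> - t * sin \<theta> \<noteq> 0"
    and "tan (\<theta> + arctan t) * (cos \<theta> - t * sin \<theta>) = sin \<theta> + t * cos \<theta>"
proof -
  have c: "cos (arctan t) \<noteq> 0" by (metis cos_arctan_not_zero)
  have s: "sin (arctan t) = t * cos (arctan t)" using c tan_arctan[of t] by (simp add: tan_def field_simps)
  have 1: "cos (\<theta> + arctan t) = (cos \<theta> - t * sin \<theta>) * cos (arctan t)"
    and 2: "sin (\<theta> + arctan t) = (sin \<theta> + t * cos \<theta>) * cos (arctan t)"
    by (simp_all add: cos_add sin_add s algebra_simps)
  show D: "cos \<theta> - t * sin \<theta> \<noteq> 0" using assms unfolding 1 by auto
  show "tan (\<theta> + arctan t) * (cos \<theta> - t * sin \<theta>) = sin \<theta> + t * cos \<theta>"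
    unfolding tan_def 1 2 using D c by (simp add: field_simps)
qed

section \<open>Eliminating one leaf and putting it back\<close>

context
  fixes G :: "('v, 'e) pre_digraph" and \<theta> :: "'e \<Rightarrow> real" and \<beta> :: "'v \<Rightarrow> real"
    and W :: "'v set" and F :: "'e set" and e :: 'e and w v :: 'v
  assumes F: "finite F" "\<And>e. e \<in> F \<Longrightarrow> tail G e \<in> W \<and> head G e \<in> W"
    and e: "e \<in> arcs G" "{tail G e, head G e} = {w, v}" "w \<in> W" "v \<notin> W"
    and cos0: "cos (\<theta> e + arctan (\<beta> v)) \<noteq> 0"
begin

lemma leaf_arcs:
  "e \<notin> F" "w \<noteq> v" "insert e F \<inter> incident_arcs G v = {e}"
  "insert e F \<inter> incident_arcs G w = insert e (F \<inter> incident_arcs G w)"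
  "y \<in> W \<Longrightarrow> y \<noteq> w \<Longrightarrow> insert e F \<inter> incident_arcs G y = F \<inter> incident_arcs G y"
  using F e by (auto simp: incident_arcs_iff doubleton_eq_iff)

lemma leaf_arc_relation:
  "arc_relation (\<theta> e) (u (tail G e)) (q e (tail G e)) (u (head G e)) (q e (head G e)) \<longleftrightarrow>
   arc_relation (\<theta> e) (u v) (q e v) (u w) (q e w)"
  using e(2) arc_relation_sym by (auto simp: doubleton_eq_iff)

text \<open>A leaf has one arc, so its condition reads \<open>q e v = \<beta> v * u v\<close>.
  Transported to \<open>w\<close>, it makes the flux of \<open>e\<close> a multiple of
  \<open>u w\<close>, which moves to the other side as a shift of the coupling. The remaining
  conclusions recover the leaf data from \<open>w\<close>.\<close>

lemma leaf_eliminate: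
  assumes "discrete_solution G \<theta> (insert v W) (insert e F) \<beta> u q"
  shows "discrete_solution G \<theta> W F (\<beta>(w := \<beta> w + tan (\<theta> e + arctan (\<beta> v)))) u q"
    and "q e v = of_real (\<beta> v) * u v"
    and "u w = of_real (cos (\<theta> e) - \<beta> v * sin (\<theta> e)) * u v"
    and "arc_relation (\<theta> e) (u v) (q e v) (u w) (q e w)"
proof -
  have rel: "arc_relation (\<theta> e) (u v) (q e v) (u w) (q e w)"
    using assms leaf_arc_relation by (simp add: discrete_solution_def)
  then show "arc_relation (\<theta> e) (u v) (q e v) (u w) (q e w)" .
  show qv: "q e v = of_real (\<beta> v) * u v"
    using assms leaf_arcs(3) by (simp add: discrete_solution_def)
  show uw: "u w = of_real (cos (\<theta> e) - \<beta> v * sin (\<theta> e)) * u v"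
    using rel qv by (simp add: arc_relation_def algebra_simps)
  have "q e w = - of_real (sin (\<theta> e) + \<beta> v * cos (\<theta> e)) * u v"
    using rel qv by (simp add: arc_relation_def algebra_simps)
  also have "\<dots> = - of_real (tan (\<theta> e + arctan (\<beta> v))) * u w"
    unfolding uw tan_arctan_shift(2)[OF cos0, symmetric] by simp
  finally have qw: "q e w = - of_real (tan (\<theta> e + arctan (\<beta> v))) * u w" .
  have "(\<Sum>e\<in>F \<inter> incident_arcs G y. q e y) =
      of_real ((\<beta>(w := \<beta> w + tan (\<theta> e + arctan (\<beta> v)))) y) * u y" if "y \<in> W" for y
  proof (cases "y = w")
    case True
    have "q e w + (\<Sum>e\<in>F \<inter> incident_arcs G w. q e w) = of_real (\<beta> w) * u w"
    proof -
      have "(\<Sum>f\<in>insert e F \<inter> incident_arcs G w. q f w) = of_real (\<beta> w) * u w"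
        using assms e(3) unfolding discrete_solution_def by blast
      then show ?thesis using F(1) leaf_arcs(1) unfolding leaf_arcs(4) by simp
    qed
    then show ?thesis using True qw by (simp add: algebra_simps)
  next
    case False
    have "(\<Sum>f\<in>insert e F \<inter> incident_arcs G y. q f y) = of_real (\<beta> y) * u y"
      using assms \<open>y \<in> W\<close> unfolding discrete_solution_def by blast
    then show ?thesis using False unfolding leaf_arcs(5)[OF \<open>y \<in> W\<close> False] by simp
  qed
  then show "discrete_solution G \<theta> W F (\<beta>(w := \<beta> w + tan (\<theta> e + arctan (\<beta> v)))) u q"
    using assms by (simp add: discrete_solution_def)
qed

text \<open>The leaf value is \<open>u w\<close> divided by the transport factor, which the cosine
  hypothesis makes nonzero; so nonvanishing is inherited by the leaf.\<close>

lemma leaf_extend: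
  assumes sol: "discrete_solution G \<theta> W F (\<beta>(w := \<beta> w + tan (\<theta> e + arctan (\<beta> v)))) u q"
    and nz: "\<forall>x\<in>W. u x \<noteq> 0"
  shows "\<exists>u q. discrete_solution G \<theta> (insert v W) (insert e F) \<beta> u q \<and> (\<forall>x\<in>insert v W. u x \<noteq> 0)"
proof -
  define D where "D = complex_of_real (cos (\<theta> e) - \<beta> v * sin (\<theta> e))"
  have D: "D \<noteq> 0" using tan_arctan_shift(1)[OF cos0] unfolding D_def by (metis of_real_eq_0_iff)
  define u' where "u' = u(v := u w / D)"
  define q' where "q' = q(e := (\<lambda>x. if x = v then of_real (\<beta> v) * u' v
    else - of_real (tan (\<theta> e + arctan (\<beta> v))) * u w))"
  have u'W: "u' x = u x" if "x \<in> W" for x using that e(4) by (auto simp: u'_def)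
  have q'F: "q' f = q f" if "f \<in> F" for f using that leaf_arcs(1) by (auto simp: q'_def)
  have uw: "u' w = D * u' v" using D leaf_arcs(2) by (simp add: u'_def)
  have qv: "q' e v = of_real (\<beta> v) * u' v" by (simp add: q'_def)
  have qw: "q' e w = - of_real (tan (\<theta> e + arctan (\<beta> v))) * u' w"
    using leaf_arcs(2) u'W[OF e(3)] by (simp add: q'_def)
  also have "\<dots> = - of_real (sin (\<theta> e) + \<beta> v * cos (\<theta> e)) * u' v"
    unfolding uw tan_arctan_shift(2)[OF cos0, symmetric] D_def by simp
  finally have qw': "q' e w = - of_real (sin (\<theta> e) + \<beta> v * cos (\<theta> e)) * u' v" .
  have rel: "arc_relation (\<theta> e) (u' v) (q' e v) (u' w) (q' e w)"
    unfolding arc_relation_def using uw qv qw' by (simp add: D_def algebra_simps)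
  have "arc_relation (\<theta> f) (u' (tail G f)) (q' f (tail G f)) (u' (head G f)) (q' f (head G f))"
    if "f \<in> insert e F" for f
  proof (cases "f = e")
    case True then show ?thesis using rel leaf_arc_relation by simp
  next
    case False
    then show ?thesis using that sol F(2) u'W q'F by (auto simp: discrete_solution_def)
  qed
  moreover have "(\<Sum>f\<in>insert e F \<inter> incident_arcs G y. q' f y) = of_real (\<beta> y) * u' y"
    if "y \<in> insert v W" for y
  proof -
    consider "y = v" | "y = w" | "y \<in> W" "y \<noteq> w" using \<open>y \<in> insert v W\<close> by auto
    then show ?thesis
    proof cases
      case 1 then show ?thesis using leaf_arcs(3) qv by simp
    next
      case 2
      have "(\<Sum>f\<in>F \<inter> incident_arcs G w. q' f w) = (\<Sum>f\<in>F \<inter> incident_arcs G w. q f w)"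
        using q'F by (intro sum.cong) auto
      also have "\<dots> = of_real (\<beta> w + tan (\<theta> e + arctan (\<beta> v))) * u w"
        using sol e(3) by (simp add: discrete_solution_def)
      finally show ?thesis using 2 leaf_arcs(1,4) F(1) qw u'W[OF e(3)] by (simp add: algebra_simps)
    next
      case 3
      have "(\<Sum>f\<in>F \<inter> incident_arcs G y. q' f y) = (\<Sum>f\<in>F \<inter> incident_arcs G y. q f y)"
        using q'F by (intro sum.cong) auto
      also have "\<dots> = of_real (\<beta> y) * u y"
        using sol 3 by (simp add: discrete_solution_def)
      finally show ?thesis using leaf_arcs(5)[OF 3] u'W[OF 3(1)] by simp
    qed
  qed
  ultimately have "discrete_solution G \<theta> (insert v W) (insert e F) \<beta> u' q'"
    by (auto simp: discrete_solution_def)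
  moreover have "\<forall>x\<in>insert v W. u' x \<noteq> 0" using nz D e(3) by (auto simp: u'_def)
  ultimately show ?thesis by blast
qed

end

lemma cos_ge_half:
  fixes x :: real assumes "\<bar>x\<bar> \<le> 1" shows "cos x \<ge> 1/2"
proof -
  have "cos (pi/3) \<le> cos \<bar>x\<bar>"
    using assms pi_gt3 by (intro cos_monotone_0_pi_le) auto
  then show ?thesis by (simp add: cos_60 abs_if split: if_splits)
qed

lemma abs_tan_le:
  fixes x :: real assumes "\<bar>x\<bar> \<le> 1" shows "\<bar>tan x\<bar> \<le> 2 * \<bar>x\<bar>"
proof -
  have c: "cos x \<ge> 1/2" using cos_ge_half assms .
  have "\<bar>sin x\<bar> \<le> \<bar>x\<bar>" by (rule abs_sin_x_le_abs_x)
  also have "\<dots> \<le> 2 * \<bar>x\<bar> * cos x" using mult_left_mono[OF c, of "2 * \<bar>x\<bar>"] by simp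
  finally show ?thesis using c by (simp add: tan_def abs_divide pos_divide_le_eq)
qed

lemma tan_ge_self:
  fixes x :: real assumes "0 \<le> x" "x \<le> 1" shows "x \<le> tan x"
proof -
  have "x < pi/2" using assms pi_gt3 by simp
  then have "arctan (tan x) = x" using assms pi_gt_zero by (intro arctan_tan) auto
  moreover have "0 \<le> tan x" using assms \<open>x < pi/2\<close> by (intro tan_pos_pi2_le) auto
  ultimately show ?thesis using abs_arctan_le[of "tan x"] by auto
qed

text \<open>
  The root phase is a continuous function of the spectral parameter that changes sign, and its zeros
  are the eigenvalues. Pruning a leaf merges its Pruefer angle into the coupling at its neighbour;
  the coupling bound then at most triples, hence the factor \<open>3 ^ card W\<close>.
\<close>

lemma grown_tree_solution:
  fixes G :: "('v, 'e) pre_digraph" and \<theta> :: "'e \<Rightarrow> real \<Rightarrow> real" and \<beta> :: "'v \<Rightarrow> real \<Rightarrow> real"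
  assumes "grown_tree G r W F" "a \<le> b" "0 < \<tau>" "0 \<le> h"
    and "0 \<le> B" "(B + h) * 3 ^ card W \<le> 1"
    and "\<And>e. e \<in> F \<Longrightarrow> continuous_on {a..b} (\<theta> e)" "\<And>e k. e \<in> F \<Longrightarrow> k \<in> {a..b} \<Longrightarrow> \<bar>\<theta> e k\<bar> \<le> h"
    and "\<And>e. e \<in> F \<Longrightarrow> \<theta> e a \<le> -\<tau>" "\<And>e. e \<in> F \<Longrightarrow> \<tau> \<le> \<theta> e b"
    and "\<And>v. v \<in> W \<Longrightarrow> continuous_on {a..b} (\<beta> v)" "\<And>v k. v \<in> W \<Longrightarrow> k \<in> {a..b} \<Longrightarrow> \<bar>\<beta> v k\<bar> \<le> B"
    and "\<And>v. v \<in> W \<Longrightarrow> \<beta> v a \<le> \<tau>/2" "\<And>v. v \<in> W \<Longrightarrow> -\<tau>/2 \<le> \<beta> v b"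
    and "F = {} \<Longrightarrow> \<beta> r a \<le> 0 \<and> 0 \<le> \<beta> r b"
  shows "\<exists>k\<in>{a..b}.
    (\<exists>u q. discrete_solution G (\<lambda>e. \<theta> e k) W F (\<lambda>v. \<beta> v k) u q \<and> (\<forall>v\<in>W. u v \<noteq> 0)) \<and>
    (\<forall>u q. discrete_solution G (\<lambda>e. \<theta> e k) W F (\<lambda>v. \<beta> v k) u q \<longrightarrow> u r = 0 \<longrightarrow>
       (\<forall>v\<in>W. u v = 0) \<and> (\<forall>e\<in>F. q e (tail G e) = 0))"
  using assms(1,5-)
proof (induct arbitrary: \<beta> B)
  case root
  \<comment> \<open>With a single vertex left the flux sum is empty and the condition reads
    \<open>\<beta> r k * u r = 0\<close>, so a zero of the accumulated root coupling admits the
    value 1.\<close>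
  obtain k where k: "k \<in> {a..b}" "\<beta> r k = 0"
    using IVT'[of "\<beta> r" a 0 b] root assms(2) by auto
  then have "discrete_solution G (\<lambda>e. \<theta> e k) {r} {} (\<lambda>v. \<beta> v k) (\<lambda>_. 1) (\<lambda>_ _. 0)"
    by (simp add: discrete_solution_def)
  then show ?case using k(1) by (intro bexI[of _ k]) auto
next
  case (grow W F e w v)
  note prems = grow(7-)
  have W: "finite W" "finite F" "r \<in> W" and Fends: "\<And>e. e \<in> F \<Longrightarrow> tail G e \<in> W \<and> head G e \<in> W"
    using grown_treeD[OF grow(1)] by auto
  define x where "x = (\<lambda>k. \<theta> e k + arctan (\<beta> v k))"
  define \<beta>' where "\<beta>' = (\<lambda>y k. if y = w then \<beta> w k + tan (x k) else \<beta> y k)"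
  have upd: "(\<lambda>y. \<beta>' y k) = (\<lambda>y. \<beta> y k)(w := \<beta> w k + tan (\<theta> e k + arctan (\<beta> v k)))" for k
    by (auto simp: \<beta>'_def x_def)
  have "card (insert v W) = Suc (card W)" using grow(6) W(1) by simp
  then have B3: "(B + h) * 3 * 3 ^ card W \<le> 1" using prems(2) by (simp only: power_Suc mult.assoc)
  moreover have "(B + h) * 3 * 1 \<le> (B + h) * 3 * 3 ^ card W"
    using prems(1) assms(4) by (intro mult_left_mono) auto
  ultimately have "(B + h) * 3 * 1 \<le> 1" by (rule order_trans[rotated])
  then have "B * 3 + h * 3 \<le> 1" by (simp add: distrib_right)
  then have Bh: "B + h \<le> 1" using prems(1) assms(4) by linarith
  have xb: "\<bar>x k\<bar> \<le> B + h" if "k \<in> {a..b}" for k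
    using prems(4)[OF insertI1 that] prems(8)[OF insertI1 that] abs_arctan_le[of "\<beta> v k"]
    unfolding x_def by linarith
  have cosx: "cos (\<theta> e k + arctan (\<beta> v k)) \<noteq> 0" if "k \<in> {a..b}" for k
    using cos_ge_half[of "x k"] xb[OF that] Bh unfolding x_def by auto
  have ab: "a \<in> {a..b}" "b \<in> {a..b}" using assms(2) by auto
  \<comment> \<open>Since \<open>arctan\<close> preserves signs and does not increase absolute
    values, a coupling of at least \<open>-\<tau>/2\<close> costs at most half of the phase margin
    \<open>\<tau>\<close>; \<open>tan\<close> keeps the remaining \<open>\<tau>/2\<close>. The left
    end is symmetric.\<close>
  have "0 \<le> arctan (\<beta> v b) \<or> \<beta> v b < 0" by simp linarith
  then have "arctan (\<beta> v b) \<ge> -\<tau>/2"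
    using prems(10)[OF insertI1] abs_arctan_le[of "\<beta> v b"] assms(3) by linarith
  then have "x b \<ge> \<tau>/2" using prems(6)[OF insertI1] unfolding x_def by linarith
  then have tb: "tan (x b) \<ge> \<tau>/2"
    using tan_ge_self[of "x b"] xb[OF ab(2)] Bh assms(3) by linarith
  have "arctan (\<beta> v a) \<le> 0 \<or> 0 < \<beta> v a" by simp linarith
  then have "arctan (\<beta> v a) \<le> \<tau>/2"
    using prems(9)[OF insertI1] abs_arctan_le[of "\<beta> v a"] assms(3) by linarith
  then have "x a \<le> -\<tau>/2" using prems(5)[OF insertI1] unfolding x_def by linarith
  then have ta: "tan (x a) \<le> -\<tau>/2"
    using tan_ge_self[of "- x a"] xb[OF ab(1)] Bh assms(3) by auto
  have cx: "continuous_on {a..b} x"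
    unfolding x_def by (intro continuous_intros prems(3,7)) auto
  have "\<exists>k\<in>{a..b}.
    (\<exists>u q. discrete_solution G (\<lambda>e. \<theta> e k) W F (\<lambda>v. \<beta>' v k) u q \<and> (\<forall>v\<in>W. u v \<noteq> 0)) \<and>
    (\<forall>u q. discrete_solution G (\<lambda>e. \<theta> e k) W F (\<lambda>v. \<beta>' v k) u q \<longrightarrow> u r = 0 \<longrightarrow>
       (\<forall>v\<in>W. u v = 0) \<and> (\<forall>e\<in>F. q e (tail G e) = 0))"
  \<comment> \<open>\<open>\<bar>tan x\<bar> \<le> 2 * (B + h)\<close> turns the coupling bound at
    \<open>w\<close> into \<open>B + 2 * (B + h)\<close>. It is the quantity \<open>B + h\<close>
    that exactly triples, offset by the vertex removed from \<open>W\<close>.\<close>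
  proof (rule grow(2)[where B = "3 * B + 2 * h"])
    show "0 \<le> 3 * B + 2 * h" using prems(1) assms(4) by simp
    show "(3 * B + 2 * h + h) * 3 ^ card W \<le> 1" using B3 by (simp add: algebra_simps)
    show "continuous_on {a..b} (\<beta>' y)" if "y \<in> W" for y
    proof (cases "y = w")
      case True
      have "continuous_on {a..b} (\<lambda>k. \<beta> w k + tan (x k))"
        using cosx grow(5) by (intro continuous_intros prems(7) cx) (auto simp: x_def)
      then show ?thesis using True by (simp add: \<beta>'_def)
    next
      case False
      then show ?thesis using prems(7)[of y] that by (simp add: \<beta>'_def)
    qed
    show "\<bar>\<beta>' y k\<bar> \<le> 3 * B + 2 * h" if "y \<in> W" "k \<in> {a..b}" for y k
      using prems(8)[of y k] that abs_tan_le[of "x k"] xb[OF that(2)] Bh assms(4) prems(1)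
      unfolding \<beta>'_def by (auto simp: abs_le_iff)
    show "\<beta>' y a \<le> \<tau>/2" if "y \<in> W" for y
      using prems(9)[of y] that ta assms(3) unfolding \<beta>'_def by auto
    show "-\<tau>/2 \<le> \<beta>' y b" if "y \<in> W" for y
      using prems(10)[of y] that tb assms(3) unfolding \<beta>'_def by auto
    \<comment> \<open>Exact signs are demanded only once no arc is left. Here the slack is consumed:
      the coupling bound \<open>\<tau>/2\<close> at the root and the tangent bound
      \<open>-\<tau>/2\<close> from the last leaf cancel.\<close>
    show "\<beta>' r a \<le> 0 \<and> 0 \<le> \<beta>' r b" if "F = {}"
    proof -
      have "W = {r}" using grow(1) that by (cases rule: grown_tree.cases) auto
      then have "w = r" using grow(5) by auto
      then show ?thesis using prems(9)[of r] prems(10)[of r] W(3) ta tb by (auto simp: \<beta>'_def)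
    qed
  qed (use prems in auto)
  then obtain k u q where k: "k \<in> {a..b}"
    and sol: "discrete_solution G (\<lambda>e. \<theta> e k) W F (\<lambda>v. \<beta>' v k) u q" "\<forall>v\<in>W. u v \<noteq> 0"
    and uniq: "\<And>u q. discrete_solution G (\<lambda>e. \<theta> e k) W F (\<lambda>v. \<beta>' v k) u q \<Longrightarrow> u r = 0 \<Longrightarrow>
       (\<forall>v\<in>W. u v = 0) \<and> (\<forall>e\<in>F. q e (tail G e) = 0)" by blast
  have ex: "\<exists>u q. discrete_solution G (\<lambda>e. \<theta> e k) (insert v W) (insert e F) (\<lambda>v. \<beta> v k) u q \<and>
      (\<forall>x\<in>insert v W. u x \<noteq> 0)"
    using leaf_extend[of F G W e w v "\<lambda>e. \<theta> e k" "\<lambda>v. \<beta> v k"] W(2) Fends grow(3-6) cosx[OF k]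
      sol unfolding upd by blast
  have un: "(\<forall>y\<in>insert v W. u y = 0) \<and> (\<forall>f\<in>insert e F. q f (tail G f) = 0)"
    if *: "discrete_solution G (\<lambda>e. \<theta> e k) (insert v W) (insert e F) (\<lambda>v. \<beta> v k) u q" "u r = 0" for u q
  proof -
    note el = leaf_eliminate[of F G W e w v "\<lambda>e. \<theta> e k" "\<lambda>v. \<beta> v k", OF W(2) Fends grow(3-6) cosx[OF k] *(1)]
    have 0: "(\<forall>y\<in>W. u y = 0) \<and> (\<forall>e\<in>F. q e (tail G e) = 0)"
      using uniq[of u q] el(1) *(2) unfolding upd by blast
    \<comment> \<open>Zero data travel back to the leaf because \<open>u w\<close> is a nonzero
      multiple of \<open>u v\<close>.\<close>
    then have "u w = 0" using grow(5) by auto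
    then have "u v = 0"
      using el(3) tan_arctan_shift(1)[OF cosx[OF k]] by (metis mult_eq_0_iff of_real_eq_0_iff)
    moreover from this have "q e v = 0" "q e w = 0"
      using el(2,4) by (auto simp: arc_relation_def)
    ultimately show ?thesis using 0 grow(4) by (auto simp: doubleton_eq_iff)
  qed
  show ?case using k ex un by blast
qed

section \<open>The vertex form\<close>

text \<open>
  The vertex form of the Dirichlet-to-Neumann map: its gradient in the value at a vertex is twice the
  defect in the coupling condition there. Arcs with \<open>sin (\<theta> e) = 0\<close> contribute the junk value \<open>0\<close>.
\<close>

definition arc_form :: "real \<Rightarrow> real \<Rightarrow> real \<Rightarrow> real" where
  "arc_form \<theta> x y = (cos \<theta> * (x\<^sup>2 + y\<^sup>2) - 2 * x * y) / sin \<theta>"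

definition graph_form :: "('v, 'e) pre_digraph \<Rightarrow> ('e \<Rightarrow> real) \<Rightarrow> ('v \<Rightarrow> real) \<Rightarrow> ('v \<Rightarrow> real) \<Rightarrow> real" where
  "graph_form G \<theta> \<beta> u =
     (\<Sum>e\<in>arcs G. arc_form (\<theta> e) (u (tail G e)) (u (head G e))) - (\<Sum>v\<in>verts G. \<beta> v * (u v)\<^sup>2)"

definition opposite_end :: "('v, 'e) pre_digraph \<Rightarrow> 'e \<Rightarrow> 'v \<Rightarrow> 'v" where
  "opposite_end G e v = (if v = tail G e then head G e else tail G e)"

text \<open>This is \<open>q\<close> solved from the first equation of \<open>arc_relation\<close>:
  the normalised outward derivative at \<open>v\<close> of the arc function with the given end
  values.\<close>

definition arc_flux :: "('v, 'e) pre_digraph \<Rightarrow> ('e \<Rightarrow> real) \<Rightarrow> ('v \<Rightarrow> real) \<Rightarrow> 'e \<Rightarrow> 'v \<Rightarrow> real" where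
  "arc_flux G \<theta> u e v = (cos (\<theta> e) * u v - u (opposite_end G e v)) / sin (\<theta> e)"

text \<open>Separates the difference energy, whose weight blows up at small angles, from a diagonal
  term whose coefficient \<open>tan (\<theta> / 2)\<close> stays small there.\<close>

lemma arc_form_eq_diff:
  assumes "sin \<theta> \<noteq> 0"
  shows "arc_form \<theta> x y = (x - y)\<^sup>2 / sin \<theta> - (1 - cos \<theta>) / sin \<theta> * (x\<^sup>2 + y\<^sup>2)"
  using assms by (simp add: arc_form_def field_simps power2_eq_square)

text \<open>Only the mixed term sees signs, and its coefficient is negative when the sine is
  positive. This is the Perron-Frobenius property of the form.\<close>

lemma arc_form_abs_le:
  assumes "sin \<theta> > 0"
  shows "arc_form \<theta> \<bar>x\<bar> \<bar>y\<bar> \<le> arc_form \<theta> x y"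
proof -
  have "x * y \<le> \<bar>x\<bar> * \<bar>y\<bar>" by (metis abs_ge_self abs_mult)
  then show ?thesis unfolding arc_form_def using assms by (intro divide_right_mono) auto
qed

lemma arc_form_scale: "arc_form \<theta> (c * x) (c * y) = c\<^sup>2 * arc_form \<theta> x y"
  by (simp add: arc_form_def power_mult_distrib algebra_simps power2_eq_square add_divide_distrib diff_divide_distrib)

lemma graph_form_scale: "graph_form G \<theta> \<beta> (\<lambda>v. c * u v) = c\<^sup>2 * graph_form G \<theta> \<beta> u"
  by (simp add: graph_form_def arc_form_scale sum_distrib_left right_diff_distrib power_mult_distrib
      mult.left_commute)

lemma graph_form_abs_le:
  assumes "\<And>e. e \<in> arcs G \<Longrightarrow> sin (\<theta> e) > 0"
  shows "graph_form G \<theta> \<beta> (\<lambda>v. \<bar>u v\<bar>) \<le> graph_form G \<theta> \<beta> u"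
  unfolding graph_form_def by (simp, intro sum_mono arc_form_abs_le assms)

text \<open>Exact expansion of the form in a single vertex value. Without loops an arc changes at
  only one end, so no mixed second-order term occurs.\<close>

lemma graph_form_update:
  assumes "fin_digraph G" "loopfree_digraph G" "v \<in> verts G"
  shows "graph_form G \<theta> \<beta> (u(v := u v + t)) =
    graph_form G \<theta> \<beta> u + 2 * t * ((\<Sum>e\<in>incident_arcs G v. arc_flux G \<theta> u e v) - \<beta> v * u v) +
    t\<^sup>2 * ((\<Sum>e\<in>incident_arcs G v. cos (\<theta> e) / sin (\<theta> e)) - \<beta> v)"
proof -
  interpret fin_digraph G by fact
  interpret loopfree_digraph G by fact
  let ?u = "u(v := u v + t)"
  have inc: "incident_arcs G v = {e \<in> arcs G. e \<in> incident_arcs G v}"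
    by (auto simp: incident_arcs_iff)
  have "arc_form (\<theta> e) (?u (tail G e)) (?u (head G e)) =
      arc_form (\<theta> e) (u (tail G e)) (u (head G e)) +
      (if e \<in> incident_arcs G v then 2 * t * arc_flux G \<theta> u e v + t\<^sup>2 * (cos (\<theta> e) / sin (\<theta> e)) else 0)"
    if e: "e \<in> arcs G" for e
  proof (cases "sin (\<theta> e) = 0")
    case True
    then show ?thesis by (simp add: arc_form_def arc_flux_def)
  next
    case False
    have "tail G e \<noteq> head G e" using no_loops e by auto
    then show ?thesis using False e
      by (auto simp: arc_form_def arc_flux_def incident_arcs_iff opposite_end_def field_simps power2_eq_square)
  qed
  then have "(\<Sum>e\<in>arcs G. arc_form (\<theta> e) (?u (tail G e)) (?u (head G e))) =
      (\<Sum>e\<in>arcs G. arc_form (\<theta> e) (u (tail G e)) (u (head G e))) +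
      (\<Sum>e\<in>arcs G. if e \<in> incident_arcs G v then 2 * t * arc_flux G \<theta> u e v + t\<^sup>2 * (cos (\<theta> e) / sin (\<theta> e)) else 0)"
    by (simp add: sum.distrib)
  also have "(\<Sum>e\<in>arcs G. if e \<in> incident_arcs G v then 2 * t * arc_flux G \<theta> u e v + t\<^sup>2 * (cos (\<theta> e) / sin (\<theta> e)) else 0)
      = (\<Sum>e\<in>incident_arcs G v. 2 * t * arc_flux G \<theta> u e v + t\<^sup>2 * (cos (\<theta> e) / sin (\<theta> e)))"
    by (subst (2) inc) (rule sum.inter_filter[symmetric], simp)
  also have "\<dots> = 2 * t * (\<Sum>e\<in>incident_arcs G v. arc_flux G \<theta> u e v) +
      t\<^sup>2 * (\<Sum>e\<in>incident_arcs G v. cos (\<theta> e) / sin (\<theta> e))"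
    by (simp only: sum.distrib sum_distrib_left)
  finally have arcs: "(\<Sum>e\<in>arcs G. arc_form (\<theta> e) (?u (tail G e)) (?u (head G e))) =
      (\<Sum>e\<in>arcs G. arc_form (\<theta> e) (u (tail G e)) (u (head G e))) +
      (2 * t * (\<Sum>e\<in>incident_arcs G v. arc_flux G \<theta> u e v) +
      t\<^sup>2 * (\<Sum>e\<in>incident_arcs G v. cos (\<theta> e) / sin (\<theta> e)))" .
  have "(\<Sum>x\<in>verts G. \<beta> x * (?u x)\<^sup>2) = \<beta> v * (u v + t)\<^sup>2 + (\<Sum>x\<in>verts G - {v}. \<beta> x * (u x)\<^sup>2)"
    using assms(3) by (subst sum.remove[of _ v]) (auto intro!: sum.cong)
  also have "\<dots> = (\<Sum>x\<in>verts G. \<beta> x * (u x)\<^sup>2) + 2 * t * (\<beta> v * u v) + t\<^sup>2 * \<beta> v"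
    using assms(3) by (subst (2) sum.remove[of _ v]) (auto simp: algebra_simps power2_eq_square)
  finally show ?thesis unfolding graph_form_def arcs by (simp add: algebra_simps)
qed

lemma nonneg_quadratic_linear_zero:
  fixes b c :: real
  assumes "\<And>t. 0 \<le> 2 * t * b + t\<^sup>2 * c"
  shows "b = 0"
proof (rule ccontr)
  assume b: "b \<noteq> 0"
  \<comment> \<open>\<open>d\<close> is positive and larger than \<open>c\<close>, so at
    \<open>t = - b / d\<close> the linear term dominates whatever the sign of
    \<open>c\<close>.\<close>
  define d where "d = \<bar>c\<bar> + 1"
  have d: "d > 0" "c < d" by (auto simp: d_def)
  have "2 * (- b / d) * b + (- b / d)\<^sup>2 * c = (b\<^sup>2 / d) * (c / d - 2)"
    using d by (simp add: field_simps power2_eq_square)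
  moreover have "c / d < 1" using d by simp
  then have "c / d - 2 < 0" by linarith
  then have "(b\<^sup>2 / d) * (c / d - 2) < 0" using b d(1) by (intro mult_pos_neg) auto
  ultimately show False using assms[of "- b / d"] by linarith
qed

text \<open>Here \<open>u\<close> minimises the form among vectors vanishing on \<open>VD\<close>,
  so the derivative in each free vertex value is zero.\<close>

lemma graph_form_null_flux:
  assumes G: "fin_digraph G" "loopfree_digraph G"
    and nonneg: "\<And>w. (\<And>v. v \<in> VD \<Longrightarrow> w v = 0) \<Longrightarrow> graph_form G \<theta> \<beta> w \<ge> 0"
    and u: "graph_form G \<theta> \<beta> u = 0" "\<And>v. v \<in> VD \<Longrightarrow> u v = 0"
    and v: "v \<in> verts G - VD"
  shows "(\<Sum>e\<in>incident_arcs G v. arc_flux G \<theta> u e v) = \<beta> v * u v"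
proof -
  have "0 \<le> 2 * t * ((\<Sum>e\<in>incident_arcs G v. arc_flux G \<theta> u e v) - \<beta> v * u v) +
    t\<^sup>2 * ((\<Sum>e\<in>incident_arcs G v. cos (\<theta> e) / sin (\<theta> e)) - \<beta> v)" for t
  proof -
    have "graph_form G \<theta> \<beta> (u(v := u v + t)) \<ge> 0"
      by (rule nonneg) (use u(2) v in auto)
    then show ?thesis using graph_form_update[OF G, of v \<theta> \<beta> u t] u(1) v by simp
  qed
  from nonneg_quadratic_linear_zero[OF this] show ?thesis by simp
qed

text \<open>Perron--Frobenius: a nonnegative null vector cannot vanish at a vertex without vanishing at its neighbours.\<close>

lemma null_vector_positive:
  assumes G: "fin_digraph G" "loopfree_digraph G" "Digraph_Component.connected G"
    and VD: "\<And>v. v \<in> VD \<Longrightarrow> vertex_degree G v = 1"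
      "\<And>e. e \<in> arcs G \<Longrightarrow> tail G e \<in> VD \<Longrightarrow> head G e \<notin> VD"
    and sin: "\<And>e. e \<in> arcs G \<Longrightarrow> sin (\<theta> e) > 0"
    and w: "\<And>v. w v \<ge> 0" "\<And>v. v \<in> VD \<Longrightarrow> w v = 0"
    and flux: "\<And>v. v \<in> verts G - VD \<Longrightarrow> (\<Sum>e\<in>incident_arcs G v. arc_flux G \<theta> w e v) = \<beta> v * w v"
    and nz: "\<exists>v\<in>verts G. w v \<noteq> 0" and v: "v \<in> verts G - VD"
  shows "w v > 0"
proof (rule ccontr)
  assume "\<not> w v > 0"
  then have wv: "w v = 0" using w(1)[of v] by linarith
  interpret fin_digraph G by fact
  interpret loopfree_digraph G by fact
  have fin: "finite (incident_arcs G x)" for x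
    by (rule finite_subset[of _ "arcs G"]) (auto simp: incident_arcs_iff)
  \<comment> \<open>At a zero of \<open>w\<close> the flux condition becomes a vanishing sum of the
    nonnegative terms \<open>w (opposite_end G e x) / sin (\<theta> e)\<close>.\<close>
  have nbr: "w (opposite_end G e x) = 0" if x: "x \<in> verts G - VD" "w x = 0" "e \<in> incident_arcs G x" for x e
  proof -
    have "(\<Sum>e\<in>incident_arcs G x. w (opposite_end G e x) / sin (\<theta> e)) = 0"
      using flux[OF x(1)] x(2) by (simp add: arc_flux_def sum_negf)
    moreover have "w (opposite_end G e x) / sin (\<theta> e) \<ge> 0" if "e \<in> incident_arcs G x" for e
      using w(1) sin[of e] that by (auto simp: incident_arcs_iff intro: divide_nonneg_pos)
    ultimately have "w (opposite_end G e x) / sin (\<theta> e) = 0"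
      using sum_nonneg_eq_0_iff[OF fin] x(3) by (metis (no_types, lifting))
    then show ?thesis using sin[of e] x(3) by (auto simp: incident_arcs_iff)
  qed
  define the_arc where "the_arc x = (THE e. e \<in> incident_arcs G x)" for x
  have the_arc: "the_arc x = e" if x: "x \<in> VD" "e \<in> incident_arcs G x" for x e
  proof -
    obtain a where "incident_arcs G x = {a}"
      using VD(1)[OF x(1)] by (metis vertex_degree_def card_1_singletonE)
    then show ?thesis using x(2) by (auto simp: the_arc_def)
  qed
  \<comment> \<open>Dirichlet vertices vanish anyway, so mere vanishing need not pass on to
    neighbours. A Dirichlet vertex is instead judged by its only neighbour, which is never Dirichlet
    itself.\<close>
  define W where "W = {x. w (if x \<in> VD then opposite_end G (the_arc x) x else x) = 0}"
  have "verts G \<subseteq> W"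
  proof (rule connected_closed_verts[OF G(3), of v])
    show "v \<in> W" "v \<in> verts G" using v wv by (auto simp: W_def)
    fix e assume e: "e \<in> arcs G"
    then have inc: "e \<in> incident_arcs G (tail G e)" "e \<in> incident_arcs G (head G e)"
      by (auto simp: incident_arcs_iff)
    have ne: "tail G e \<noteq> head G e" using no_loops e by auto
    have opp: "opposite_end G e (tail G e) = head G e" "opposite_end G e (head G e) = tail G e"
      using ne by (auto simp: opposite_end_def)
    have vs: "tail G e \<in> verts G" "head G e \<in> verts G" using e by auto
    consider "tail G e \<in> VD" "head G e \<notin> VD" | "tail G e \<notin> VD" "head G e \<in> VD" | "tail G e \<notin> VD" "head G e \<notin> VD"
      using VD(2)[OF e] by auto
    then show "tail G e \<in> W \<longleftrightarrow> head G e \<in> W"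
    proof cases
      case 1 then show ?thesis using the_arc[OF 1(1) inc(1)] opp by (simp add: W_def)
    next
      case 2 then show ?thesis using the_arc[OF 2(2) inc(2)] opp by (simp add: W_def)
    next
      case 3 then show ?thesis
        using nbr[of "tail G e" e] nbr[of "head G e" e] opp inc vs by (auto simp: W_def)
    qed
  qed
  then have "w x = 0" if "x \<in> verts G" for x using w(2)[of x] that by (auto simp: W_def split: if_splits)
  then show False using nz by auto
qed

text \<open>The type \<open>'v\<close> may be infinite, so vertex functions are pinned to zero off
  \<open>A\<close>; Tychonoff's theorem then gives compactness in the product topology.\<close>

lemma compact_function_cube:
  fixes A :: "'v set"
  shows "compact {u :: 'v \<Rightarrow> real. \<forall>v. u v \<in> (if v \<in> A then {-1..1} else {0})}"
proof -
  have "compactin (product_topology (\<lambda>v::'v. euclidean :: real topology) UNIV)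
      (PiE UNIV (\<lambda>v. if v \<in> A then {-1..1} else {0}))"
    by (subst compactin_PiE) auto
  then show ?thesis
    by (simp add: euclidean_product_topology compactin_euclidean_iff PiE_def Pi_def)
qed

text \<open>The witness is the first parameter at which the form stops being positive definite.\<close>

lemma first_null_vector:
  fixes G :: "('v, 'e) pre_digraph" and \<theta> :: "'e \<Rightarrow> real \<Rightarrow> real" and \<beta> :: "'v \<Rightarrow> real \<Rightarrow> real"
  assumes G: "fin_digraph G" and ab: "a \<le> b"
    and \<theta>: "\<And>e. e \<in> arcs G \<Longrightarrow> continuous_on {a..b} (\<theta> e)"
      "\<And>e k. e \<in> arcs G \<Longrightarrow> k \<in> {a..b} \<Longrightarrow> sin (\<theta> e k) > 0"
    and \<beta>: "\<And>v. v \<in> verts G \<Longrightarrow> continuous_on {a..b} (\<beta> v)"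
    and N: "N = {u. (\<forall>v. v \<notin> verts G - VD \<longrightarrow> u v = 0) \<and> (\<Sum>v\<in>verts G. (u v)\<^sup>2) = 1}"
    and pos: "\<And>u. u \<in> N \<Longrightarrow> graph_form G (\<lambda>e. \<theta> e a) (\<lambda>v. \<beta> v a) u > 0"
    and neg: "\<exists>u\<in>N. graph_form G (\<lambda>e. \<theta> e b) (\<lambda>v. \<beta> v b) u \<le> 0"
  shows "\<exists>k\<in>{a..b}. \<exists>u\<in>N. graph_form G (\<lambda>e. \<theta> e k) (\<lambda>v. \<beta> v k) u = 0 \<and>
     (\<forall>w\<in>N. graph_form G (\<lambda>e. \<theta> e k) (\<lambda>v. \<beta> v k) w \<ge> 0)"
proof -
  interpret fin_digraph G by fact
  define f where "f = (\<lambda>p. graph_form G (\<lambda>e. \<theta> e (fst p)) (\<lambda>v. \<beta> v (fst p)) (snd p))"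
  have co: "continuous_on S (\<lambda>p. snd p v)" for S :: "(real \<times> ('v \<Rightarrow> real)) set" and v
  proof -
    have "continuous_on S ((\<lambda>u. u v) \<circ> snd)"
      by (intro continuous_on_compose continuous_intros continuous_on_subset[OF continuous_on_product_coordinates]) auto
    then show ?thesis by (simp add: comp_def)
  qed
  have cf: "continuous_on ({a..b} \<times> UNIV) f"
  proof -
    have cosc: "continuous_on ({a..b} \<times> (UNIV :: ('v \<Rightarrow> real) set)) (\<lambda>p. cos (\<theta> e (fst p)))"
      and sinc: "continuous_on ({a..b} \<times> (UNIV :: ('v \<Rightarrow> real) set)) (\<lambda>p. sin (\<theta> e (fst p)))"
      if e: "e \<in> arcs G" for e
      by (rule continuous_on_compose2[OF continuous_on_cos[OF \<theta>(1)[OF e]]]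
          continuous_on_compose2[OF continuous_on_sin[OF \<theta>(1)[OF e]]];
          auto intro: continuous_intros)+
    have 2: "continuous_on ({a..b} \<times> (UNIV :: ('v \<Rightarrow> real) set)) (\<lambda>p. \<beta> v (fst p))" if "v \<in> verts G" for v
      by (rule continuous_on_compose2[OF \<beta>[OF that]]) (auto intro: continuous_intros)
    show ?thesis unfolding f_def graph_form_def arc_form_def
    proof (intro continuous_intros cosc sinc 2 co)
      show "\<forall>x\<in>{a..b} \<times> UNIV. sin (\<theta> e (fst x)) \<noteq> 0" if "e \<in> arcs G" for e
        using \<theta>(2)[OF that] by force
    qed auto
  qed
  define C where "C = {u :: 'v \<Rightarrow> real. \<forall>v. u v \<in> (if v \<in> verts G - VD then {-1..1} else {0})}"
  have NC: "u \<in> C" if u: "u \<in> N" for u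
  proof -
    have "\<bar>u v\<bar> \<le> 1" if "v \<in> verts G" for v
    proof -
      have "(u v)\<^sup>2 \<le> (\<Sum>v\<in>verts G. (u v)\<^sup>2)" using that by (intro member_le_sum) auto
      then show ?thesis using u by (simp add: N abs_square_le_1)
    qed
    then show ?thesis using u by (auto simp: C_def N abs_le_iff)
  qed
  \<comment> \<open>Pairs of a parameter and a unit vector on which the form is not positive. The
    least parameter occurring in this compact set is the one sought.\<close>
  define S where "S = ({a..b} \<times> C) \<inter> {p \<in> {a..b} \<times> UNIV. f p \<le> 0} \<inter> {p. (\<Sum>v\<in>verts G. (snd p v)\<^sup>2) = 1}"
  have S_iff: "(k, u) \<in> S \<longleftrightarrow> k \<in> {a..b} \<and> u \<in> N \<and> f (k, u) \<le> 0" for k u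
  proof -
    have outside: "u v = 0" if "u \<in> C" "v \<notin> verts G - VD" for v
      using that unfolding C_def by (metis (lifting) mem_Collect_eq singletonD)
    have "u \<in> N \<longleftrightarrow> u \<in> C \<and> (\<Sum>v\<in>verts G. (u v)\<^sup>2) = 1"
      using NC[of u] outside unfolding N by blast
    then show ?thesis unfolding S_def by simp blast
  qed
  have "compact S"
  proof -
    have "closed ({a..b} \<times> UNIV \<inter> f -` {..0})"
      by (intro continuous_closed_preimage cf closed_Times) auto
    moreover have "{p \<in> {a..b} \<times> UNIV. f p \<le> 0} = {a..b} \<times> UNIV \<inter> f -` {..0}" by auto
    moreover have "closed {p :: real \<times> ('v \<Rightarrow> real). (\<Sum>v\<in>verts G. (snd p v)\<^sup>2) = (1::real)}"
      by (intro closed_Collect_eq continuous_intros co)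
    moreover have "compact ({a..b} \<times> C)"
      unfolding C_def by (intro compact_Times compact_function_cube) auto
    ultimately show ?thesis unfolding S_def by (intro compact_Int_closed) simp_all
  qed
  moreover have "S \<noteq> {}" using neg S_iff[of b] ab by (auto simp: f_def)
  moreover have "continuous_on S fst" by (rule continuous_on_fst[OF continuous_on_id])
  ultimately have "\<exists>p\<in>S. \<forall>p'\<in>S. fst p \<le> fst p'" by (rule continuous_attains_inf)
  then obtain p where p: "p \<in> S" "\<And>p'. p' \<in> S \<Longrightarrow> fst p \<le> fst p'" by blast
  obtain k u where ku: "p = (k, u)" by force
  have k: "k \<in> {a..b}" "u \<in> N" "f (k, u) \<le> 0" using p(1) S_iff ku by auto
  \<comment> \<open>The form is positive at \<open>a\<close>, so a negative value at the least
    parameter would force an earlier zero by the intermediate value theorem.\<close>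
  have nonneg: "f (k, w) \<ge> 0" if w: "w \<in> N" for w
  proof (rule ccontr)
    assume neg: "\<not> f (k, w) \<ge> 0"
    have "continuous_on {a..k} (\<lambda>z. f (z, w))"
      using k(1) by (intro continuous_on_compose2[OF cf] continuous_intros) auto
    moreover have "f (a, w) > 0" using pos[OF w] by (simp add: f_def)
    ultimately obtain z where z: "a \<le> z" "z \<le> k" "f (z, w) = 0"
      using IVT2'[of "\<lambda>z. f (z, w)" k 0 a] neg k(1) by auto
    then have "(z, w) \<in> S" using S_iff w k(1) by auto
    then have "z = k" using p(2)[of "(z, w)"] ku z by simp
    then show False using z neg by auto
  qed
  have "f (k, u) = 0" using nonneg[OF k(2)] k(3) by simp
  then show ?thesis using k nonneg unfolding f_def by (intro bexI[of _ k] bexI[of _ u]) auto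
qed

text \<open>Only existence of a constant is wanted: the vertices whose value is controlled by the
  difference energy include \<open>v0\<close> and pass the control on along every arc, at the price
  of a larger constant.\<close>

lemma poincare_inequality:
  assumes "fin_digraph G" "Digraph_Component.connected G" "v0 \<in> verts G"
  shows "\<exists>C>0. \<forall>u :: 'v \<Rightarrow> real. u v0 = 0 \<longrightarrow>
    (\<Sum>v\<in>verts G. (u v)\<^sup>2) \<le> C * (\<Sum>e\<in>arcs G. (u (tail G e) - u (head G e))\<^sup>2)"
proof -
  interpret fin_digraph G by fact
  define D where "D = (\<lambda>u :: 'v \<Rightarrow> real. \<Sum>e\<in>arcs G. (u (tail G e) - u (head G e))\<^sup>2)"
  define W where "W = {v. \<exists>C. \<forall>u. u v0 = 0 \<longrightarrow> (u v)\<^sup>2 \<le> C * D u}"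
  have step: "y \<in> W" if xy: "x \<in> W" "\<And>u. (u x - u y)\<^sup>2 \<le> D u" for x y
  proof -
    obtain C where C: "\<forall>u. u v0 = 0 \<longrightarrow> (u x)\<^sup>2 \<le> C * D u" using xy(1) by (auto simp: W_def)
    have "(u y)\<^sup>2 \<le> (2 * C + 2) * D u" if "u v0 = 0" for u
    proof -
      have "0 \<le> (2 * u x - u y)\<^sup>2" by simp
      then have "(u y)\<^sup>2 \<le> 2 * (u x)\<^sup>2 + 2 * (u x - u y)\<^sup>2" by (simp add: power2_eq_square algebra_simps)
      also have "\<dots> \<le> 2 * (C * D u) + 2 * D u" using C that xy(2)[of u] by (intro add_mono) auto
      finally show ?thesis by (simp add: algebra_simps)
    qed
    then show ?thesis unfolding W_def by (intro CollectI exI[of _ "2 * C + 2"]) simp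
  qed
  have De: "(u (tail G e) - u (head G e))\<^sup>2 \<le> D u" if "e \<in> arcs G" for e u
    unfolding D_def using that by (intro member_le_sum) auto
  have "verts G \<subseteq> W"
  proof (rule connected_closed_verts[OF assms(2) _ assms(3)])
    show "v0 \<in> W" unfolding W_def by (intro CollectI exI[of _ 0]) simp
    show "tail G e \<in> W \<longleftrightarrow> head G e \<in> W" if "e \<in> arcs G" for e
      using step[of "tail G e" "head G e"] step[of "head G e" "tail G e"] De[OF that]
      by (metis power2_commute)
  qed
  then have "\<forall>v\<in>verts G. \<exists>C. \<forall>u. u v0 = 0 \<longrightarrow> (u v)\<^sup>2 \<le> C * D u" by (auto simp: W_def)
  from bchoice[OF this] obtain C where C: "\<And>v u. v \<in> verts G \<Longrightarrow> u v0 = 0 \<Longrightarrow> (u v)\<^sup>2 \<le> C v * D u"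
    by blast
  have "(\<Sum>v\<in>verts G. (u v)\<^sup>2) \<le> (\<bar>\<Sum>v\<in>verts G. C v\<bar> + 1) * D u" if "u v0 = 0" for u
  proof -
    have "(\<Sum>v\<in>verts G. (u v)\<^sup>2) \<le> (\<Sum>v\<in>verts G. C v) * D u"
      unfolding sum_distrib_right using C that by (intro sum_mono) auto
    also have "\<dots> \<le> (\<bar>\<Sum>v\<in>verts G. C v\<bar> + 1) * D u"
      by (intro mult_right_mono) (auto simp: D_def intro: sum_nonneg)
    finally show ?thesis .
  qed
  then show ?thesis unfolding D_def by (intro exI[of _ "\<bar>\<Sum>v\<in>verts G. C v\<bar> + 1"]) auto
qed

section \<open>The positive null vector and the estimates at both ends of the window\<close>

lemma graph_form_cong:
  assumes "wf_digraph G" "\<And>v. v \<in> verts G \<Longrightarrow> u v = u' v"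
  shows "graph_form G \<theta> \<beta> u = graph_form G \<theta> \<beta> u'"
proof -
  interpret wf_digraph G by fact
  show ?thesis unfolding graph_form_def by (intro arg_cong2[where f = minus] sum.cong) (auto simp: assms(2))
qed

text \<open>The null vector at the first degenerate parameter may change sign. Absolute values do
  not increase the form, which is nonnegative there, so they give a null vector too; minimality
  yields its flux conditions, and these its positivity.\<close>

lemma first_positive_null_vector:
  fixes G :: "('v, 'e) pre_digraph" and \<theta> :: "'e \<Rightarrow> real \<Rightarrow> real" and \<beta> :: "'v \<Rightarrow> real \<Rightarrow> real"
  assumes G: "fin_digraph G" "loopfree_digraph G" "Digraph_Component.connected G" and ab: "a \<le> b"
    and VD: "\<And>v. v \<in> VD \<Longrightarrow> vertex_degree G v = 1"
      "\<And>e. e \<in> arcs G \<Longrightarrow> tail G e \<in> VD \<Longrightarrow> head G e \<notin> VD"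
    and \<theta>: "\<And>e. e \<in> arcs G \<Longrightarrow> continuous_on {a..b} (\<theta> e)"
      "\<And>e k. e \<in> arcs G \<Longrightarrow> k \<in> {a..b} \<Longrightarrow> sin (\<theta> e k) > 0"
    and \<beta>: "\<And>v. v \<in> verts G \<Longrightarrow> continuous_on {a..b} (\<beta> v)"
    and pos: "\<And>u. (\<And>v. v \<in> VD \<Longrightarrow> u v = 0) \<Longrightarrow> (\<Sum>v\<in>verts G. (u v)\<^sup>2) = 1 \<Longrightarrow>
      graph_form G (\<lambda>e. \<theta> e a) (\<lambda>v. \<beta> v a) u > 0"
    and neg: "\<And>v. v \<notin> verts G - VD \<Longrightarrow> u0 v = 0" "\<exists>v\<in>verts G. u0 v \<noteq> 0"
      "graph_form G (\<lambda>e. \<theta> e b) (\<lambda>v. \<beta> v b) u0 \<le> 0"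
  shows "\<exists>k\<in>{a..b}. \<exists>w. (\<forall>v\<in>VD. w v = 0) \<and> (\<forall>v\<in>verts G - VD. w v > 0 \<and>
     (\<Sum>e\<in>incident_arcs G v. arc_flux G (\<lambda>e. \<theta> e k) w e v) = \<beta> v k * w v)"
proof -
  interpret fin_digraph G by fact
  define N where "N = {u. (\<forall>v. v \<notin> verts G - VD \<longrightarrow> u v = 0) \<and> (\<Sum>v\<in>verts G. (u v)\<^sup>2) = (1::real)}"
  have normalize: "\<exists>c>0. (\<lambda>v. c * u v) \<in> N"
    if u: "\<And>v. v \<notin> verts G - VD \<Longrightarrow> u v = 0" "\<exists>v\<in>verts G. u v \<noteq> 0" for u
  proof -
    define s where "s = (\<Sum>v\<in>verts G. (u v)\<^sup>2)"
    obtain v where v: "v \<in> verts G" "u v \<noteq> 0" using u(2) by auto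
    then have "s > 0" unfolding s_def by (intro sum_pos2[of _ v]) auto
    have "(\<Sum>v\<in>verts G. (1 / sqrt s * u v)\<^sup>2) = (1 / sqrt s)\<^sup>2 * s"
      unfolding s_def sum_distrib_left power_mult_distrib ..
    also have "\<dots> = 1" using \<open>s > 0\<close> by (simp add: power_divide)
    finally have one: "(\<Sum>v\<in>verts G. (1 / sqrt s * u v)\<^sup>2) = 1" .
    have "(\<lambda>v. 1 / sqrt s * u v) \<in> N"
      unfolding N_def mem_Collect_eq by (intro conjI allI impI one) (simp add: u(1))
    then show ?thesis using \<open>s > 0\<close> by (intro exI[of _ "1 / sqrt s"]) simp
  qed
  have "\<exists>c>0. (\<lambda>v. c * u0 v) \<in> N" by (rule normalize[of u0]) (simp_all only: neg(1,2) simp_thms)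
  then obtain c where c: "c > 0" "(\<lambda>v. c * u0 v) \<in> N" by (elim exE conjE) (rule that)
  have "graph_form G (\<lambda>e. \<theta> e b) (\<lambda>v. \<beta> v b) (\<lambda>v. c * u0 v) \<le> 0"
    unfolding graph_form_scale using neg(3) by (simp add: mult_nonneg_nonpos)
  then have neg': "\<exists>u\<in>N. graph_form G (\<lambda>e. \<theta> e b) (\<lambda>v. \<beta> v b) u \<le> 0"
    using c(2) by (rule bexI)
  have VDz: "u v = 0" if "u \<in> N" "v \<in> VD" for u v using that by (auto simp: N_def)
  have pos': "graph_form G (\<lambda>e. \<theta> e a) (\<lambda>v. \<beta> v a) u > 0" if "u \<in> N" for u
    by (rule pos) (use that VDz[OF that] in \<open>simp_all add: N_def\<close>)
  have "\<exists>k\<in>{a..b}. \<exists>u\<in>N. graph_form G (\<lambda>e. \<theta> e k) (\<lambda>v. \<beta> v k) u = 0 \<and>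
     (\<forall>w\<in>N. graph_form G (\<lambda>e. \<theta> e k) (\<lambda>v. \<beta> v k) w \<ge> 0)"
    by (rule first_null_vector[OF G(1) ab \<theta> \<beta> N_def pos' neg'])
  then obtain k u where k: "k \<in> {a..b}" and u: "u \<in> N" "graph_form G (\<lambda>e. \<theta> e k) (\<lambda>v. \<beta> v k) u = 0"
    and nonneg: "\<forall>w\<in>N. graph_form G (\<lambda>e. \<theta> e k) (\<lambda>v. \<beta> v k) w \<ge> 0"
    by (elim bexE conjE) (rule that)
  define w where "w = (\<lambda>v. \<bar>u v\<bar>)"
  have wN: "w \<in> N" using u(1) by (auto simp: w_def N_def)
  have "graph_form G (\<lambda>e. \<theta> e k) (\<lambda>v. \<beta> v k) w \<le> 0"
    using graph_form_abs_le[of G "\<lambda>e. \<theta> e k" "\<lambda>v. \<beta> v k" u] \<theta>(2) k u(2) by (simp add: w_def)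
  then have w0: "graph_form G (\<lambda>e. \<theta> e k) (\<lambda>v. \<beta> v k) w = 0" using bspec[OF nonneg wN] by simp
  \<comment> \<open>Nonnegativity is known on normalised vectors. Homogeneity extends it to all
    vectors vanishing on \<open>VD\<close>, after clearing values outside the vertex set, which the
    form does not see.\<close>
  have nonneg': "graph_form G (\<lambda>e. \<theta> e k) (\<lambda>v. \<beta> v k) x \<ge> 0" if x: "\<And>v. v \<in> VD \<Longrightarrow> x v = 0" for x
  proof -
    define y where "y = (\<lambda>v. if v \<in> verts G then x v else 0)"
    have y: "y v = 0" if "v \<notin> verts G - VD" for v using that x by (auto simp: y_def)
    have eq: "graph_form G (\<lambda>e. \<theta> e k) (\<lambda>v. \<beta> v k) x = graph_form G (\<lambda>e. \<theta> e k) (\<lambda>v. \<beta> v k) y"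
      by (rule graph_form_cong[OF wf_digraph_axioms]) (simp add: y_def)
    show ?thesis
    proof (cases "\<exists>v\<in>verts G. y v \<noteq> 0")
      case True
      have "\<exists>c>0. (\<lambda>v. c * y v) \<in> N" by (rule normalize[of y]) (simp_all only: y True simp_thms)
      then obtain c where "c > 0" "(\<lambda>v. c * y v) \<in> N" by (elim exE conjE) (rule that)
      then show ?thesis using bspec[OF nonneg, of "\<lambda>v. c * y v"] unfolding eq graph_form_scale
        by (simp add: zero_le_mult_iff)
    next
      case False
      then have "graph_form G (\<lambda>e. \<theta> e k) (\<lambda>v. \<beta> v k) y = graph_form G (\<lambda>e. \<theta> e k) (\<lambda>v. \<beta> v k) (\<lambda>_. 0)"
        by (intro graph_form_cong wf_digraph_axioms) auto
      then show ?thesis unfolding eq by (simp add: graph_form_def arc_form_def)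
    qed
  qed
  have flux: "(\<Sum>e\<in>incident_arcs G v. arc_flux G (\<lambda>e. \<theta> e k) w e v) = \<beta> v k * w v" if "v \<in> verts G - VD" for v
    by (rule graph_form_null_flux[OF G(1,2) nonneg' w0 VDz[OF wN] that])
  have nz: "\<exists>v\<in>verts G. w v \<noteq> 0"
  proof (rule ccontr)
    assume "\<not> ?thesis"
    then have "(\<Sum>v\<in>verts G. (w v)\<^sup>2) = 0" by simp
    then show False using wN by (simp add: N_def)
  qed
  have wpos: "w v > 0" if "v \<in> verts G - VD" for v
  proof (rule null_vector_positive[where G = G and VD = VD and w = w
        and \<theta> = "\<lambda>e. \<theta> e k" and \<beta> = "\<lambda>v. \<beta> v k"])
    show "sin (\<theta> e k) > 0" if "e \<in> arcs G" for e by (rule \<theta>(2)[OF that k])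
    show "w v \<ge> 0" for v by (simp add: w_def)
    show "w v = 0" if "v \<in> VD" for v by (rule VDz[OF wN that])
  qed (fact G VD flux nz that)+
  show ?thesis
  proof (rule bexI[OF _ k], rule exI[of _ w], intro conjI ballI)
    show "w v = 0" if "v \<in> VD" for v by (rule VDz[OF wN that])
  qed (fact wpos flux)+
qed

text \<open>On unit vectors the diagonal terms of \<open>arc_form_eq_diff\<close> cost at most 2 per
  arc, since \<open>sin + cos \<ge> 1\<close> at acute angles bounds \<open>(1 - cos) / sin\<close>
  by 1, and the couplings cost at most 1. The difference energy keeps the large weight
  \<open>1 / \<tau>\<close>.\<close>

lemma graph_form_small_angle:
  assumes G: "fin_digraph G" and \<tau>: "\<tau> \<le> 1" and \<theta>: "\<And>e. e \<in> arcs G \<Longrightarrow> 0 < \<theta> e \<and> \<theta> e \<le> \<tau>"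
    and \<beta>: "\<And>v. v \<in> verts G \<Longrightarrow> \<beta> v \<le> 1" and u: "(\<Sum>v\<in>verts G. (u v)\<^sup>2) = 1"
  shows "graph_form G \<theta> \<beta> u \<ge> (\<Sum>e\<in>arcs G. (u (tail G e) - u (head G e))\<^sup>2) / \<tau> - 2 * card (arcs G) - 1"
proof -
  interpret fin_digraph G by fact
  have le1: "(u v)\<^sup>2 \<le> 1" if "v \<in> verts G" for v
    unfolding u[symmetric] using that by (intro member_le_sum) auto
  have arc: "arc_form (\<theta> e) (u (tail G e)) (u (head G e)) \<ge> (u (tail G e) - u (head G e))\<^sup>2 / \<tau> - 2"
    if e: "e \<in> arcs G" for e
  proof -
    have th: "0 < \<theta> e" "\<theta> e \<le> \<tau>" "\<theta> e < pi/2" "\<theta> e < pi" using \<theta>[OF e] \<tau> pi_gt3 by auto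
    have s: "sin (\<theta> e) > 0" and c: "cos (\<theta> e) > 0"
      using th by (auto intro: sin_gt_zero cos_gt_zero)
    have "1\<^sup>2 \<le> (sin (\<theta> e) + cos (\<theta> e))\<^sup>2"
      using s c sin_cos_squared_add[of "\<theta> e"] by (simp add: power2_sum)
    then have "1 \<le> sin (\<theta> e) + cos (\<theta> e)" by (rule power2_le_imp_le) (use s c in linarith)
    then have "(1 - cos (\<theta> e)) / sin (\<theta> e) \<le> 1" using s by simp
    then have "(1 - cos (\<theta> e)) / sin (\<theta> e) * ((u (tail G e))\<^sup>2 + (u (head G e))\<^sup>2) \<le> 1 * 2"
      using le1[OF tail_in_verts[OF e]] le1[OF head_in_verts[OF e]] by (intro mult_mono) simp_all
    moreover have "sin (\<theta> e) \<le> \<tau>" using sin_x_le_x[of "\<theta> e"] th by simp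
    then have "(u (tail G e) - u (head G e))\<^sup>2 / \<tau> \<le> (u (tail G e) - u (head G e))\<^sup>2 / sin (\<theta> e)"
      using s by (intro divide_left_mono mult_pos_pos) auto
    moreover have "sin (\<theta> e) \<noteq> 0" using s by simp
    ultimately show ?thesis unfolding arc_form_eq_diff[OF \<open>sin (\<theta> e) \<noteq> 0\<close>] by linarith
  qed
  have "(\<Sum>e\<in>arcs G. (u (tail G e) - u (head G e))\<^sup>2) / \<tau> - 2 * card (arcs G) =
      (\<Sum>e\<in>arcs G. (u (tail G e) - u (head G e))\<^sup>2 / \<tau> - 2)"
    by (simp add: sum_subtractf sum_divide_distrib)
  also have "\<dots> \<le> (\<Sum>e\<in>arcs G. arc_form (\<theta> e) (u (tail G e)) (u (head G e)))"
    by (intro sum_mono arc)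
  finally have 1: "(\<Sum>e\<in>arcs G. (u (tail G e) - u (head G e))\<^sup>2) / \<tau> - 2 * card (arcs G) \<le>
      (\<Sum>e\<in>arcs G. arc_form (\<theta> e) (u (tail G e)) (u (head G e)))" .
  have "(\<Sum>v\<in>verts G. \<beta> v * (u v)\<^sup>2) \<le> (\<Sum>v\<in>verts G. 1 * (u v)\<^sup>2)"
    using \<beta> by (intro sum_mono mult_right_mono) auto
  then show ?thesis unfolding graph_form_def using 1 u by simp
qed

text \<open>Bounds the arcs other than the longest. Near \<open>pi\<close> the sine may be tiny, but
  at obtuse angles the numerator is nonpositive for these values; the lower bound \<open>c\<close>
  takes care of acute angles.\<close>

lemma arc_form_indicator_le:
  assumes "0 < c" "c \<le> pi/2" "c \<le> \<theta>" "\<theta> < pi" "x \<in> {0, 1}" "y \<in> {0, 1}"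
  shows "arc_form \<theta> x y \<le> 2 / sin c"
proof -
  have s: "sin \<theta> > 0" and sc: "sin c > 0" using assms by (auto intro!: sin_gt_zero)
  have sq: "x\<^sup>2 + y\<^sup>2 \<ge> 0" "x\<^sup>2 + y\<^sup>2 \<le> 2" "x * y \<ge> 0" using assms(5,6) by auto
  show ?thesis
  proof (cases "\<theta> \<le> pi/2")
    case True
    have "cos \<theta> * (x\<^sup>2 + y\<^sup>2) \<le> 1 * 2" using sq by (intro mult_mono) auto
    then have "arc_form \<theta> x y \<le> 2 / sin \<theta>"
      unfolding arc_form_def using s sq by (intro divide_right_mono) auto
    also have "\<dots> \<le> 2 / sin c"
      using True assms sc by (intro divide_left_mono mult_pos_pos sin_monotone_2pi_le s) auto
    finally show ?thesis .
  next
    case False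
    then have "cos \<theta> \<le> 0" using assms cos_monotone_0_pi_le[of "pi/2" \<theta>] by simp
    then have "cos \<theta> * (x\<^sup>2 + y\<^sup>2) - 2 * x * y \<le> 0"
      using sq mult_nonpos_nonneg[of "cos \<theta>" "x\<^sup>2 + y\<^sup>2"] by simp
    then have "arc_form \<theta> x y \<le> 0" unfolding arc_form_def using s by (simp add: divide_le_0_iff)
    then show ?thesis using sc by (smt (verit) divide_nonneg_pos)
  qed
qed

text \<open>The cotangent of \<open>pi/2 + arctan N\<close> is \<open>- N\<close>, so one arc can
  make the form as negative as desired. With both values 1 the numerator
  \<open>2 * cos \<theta> - 2\<close> is still at most \<open>cos \<theta>\<close>.\<close>

lemma arc_form_obtuse_le:
  assumes "x \<in> {0, 1}" "y \<in> {0, 1}" "x \<noteq> 0 \<or> y \<noteq> 0"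
  shows "arc_form (pi/2 + arctan N) x y \<le> - N"
proof -
  define \<theta> where "\<theta> = pi/2 + arctan N"
  have c: "cos (arctan N) > 0" using arctan_bounded[of N] by (intro cos_gt_zero_pi) auto
  have t: "sin \<theta> = cos (arctan N)" "cos \<theta> = - sin (arctan N)" unfolding \<theta>_def by (auto simp: sin_add cos_add)
  have "cos \<theta> / sin \<theta> = - N" using tan_arctan[of N] c unfolding t tan_def by simp
  moreover have "cos \<theta> * (x\<^sup>2 + y\<^sup>2) - 2 * x * y \<le> cos \<theta>"
  proof -
    have "2 * cos \<theta> - 2 \<le> cos \<theta>" using cos_le_one[of \<theta>] by linarith
    then show ?thesis using assms by auto
  qed
  then have "arc_form \<theta> x y \<le> cos \<theta> / sin \<theta>"
    unfolding arc_form_def using c t by (intro divide_right_mono) auto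
  ultimately show ?thesis by (simp add: \<theta>_def)
qed

section \<open>Weak solutions on an interval\<close>

lemma integral_lebesgue_on_open_interval:
  fixes f :: "real \<Rightarrow> 'b::euclidean_space"
  assumes "continuous_on {0..l} f"
  shows "integrable (lebesgue_on {0<..<l}) f" "(LINT x|lebesgue_on {0<..<l}. f x) = integral {0..l} f"
proof -
  have "f absolutely_integrable_on cbox 0 l"
    using absolutely_integrable_continuous_real[OF assms] by simp
  then have "f absolutely_integrable_on {0<..<l}"
    using absolutely_integrable_on_open_interval[where f = f and a = 0 and b = l] by (simp add: box_real)
  then show int: "integrable (lebesgue_on {0<..<l}) f"
    by (intro absolutely_integrable_imp_integrable) auto
  show "(LINT x|lebesgue_on {0<..<l}. f x) = integral {0..l} f"
    using lebesgue_integral_eq_integral[OF int] by (simp add: integral_open_interval_real)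
qed

lemma square_integrable_continuous:
  assumes "continuous_on {0..l} f"
  shows "square_integrable l f"
  unfolding square_integrable_def
proof
  show "f \<in> borel_measurable (lebesgue_on {0<..<l})"
    using integral_lebesgue_on_open_interval(1)[OF assms] by (rule borel_measurable_integrable)
  show "integrable (lebesgue_on {0<..<l}) (\<lambda>x. (norm (f x))\<^sup>2)"
    by (intro integral_lebesgue_on_open_interval(1) continuous_intros assms)
qed

lemma test_functionE:
  assumes "test_function l \<phi>"
  obtains D where "\<And>x. (\<phi> has_real_derivative D x) (at x)" "continuous_on UNIV D" "deriv \<phi> = D"
    "\<phi> 0 = 0" "\<phi> l = 0"
proof -
  obtain D where D: "\<And>x. (\<phi> has_vector_derivative D x) (at x)" "continuous_on UNIV D"
    using assms by (auto simp: test_function_def C1_differentiable_on_def)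
  have 1: "(\<phi> has_real_derivative D x) (at x)" for x
    using D(1) by (simp add: has_real_derivative_iff_has_vector_derivative)
  moreover have "deriv \<phi> = D" using 1 by (intro ext DERIV_imp_deriv)
  moreover have "{x. \<phi> x \<noteq> 0} \<subseteq> {0<..<l}"
    using assms closure_subset[of "{x. \<phi> x \<noteq> 0}"] unfolding test_function_def by blast
  then have "\<phi> 0 = 0" "\<phi> l = 0" by force+
  ultimately show ?thesis using that D(2) by blast
qed

lemma weak_derivative_C1:
  fixes f f' :: "real \<Rightarrow> complex"
  assumes f: "\<And>x. (f has_vector_derivative f' x) (at x)" and f': "continuous_on UNIV f'" and l: "0 \<le> l"
  shows "weak_derivative l f f'"
  unfolding weak_derivative_def
proof (intro conjI allI impI)
  have cf: "continuous_on S f" for S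
    using f by (meson continuous_at_imp_continuous_on has_vector_derivative_continuous)
  have cf': "continuous_on S f'" for S using f' continuous_on_subset by blast
  show "square_integrable l f" "square_integrable l f'"
    by (intro square_integrable_continuous cf cf')+
  fix \<phi> assume "test_function l \<phi>"
  then obtain D where D: "\<And>x. (\<phi> has_real_derivative D x) (at x)" "continuous_on UNIV D" "deriv \<phi> = D"
    "\<phi> 0 = 0" "\<phi> l = 0" using test_functionE by blast
  have cD: "continuous_on S D" for S using D(2) continuous_on_subset by blast
  have c\<phi>: "continuous_on S \<phi>" for S
    using D(1) by (intro continuous_at_imp_continuous_on) (blast intro: DERIV_continuous)
  have "((\<lambda>x. \<phi> x *\<^sub>R f x) has_vector_derivative \<phi> x *\<^sub>R f' x + D x *\<^sub>R f x) (at x within {0..l})" for x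
    by (intro has_vector_derivative_scaleR has_field_derivative_at_within[OF D(1)]
        has_vector_derivative_at_within[OF f])
  then have "((\<lambda>x. \<phi> x *\<^sub>R f' x + D x *\<^sub>R f x) has_integral (\<phi> l *\<^sub>R f l - \<phi> 0 *\<^sub>R f 0)) {0..l}"
    by (intro fundamental_theorem_of_calculus l) auto
  then have "integral {0..l} (\<lambda>x. \<phi> x *\<^sub>R f' x + D x *\<^sub>R f x) = 0"
    using D(4,5) by (simp add: integral_unique)
  moreover have "integral {0..l} (\<lambda>x. \<phi> x *\<^sub>R f' x + D x *\<^sub>R f x) =
      integral {0..l} (\<lambda>x. \<phi> x *\<^sub>R f' x) + integral {0..l} (\<lambda>x. D x *\<^sub>R f x)"
    by (intro integral_add integrable_continuous_real continuous_intros c\<phi> cf' cD cf)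
  ultimately have "integral {0..l} (\<lambda>x. D x *\<^sub>R f x) = - integral {0..l} (\<lambda>x. \<phi> x *\<^sub>R f' x)"
    by (simp add: eq_neg_iff_add_eq_0 add.commute)
  moreover have "(LINT x|lebesgue_on {0<..<l}. D x *\<^sub>R f x) = integral {0..l} (\<lambda>x. D x *\<^sub>R f x)"
    "(LINT x|lebesgue_on {0<..<l}. \<phi> x *\<^sub>R f' x) = integral {0..l} (\<lambda>x. \<phi> x *\<^sub>R f' x)"
    by (intro integral_lebesgue_on_open_interval(2) continuous_intros c\<phi> cf' cD cf)+
  ultimately show "(LINT x|lebesgue_on {0<..<l}. deriv \<phi> x *\<^sub>R f x) =
      - (LINT x|lebesgue_on {0<..<l}. \<phi> x *\<^sub>R f' x)"
    using D(3) by simp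
qed

text \<open>The general classical solution of frequency \<open>k\<close>: \<open>A\<close> is the
  value at 0 and \<open>k * B\<close> the derivative there. Differentiation acts on the coefficients
  alone, so weak derivatives stay in the family.\<close>

definition trig_fun :: "real \<Rightarrow> complex \<Rightarrow> complex \<Rightarrow> real \<Rightarrow> complex" where
  "trig_fun k A B x = of_real (cos (k * x)) * A + of_real (sin (k * x)) * B"

lemma trig_fun_has_vector_derivative:
  "(trig_fun k A B has_vector_derivative trig_fun k (of_real k * B) (- of_real k * A) x) (at x)"
proof -
  have c: "((\<lambda>x. cos (k * x)) has_real_derivative - sin (k * x) * k) (at x)"
    and s: "((\<lambda>x. sin (k * x)) has_real_derivative cos (k * x) * k) (at x)"
    by (auto intro!: derivative_eq_intros)
  have "((\<lambda>x. cos (k * x) *\<^sub>R A + sin (k * x) *\<^sub>R B) has_vector_derivative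
      (cos (k * x) *\<^sub>R 0 + (- sin (k * x) * k) *\<^sub>R A) + (sin (k * x) *\<^sub>R 0 + (cos (k * x) * k) *\<^sub>R B)) (at x)"
    by (intro has_vector_derivative_add has_vector_derivative_scaleR c s has_vector_derivative_const)
  then show ?thesis
    unfolding trig_fun_def[abs_def] by (simp add: scaleR_conv_of_real algebra_simps)
qed

lemma continuous_on_trig_fun: "continuous_on S (trig_fun k A B)"
  unfolding trig_fun_def[abs_def] by (intro continuous_intros)

lemma trig_fun_weak_derivative:
  assumes "0 \<le> l"
  shows "weak_derivative l (trig_fun k A B) (trig_fun k (of_real k * B) (- of_real k * A))"
  by (intro weak_derivative_C1 trig_fun_has_vector_derivative continuous_on_trig_fun assms)

lemma trig_fun_second_derivative:
  "trig_fun k (of_real k * (- of_real k * A)) (- of_real k * (of_real k * B)) =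
    (\<lambda>x. - (complex_of_real (k\<^sup>2) * trig_fun k A B x))"
  by (rule ext) (simp add: trig_fun_def power2_eq_square algebra_simps)

text \<open>The zero mean is what makes the antiderivative return to zero beyond
  \<open>b\<close>.\<close>

lemma compact_support_antiderivative:
  fixes \<psi> :: "real \<Rightarrow> real"
  assumes cont: "continuous_on UNIV \<psi>" and supp: "\<And>x. x \<notin> {a..b} \<Longrightarrow> \<psi> x = 0"
    and ab: "a \<le> b" and int0: "integral {a..b} \<psi> = 0"
  obtains \<Psi> where "\<And>x. (\<Psi> has_real_derivative \<psi> x) (at x)" "\<And>x. x \<notin> {a..b} \<Longrightarrow> \<Psi> x = 0"
proof
  \<comment> \<open>Integration starts at \<open>a - 1\<close> so that \<open>a\<close> becomes an
    interior point, where a two-sided derivative is available.\<close>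
  define \<Psi> where "\<Psi> = (\<lambda>x. integral {a - 1..x} \<psi>)"
  have int: "\<psi> integrable_on {c..d}" for c d
    by (intro integrable_continuous_real continuous_on_subset[OF cont]) auto
  have zero: "integral {c..d} \<psi> = 0" if "d < a \<or> b < c" for c d
  proof -
    have "integral {c..d} \<psi> = integral {c..d} (\<lambda>_. 0)"
      using that supp by (intro integral_cong) force
    then show ?thesis by simp
  qed
  \<comment> \<open>The support hypothesis says nothing at the ends; continuity from outside
    supplies the value zero.\<close>
  have "\<psi> a = 0"
    by (rule continuous_constant_on_closure[of "{..<a}"])
      (use supp continuous_on_subset[OF cont] in \<open>auto simp: closure_lessThan\<close>)
  have "\<psi> b = 0"
    by (rule continuous_constant_on_closure[of "{b<..}"])
      (use supp continuous_on_subset[OF cont] in \<open>auto simp: closure_greaterThan\<close>)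
  have zl: "integral {a - 1..a} \<psi> = 0"
  proof -
    have "integral {a - 1..a} \<psi> = integral {a - 1..a} (\<lambda>_. 0)"
      using supp \<open>\<psi> a = 0\<close> by (intro integral_cong) (metis atLeastAtMost_iff order_antisym)
    then show ?thesis by simp
  qed
  have zr: "integral {b..x} \<psi> = 0" for x
  proof -
    have "integral {b..x} \<psi> = integral {b..x} (\<lambda>_. 0)"
      using supp \<open>\<psi> b = 0\<close> by (intro integral_cong) (metis atLeastAtMost_iff order_antisym)
    then show ?thesis by simp
  qed
  show out: "\<Psi> x = 0" if "x \<notin> {a..b}" for x
  proof (cases "x < a")
    case True
    then show ?thesis unfolding \<Psi>_def by (intro zero) simp
  next
    case False
    then have x: "b < x" using that by auto
    have "integral {a - 1..x} \<psi> = integral {a - 1..a} \<psi> + integral {a..x} \<psi>"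
      using ab x by (intro Henstock_Kurzweil_Integration.integral_combine[symmetric] int) auto
    also have "integral {a..x} \<psi> = integral {a..b} \<psi> + integral {b..x} \<psi>"
      using ab x by (intro Henstock_Kurzweil_Integration.integral_combine[symmetric] int) auto
    finally show ?thesis unfolding \<Psi>_def using zl zr int0 by simp
  qed
  show "(\<Psi> has_real_derivative \<psi> x) (at x)" for x
  proof (cases "x < a")
    case True
    have "(\<Psi> has_real_derivative 0) (at x)"
      using True out by (intro has_field_derivative_transform_within_open[of "\<lambda>_. 0" 0 x "{..<a}" \<Psi>]) auto
    then show ?thesis using supp[of x] True by simp
  next
    case False
    have "(\<Psi> has_real_derivative \<psi> x) (at x within {a - 1..x + 1})"
      unfolding \<Psi>_def using False
      by (intro integral_has_real_derivative continuous_on_subset[OF cont]) auto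
    then show ?thesis using False by (subst (asm) at_within_interior) (auto simp: interior_atLeastAtMost_real)
  qed
qed

lemma test_functionI:
  assumes "\<And>x. (\<phi> has_real_derivative D x) (at x)" "continuous_on UNIV D"
    and "\<And>x. x \<notin> {a..b} \<Longrightarrow> \<phi> x = 0" "0 < a" "b < l"
  shows "test_function l \<phi>"
proof -
  have "closure {x. \<phi> x \<noteq> 0} \<subseteq> {a..b}"
    using assms(3) by (intro closure_minimal subsetI) (fastforce, auto)
  moreover have "{a..b} \<subseteq> {0<..<l}" using assms(4,5) by auto
  moreover have "\<phi> C1_differentiable_on UNIV"
    unfolding C1_differentiable_on_def
    using assms(1,2) by (auto simp: has_real_derivative_iff_has_vector_derivative)
  ultimately show ?thesis unfolding test_function_def by blast
qed

text \<open>
  The variation-of-constants formula turns any source orthogonal to both solutions into an admissible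
  test function, so a weak solution annihilates the orthogonal complement of the classical ones.
\<close>

lemma weak_solution_orthogonal:
  fixes f g :: "real \<Rightarrow> complex" and \<psi> :: "real \<Rightarrow> real"
  assumes k: "0 < k" and ab: "0 < a" "a < b" "b < l"
    and f: "continuous_on {0..l} f"
    and w: "weak_derivative l f g" "weak_derivative l g (\<lambda>x. - (complex_of_real (k\<^sup>2) * f x))"
    and \<psi>: "continuous_on UNIV \<psi>" "\<And>x. x \<notin> {a..b} \<Longrightarrow> \<psi> x = 0"
    and orth: "integral {a..b} (\<lambda>x. \<psi> x * cos (k * x)) = 0" "integral {a..b} (\<lambda>x. \<psi> x * sin (k * x)) = 0"
  shows "integral {0..l} (\<lambda>x. \<psi> x *\<^sub>R f x) = 0"
proof -
  obtain C where C: "\<And>x. (C has_real_derivative \<psi> x * cos (k * x)) (at x)" "\<And>x. x \<notin> {a..b} \<Longrightarrow> C x = 0"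
    by (rule compact_support_antiderivative[of "\<lambda>x. \<psi> x * cos (k * x)" a b])
      (use \<psi> orth ab in \<open>auto intro!: continuous_intros\<close>)
  obtain S where S: "\<And>x. (S has_real_derivative \<psi> x * sin (k * x)) (at x)" "\<And>x. x \<notin> {a..b} \<Longrightarrow> S x = 0"
    by (rule compact_support_antiderivative[of "\<lambda>x. \<psi> x * sin (k * x)" a b])
      (use \<psi> orth ab in \<open>auto intro!: continuous_intros\<close>)
  \<comment> \<open>This is the integral of \<open>sin (k * (x - t)) * \<psi> t / k\<close> with the
    sine expanded, so \<open>\<phi>'' + k\<^sup>2 * \<phi> = \<psi>\<close>; it vanishes off
    \<open>{a..b}\<close> because \<open>C\<close> and \<open>S\<close> do.\<close>
  define \<phi> where "\<phi> = (\<lambda>x. (sin (k * x) * C x - cos (k * x) * S x) / k)"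
  define \<phi>1 where "\<phi>1 = (\<lambda>x. cos (k * x) * C x + sin (k * x) * S x)"
  define \<phi>2 where "\<phi>2 = (\<lambda>x. \<psi> x - k\<^sup>2 * \<phi> x)"
  have d1: "(\<phi> has_real_derivative \<phi>1 x) (at x)" for x
    unfolding \<phi>_def \<phi>1_def using k
    by (auto intro!: derivative_eq_intros C(1) S(1) simp: field_simps)
  have trig: "cos (k * x) * (\<psi> x * cos (k * x)) + sin (k * x) * (\<psi> x * sin (k * x)) = \<psi> x" for x
  proof -
    have "cos (k * x) * (\<psi> x * cos (k * x)) + sin (k * x) * (\<psi> x * sin (k * x)) =
        \<psi> x * ((sin (k * x))\<^sup>2 + (cos (k * x))\<^sup>2)"
      by (simp only: power2_eq_square distrib_left mult_ac add_ac)
    also have "\<dots> = \<psi> x" by simp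
    finally show ?thesis .
  qed
  have d2: "(\<phi>1 has_real_derivative \<phi>2 x) (at x)" for x
  proof -
    have "(\<phi>1 has_real_derivative - sin (k * x) * k * C x + cos (k * x) * (\<psi> x * cos (k * x)) +
        (cos (k * x) * k * S x + sin (k * x) * (\<psi> x * sin (k * x)))) (at x)"
      unfolding \<phi>1_def by (auto intro!: derivative_eq_intros C(1) S(1))
    moreover have "- sin (k * x) * k * C x + cos (k * x) * (\<psi> x * cos (k * x)) +
        (cos (k * x) * k * S x + sin (k * x) * (\<psi> x * sin (k * x))) = \<phi>2 x"
      using trig[of x] k by (simp add: \<phi>2_def \<phi>_def field_simps power2_eq_square)
    ultimately show ?thesis by simp
  qed
  have c\<phi>: "continuous_on T \<phi>" and c\<phi>1: "continuous_on T \<phi>1" for T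
    using d1 d2 by (meson DERIV_continuous continuous_at_imp_continuous_on)+
  have c\<psi>: "continuous_on T \<psi>" for T using \<psi>(1) continuous_on_subset by blast
  have c\<phi>2: "continuous_on T \<phi>2" for T unfolding \<phi>2_def by (intro continuous_intros c\<phi> c\<psi>)
  \<comment> \<open>The first weak derivative is tested with \<open>\<phi>1\<close>, the second with
    \<open>\<phi>\<close>. Test functions need only be C1, which suits \<open>\<phi>1\<close>, whose
    derivative is merely continuous.\<close>
  have t: "test_function l \<phi>" "test_function l \<phi>1"
    using test_functionI[of \<phi> \<phi>1 a b l] test_functionI[of \<phi>1 \<phi>2 a b l] d1 d2 c\<phi>1 c\<phi>2 ab C(2) S(2)
    by (auto simp: \<phi>_def \<phi>1_def)
  have "deriv \<phi> = \<phi>1" "deriv \<phi>1 = \<phi>2" using d1 d2 by (auto intro!: ext DERIV_imp_deriv)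
  moreover have "(LINT x|lebesgue_on {0<..<l}. deriv \<phi>1 x *\<^sub>R f x) = - (LINT x|lebesgue_on {0<..<l}. \<phi>1 x *\<^sub>R g x)"
    using w(1) t(2) unfolding weak_derivative_def by blast
  moreover have "(LINT x|lebesgue_on {0<..<l}. deriv \<phi> x *\<^sub>R g x) =
      - (LINT x|lebesgue_on {0<..<l}. \<phi> x *\<^sub>R - (complex_of_real (k\<^sup>2) * f x))"
    using w(2) t(1) unfolding weak_derivative_def by blast
  ultimately have "(LINT x|lebesgue_on {0<..<l}. \<phi>2 x *\<^sub>R f x) =
      (LINT x|lebesgue_on {0<..<l}. \<phi> x *\<^sub>R - (complex_of_real (k\<^sup>2) * f x))"
    by (simp only: minus_minus)
  moreover have "(LINT x|lebesgue_on {0<..<l}. \<phi>2 x *\<^sub>R f x) = integral {0..l} (\<lambda>x. \<phi>2 x *\<^sub>R f x)"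
    by (intro integral_lebesgue_on_open_interval(2) continuous_intros c\<phi>2 f)
  moreover have "(LINT x|lebesgue_on {0<..<l}. \<phi> x *\<^sub>R - (complex_of_real (k\<^sup>2) * f x)) =
      integral {0..l} (\<lambda>x. \<phi> x *\<^sub>R - (complex_of_real (k\<^sup>2) * f x))"
    by (intro integral_lebesgue_on_open_interval(2) continuous_intros c\<phi> f)
  moreover have "integral {0..l} (\<lambda>x. \<phi>2 x *\<^sub>R f x - \<phi> x *\<^sub>R - (complex_of_real (k\<^sup>2) * f x)) =
      integral {0..l} (\<lambda>x. \<phi>2 x *\<^sub>R f x) - integral {0..l} (\<lambda>x. \<phi> x *\<^sub>R - (complex_of_real (k\<^sup>2) * f x))"
    by (intro integral_diff integrable_continuous_real continuous_intros c\<phi>2 c\<phi> f)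
  moreover have "\<phi>2 x *\<^sub>R f x - \<phi> x *\<^sub>R - (complex_of_real (k\<^sup>2) * f x) = \<psi> x *\<^sub>R f x" for x
    by (simp add: \<phi>2_def scaleR_conv_of_real algebra_simps)
  ultimately show ?thesis by simp
qed

text \<open>Evaluation at \<open>x\<close> and \<open>x + d\<close> gives a linear system with
  determinant \<open>sin (k * d)\<close>.\<close>

lemma cos_sin_independent:
  fixes p r k :: real
  assumes "0 < k" "a < b" and z: "\<And>x. x \<in> {a<..<b} \<Longrightarrow> p * cos (k * x) + r * sin (k * x) = 0"
  shows "p = 0" "r = 0"
proof -
  define x where "x = (2 * a + b) / 3"
  \<comment> \<open>A third of the interval keeps both points inside; \<open>1 / k\<close> keeps
    \<open>k * d\<close> at most 1, hence its sine positive.\<close>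
  define d where "d = min ((b - a) / 3) (1 / k)"
  have d: "0 < d" "d \<le> (b - a) / 3" "k * d \<le> 1"
    using assms(1,2) by (auto simp: d_def min_def field_simps)
  have x: "x \<in> {a<..<b}" "x + d \<in> {a<..<b}" using assms(2) d by (auto simp: x_def field_simps)
  have "sin (k * d) > 0"
    using d assms(1) pi_gt3 by (intro sin_gt_zero) auto
  moreover have "sin (k * d) = sin (k * (x + d)) * cos (k * x) - cos (k * (x + d)) * sin (k * x)"
    unfolding sin_diff[symmetric] by (simp add: algebra_simps)
  ultimately have s: "sin (k * (x + d)) * cos (k * x) - cos (k * (x + d)) * sin (k * x) \<noteq> 0" by simp
  have "p * (sin (k * (x + d)) * cos (k * x) - cos (k * (x + d)) * sin (k * x)) =
      (p * cos (k * x) + r * sin (k * x)) * sin (k * (x + d)) -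
      (p * cos (k * (x + d)) + r * sin (k * (x + d))) * sin (k * x)" by (simp add: algebra_simps)
  then show "p = 0" using z[OF x(1)] z[OF x(2)] s by simp
  have "r * (sin (k * (x + d)) * cos (k * x) - cos (k * (x + d)) * sin (k * x)) =
      (p * cos (k * (x + d)) + r * sin (k * (x + d))) * cos (k * x) -
      (p * cos (k * x) + r * sin (k * x)) * cos (k * (x + d))" by (simp add: algebra_simps)
  then show "r = 0" using z[OF x(1)] z[OF x(2)] s by simp
qed

text \<open>
  Testing with the residual of the weighted orthogonal projection onto the span of the two
  solutions, the weight being positive exactly on the open interval.
\<close>

lemma annihilator_orthogonal_trig:
  fixes F :: "real \<Rightarrow> real"
  assumes k: "0 < k" and ab: "a < b" and F: "continuous_on UNIV F"
    and ann: "\<And>\<psi>. continuous_on UNIV \<psi> \<Longrightarrow> (\<And>x. x \<notin> {a..b} \<Longrightarrow> \<psi> x = 0) \<Longrightarrow>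
      integral {a..b} (\<lambda>x. \<psi> x * cos (k * x)) = 0 \<Longrightarrow> integral {a..b} (\<lambda>x. \<psi> x * sin (k * x)) = 0 \<Longrightarrow>
      integral {a..b} (\<lambda>x. \<psi> x * F x) = 0"
  shows "\<exists>A B. \<forall>x\<in>{a<..<b}. F x = A * cos (k * x) + B * sin (k * x)"
proof -
  define \<eta> where "\<eta> = (\<lambda>x::real. max 0 ((x - a) * (b - x)))"
  define ip where "ip = (\<lambda>p q. integral {a..b} (\<lambda>x. \<eta> x * p x * q x))"
  define c s where "c = (\<lambda>x. cos (k * x))" and "s = (\<lambda>x. sin (k * x))"
  have c\<eta>: "continuous_on T \<eta>" for T unfolding \<eta>_def by (intro continuous_intros)
  have cc: "continuous_on T c" and cs: "continuous_on T s" for T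
    unfolding c_def s_def by (intro continuous_intros)+
  have cF: "continuous_on T F" for T using F continuous_on_subset by blast
  have \<eta>pos: "\<eta> x > 0" if "x \<in> {a<..<b}" for x using that by (simp add: \<eta>_def less_max_iff_disj)
  have \<eta>0: "\<eta> x = 0" if "x \<notin> {a..b}" for x
  proof -
    have "(x - a) * (b - x) \<le> 0" using that ab by (auto simp: mult_le_0_iff)
    then show ?thesis by (simp add: \<eta>_def max_def)
  qed
  have ip_lin: "ip (\<lambda>x. p x - t * q x) r = ip p r - t * ip q r"
    if "continuous_on {a..b} p" "continuous_on {a..b} q" "continuous_on {a..b} r" for p q r t
  proof -
    have "ip (\<lambda>x. p x - t * q x) r = integral {a..b} (\<lambda>x. \<eta> x * p x * r x - t * (\<eta> x * q x * r x))"
      unfolding ip_def by (simp add: algebra_simps)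
    also have "\<dots> = integral {a..b} (\<lambda>x. \<eta> x * p x * r x) - integral {a..b} (\<lambda>x. t * (\<eta> x * q x * r x))"
      by (intro integral_diff integrable_continuous_real continuous_intros c\<eta> that)
    finally show ?thesis by (simp add: ip_def)
  qed
  have ip_sym: "ip p q = ip q p" for p q unfolding ip_def by (simp add: mult_ac)
  have ip_zero: "p x = 0" if p: "continuous_on {a..b} p" "ip p p = 0" "x \<in> {a<..<b}" for p x
  proof -
    have "integral {a..b} (\<lambda>x. \<eta> x * p x * p x) = 0 \<longleftrightarrow> (\<forall>x\<in>{a..b}. \<eta> x * p x * p x = 0)"
      by (intro integral_eq_0_iff continuous_intros c\<eta> p ab)
        (simp add: \<eta>_def mult.assoc)
    then have "\<eta> x * p x * p x = 0" using p(2,3) by (auto simp: ip_def)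
    then show ?thesis using \<eta>pos[OF p(3)] by simp
  qed
  have cc0: "ip c c \<noteq> 0"
  proof
    assume "ip c c = 0"
    then have "1 * cos (k * x) + 0 * sin (k * x) = 0" if "x \<in> {a<..<b}" for x
      using ip_zero[of c x] cc that by (simp add: c_def)
    from cos_sin_independent(1)[OF k ab this] show False by simp
  qed
  \<comment> \<open>Gram-Schmidt for the weighted product. Neither \<open>c\<close> nor
    \<open>s'\<close> has norm zero, by independence of cosine and sine on the interval.\<close>
  define t where "t = ip s c / ip c c"
  define s' where "s' = (\<lambda>x. s x - t * c x)"
  have cs': "continuous_on T s'" for T unfolding s'_def by (intro continuous_intros cs cc)
  have s'c: "ip s' c = 0" unfolding s'_def using ip_lin[of s c c t] cc cs cc0 by (simp add: t_def)
  have ss0: "ip s' s' \<noteq> 0"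
  proof
    assume "ip s' s' = 0"
    then have "(- t) * cos (k * x) + 1 * sin (k * x) = 0" if "x \<in> {a<..<b}" for x
      using ip_zero[of s' x] cs' that by (simp add: s'_def s_def c_def)
    from cos_sin_independent(2)[OF k ab this] show False by simp
  qed
  define A B where "A = ip F c / ip c c" and "B = ip F s' / ip s' s'"
  define h0 where "h0 = (\<lambda>x. F x - A * c x)"
  define h where "h = (\<lambda>x. h0 x - B * s' x)"
  have ch0: "continuous_on T h0" for T unfolding h0_def by (intro continuous_intros cF cc)
  have ch: "continuous_on T h" for T unfolding h_def by (intro continuous_intros ch0 cs')
  have hc: "ip h c = 0"
    unfolding h_def using ip_lin[OF ch0 cs' cc, of B] ip_lin[OF cF cc cc, of A] s'c cc0
    by (simp add: h0_def A_def)
  have hs': "ip h s' = 0"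
    unfolding h_def using ip_lin[OF ch0 cs' cs', of B] ip_lin[OF cF cc cs', of A] s'c ss0 ip_sym[of c s']
    by (simp add: h0_def B_def)
  have hs: "ip h s = 0"
    using ip_lin[OF cs cc ch, of t] hc hs' unfolding s'_def[symmetric] by (simp add: ip_sym)
  \<comment> \<open>\<open>\<eta> * h\<close> is an admissible source, so \<open>h\<close> is
    orthogonal to \<open>F\<close> as well as to both solutions. As \<open>F - h\<close> is a
    combination of the solutions, \<open>h\<close> is orthogonal to itself.\<close>
  have "integral {a..b} (\<lambda>x. \<eta> x * h x * F x) = 0"
    using hc hs unfolding ip_def c_def s_def
    by (intro ann) (auto intro!: continuous_intros c\<eta> ch simp: \<eta>0)
  then have hF: "ip h F = 0" by (simp add: ip_def)
  have "ip h h = 0"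
    using ip_lin[OF ch0 cs' ch, of B] ip_lin[OF cF cc ch, of A] hF hc hs'
    unfolding h_def[symmetric] h0_def[symmetric] by (simp add: ip_sym)
  then have "h x = 0" if "x \<in> {a<..<b}" for x using ip_zero[OF ch _ that] by simp
  then have "F x = A * c x + B * (s x - t * c x)" if "x \<in> {a<..<b}" for x
    using that unfolding h_def h0_def s'_def by (simp add: algebra_simps)
  then have "F x = (A - B * t) * cos (k * x) + B * sin (k * x)" if "x \<in> {a<..<b}" for x
    using that by (simp add: c_def s_def left_diff_distrib right_diff_distrib)
  then show ?thesis by blast
qed

text \<open>Sources must stay away from the ends, so coefficients are first found on inner
  subintervals. They agree by comparison on the middle half, and continuity adds the two end
  points.\<close>

lemma annihilator_orthogonal_trig_global:
  fixes F :: "real \<Rightarrow> real"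
  assumes k: "0 < k" and l: "0 < l" and F: "continuous_on UNIV F"
    and ann: "\<And>\<psi> a b. 0 < a \<Longrightarrow> a < b \<Longrightarrow> b < l \<Longrightarrow> continuous_on UNIV \<psi> \<Longrightarrow> (\<And>x. x \<notin> {a..b} \<Longrightarrow> \<psi> x = 0) \<Longrightarrow>
      integral {a..b} (\<lambda>x. \<psi> x * cos (k * x)) = 0 \<Longrightarrow> integral {a..b} (\<lambda>x. \<psi> x * sin (k * x)) = 0 \<Longrightarrow>
      integral {a..b} (\<lambda>x. \<psi> x * F x) = 0"
  shows "\<exists>A B. \<forall>x\<in>{0..l}. F x = A * cos (k * x) + B * sin (k * x)"
proof -
  have loc: "\<exists>A B. \<forall>x\<in>{a<..<b}. F x = A * cos (k * x) + B * sin (k * x)" if "0 < a" "a < b" "b < l" for a b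
    by (rule annihilator_orthogonal_trig[OF k that(2) F]) (rule ann[OF that])
  obtain A B where AB: "\<And>x. x \<in> {l/4<..<3*l/4} \<Longrightarrow> F x = A * cos (k * x) + B * sin (k * x)"
    using loc[of "l/4" "3*l/4"] l by auto
  have inner: "F x = A * cos (k * x) + B * sin (k * x)" if x: "x \<in> {0<..<l}" for x
  proof -
    \<comment> \<open>The subinterval is chosen to contain both \<open>x\<close> and the middle
      half.\<close>
    define a b where "a = min (x/2) (l/4)" and "b = max ((x+l)/2) (3*l/4)"
    have ab: "0 < a" "a < b" "b < l" "x \<in> {a<..<b}" and sub: "{l/4<..<3*l/4} \<subseteq> {a<..<b}"
      using x l by (auto simp: a_def b_def min_def max_def)
    obtain A' B' where A'B': "\<And>x. x \<in> {a<..<b} \<Longrightarrow> F x = A' * cos (k * x) + B' * sin (k * x)"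
      using loc[OF ab(1-3)] by auto
    have z: "(A' - A) * cos (k * y) + (B' - B) * sin (k * y) = 0" if "y \<in> {l/4<..<3*l/4}" for y
      using AB[OF that] A'B'[of y] that sub by (auto simp: algebra_simps)
    have "l/4 < 3*l/4" using l by simp
    from cos_sin_independent[OF k this z] have "A' = A" "B' = B" by auto
    then show ?thesis using A'B'[OF ab(4)] by simp
  qed
  have "continuous_on (closure {0<..<l}) (\<lambda>x. F x - (A * cos (k * x) + B * sin (k * x)))"
    by (intro continuous_intros continuous_on_subset[OF F]) auto
  from continuous_constant_on_closure[OF this, of 0]
  have "F x - (A * cos (k * x) + B * sin (k * x)) = 0" if "x \<in> {0..l}" for x
    using inner l that by auto
  then show ?thesis by (intro exI[of _ A] exI[of _ B]) auto
qed

text \<open>Regularity: it allows arbitrary weak eigenfunctions to be described by their vertex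
  data. Real and imaginary parts are treated separately because the projection argument is for real
  functions.\<close>

lemma weak_solution_trig:
  fixes f g :: "real \<Rightarrow> complex"
  assumes k: "0 < k" and l: "0 < l" and f: "continuous_on {0..l} f"
    and w: "weak_derivative l f g" "weak_derivative l g (\<lambda>x. - (complex_of_real (k\<^sup>2) * f x))"
  shows "\<exists>A B. \<forall>x\<in>{0..l}. f x = trig_fun k A B x"
proof -
  \<comment> \<open>Clamping the argument extends \<open>f\<close> continuously to the whole line,
    as the projection lemmas require, without changing it on \<open>{0..l}\<close>.\<close>
  define fe where "fe = (\<lambda>x. f (max 0 (min l x)))"
  have fe: "fe x = f x" if "x \<in> {0..l}" for x using that by (auto simp: fe_def)
  have cfe: "continuous_on UNIV fe"
    unfolding fe_def using l by (intro continuous_on_compose2[OF f] continuous_intros) auto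
  have key: "integral {a..b} (\<lambda>x. \<psi> x *\<^sub>R fe x) = 0"
    if ab: "0 < a" "a < b" "b < l" and \<psi>: "continuous_on UNIV \<psi>" "\<And>x. x \<notin> {a..b} \<Longrightarrow> \<psi> x = 0"
      and orth: "integral {a..b} (\<lambda>x. \<psi> x * cos (k * x)) = 0" "integral {a..b} (\<lambda>x. \<psi> x * sin (k * x)) = 0"
    for \<psi> a b
  proof -
    have "integral {0..l} (\<lambda>x. \<psi> x *\<^sub>R fe x) = integral {0..l} (\<lambda>x. \<psi> x *\<^sub>R f x)"
      using fe by (intro integral_cong) auto
    also have "\<dots> = 0" by (rule weak_solution_orthogonal[OF k ab f w \<psi> orth])
    finally have 0: "integral {0..l} (\<lambda>x. \<psi> x *\<^sub>R fe x) = 0" .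
    have "integral {a..b} (\<lambda>x. \<psi> x *\<^sub>R fe x) =
        integral {0..l} (\<lambda>x. if x \<in> {a..b} then \<psi> x *\<^sub>R fe x else 0)"
      using ab by (subst integral_restrict_Int) (simp add: Int_absorb2 Int_absorb1)
    also have "\<dots> = integral {0..l} (\<lambda>x. \<psi> x *\<^sub>R fe x)"
      using \<psi>(2) by (intro integral_cong) auto
    finally show ?thesis using 0 by simp
  qed
  have comp: "integral {a..b} (\<lambda>x. \<psi> x * L (fe x)) = 0"
    if L: "bounded_linear L" and ab: "0 < a" "a < b" "b < l" and \<psi>: "continuous_on UNIV \<psi>" "\<And>x. x \<notin> {a..b} \<Longrightarrow> \<psi> x = 0"
      and orth: "integral {a..b} (\<lambda>x. \<psi> x * cos (k * x)) = 0" "integral {a..b} (\<lambda>x. \<psi> x * sin (k * x)) = 0"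
    for \<psi> a b and L :: "complex \<Rightarrow> real"
  proof -
    have "(\<lambda>x. \<psi> x *\<^sub>R fe x) integrable_on {a..b}"
      by (intro integrable_continuous_real continuous_intros continuous_on_subset[OF \<psi>(1)]
          continuous_on_subset[OF cfe]) auto
    from integral_linear[OF this L] show ?thesis
      using key[OF ab \<psi> orth] linear_simps(3)[OF L] linear_simps(5)[OF L] by (simp add: comp_def)
  qed
  have "\<exists>A B. \<forall>x\<in>{0..l}. Re (fe x) = A * cos (k * x) + B * sin (k * x)"
    by (rule annihilator_orthogonal_trig_global[OF k l])
      (auto intro!: continuous_intros cfe comp bounded_linear_Re)
  moreover have "\<exists>A B. \<forall>x\<in>{0..l}. Im (fe x) = A * cos (k * x) + B * sin (k * x)"
    by (rule annihilator_orthogonal_trig_global[OF k l])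
      (auto intro!: continuous_intros cfe comp bounded_linear_Im)
  ultimately obtain A B A' B' where
    "\<And>x. x \<in> {0..l} \<Longrightarrow> Re (f x) = A * cos (k * x) + B * sin (k * x)"
    "\<And>x. x \<in> {0..l} \<Longrightarrow> Im (f x) = A' * cos (k * x) + B' * sin (k * x)"
    using fe by metis
  then have "f x = trig_fun k (Complex A A') (Complex B B') x" if "x \<in> {0..l}" for x
    using that by (simp add: trig_fun_def complex_eq_iff algebra_simps)
  then show ?thesis by blast
qed

section \<open>Recurrence of the phases\<close>

lemma cos_sin_minus_2pi_int:
  "cos (x - 2 * pi * of_int p) = cos x" "sin (x - 2 * pi * of_int p) = sin x"
  by (simp_all add: cos_diff sin_diff cos_int_2pin sin_int_2pin)

lemma simultaneous_recurrence:
  fixes len :: "'e \<Rightarrow> real"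
  assumes "finite E" "\<epsilon> > 0"
  obtains K and p :: "'e \<Rightarrow> int" where "K \<ge> R" "\<And>e. e \<in> E \<Longrightarrow> \<bar>K * len e - 2 * pi * of_int (p e)\<bar> < \<epsilon>"
proof -
  obtain h where h: "bij_betw h {0..<card E} E" using ex_bij_betw_nat_finite[OF assms(1)] by auto
  \<comment> \<open>Dirichlet's theorem guarantees only a multiplier \<open>q \<ge> 1\<close>;
    scaling the lengths by \<open>Q\<close> beforehand makes \<open>K = q * Q\<close> at least
    \<open>R\<close>.\<close>
  define Q where "Q = max R 1"
  obtain N where N: "N > 0" "2 * pi / \<epsilon> < real N"
    using reals_Archimedean2[of "2 * pi / \<epsilon>"] assms(2) by (metis divide_pos_pos gr0I less_trans of_nat_0
        order_less_asym pi_gt_zero zero_less_mult_iff zero_less_numeral)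
  obtain q p where q: "0 < q" and p: "\<And>i. i < card E \<Longrightarrow>
      \<bar>of_int q * (Q * len (h i) / (2 * pi)) - of_int (p i)\<bar> < 1 / real N"
    using Dirichlet_approx_simult[OF N(1), of "card E" "\<lambda>i. Q * len (h i) / (2 * pi)"] by metis
  define g where "g = the_inv_into {0..<card E} h"
  show ?thesis
  proof (rule that[of "of_int q * Q" "\<lambda>e. p (g e)"])
    have "1 * Q \<le> of_int q * Q" using q by (intro mult_right_mono) (auto simp: Q_def)
    then show "R \<le> of_int q * Q" by (auto simp: Q_def)
    fix e assume e: "e \<in> E"
    then have g: "g e < card E" "h (g e) = e"
      using bij_betw_apply[OF bij_betw_the_inv_into[OF h] e] f_the_inv_into_f_bij_betw[OF h]
      by (simp_all add: g_def)
    have "of_int q * Q * len e - 2 * pi * of_int (p (g e)) =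
        2 * pi * (of_int q * (Q * len e / (2 * pi)) - of_int (p (g e)))"
      by (simp add: field_simps)
    then have "\<bar>of_int q * Q * len e - 2 * pi * of_int (p (g e))\<bar> =
        2 * pi * \<bar>of_int q * (Q * len e / (2 * pi)) - of_int (p (g e))\<bar>"
      by (simp add: abs_mult)
    also have "\<dots> < 2 * pi * (1 / real N)"
      using p[OF g(1)] g(2) by (intro mult_strict_left_mono) auto
    also have "\<dots> < \<epsilon>" using N assms(2) by (simp add: field_simps)
    finally show "\<bar>of_int q * Q * len e - 2 * pi * of_int (p (g e))\<bar> < \<epsilon>" .
  qed
qed

section \<open>Frequency windows for the two cases\<close>

lemma dirichlet_positive_solution:
  fixes G :: "('v, 'e) pre_digraph" and \<alpha> :: "'v \<Rightarrow> real"
  assumes cmg: "compact_metric_graph G len" and con: "Digraph_Component.connected G"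
    and VD: "VD \<subseteq> verts G" "VD \<noteq> {}" "\<And>v. v \<in> VD \<Longrightarrow> vertex_degree G v = 1"
      "\<And>e. e \<in> arcs G \<Longrightarrow> tail G e \<in> VD \<Longrightarrow> head G e \<notin> VD"
  shows "\<exists>k>R. 0 < k \<and> (\<forall>e\<in>arcs G. sin (k * len e) > 0) \<and> (\<exists>w. (\<forall>v\<in>VD. w v = 0) \<and>
    (\<forall>v\<in>verts G - VD. w v > 0 \<and>
      (\<Sum>e\<in>incident_arcs G v. arc_flux G (\<lambda>e. k * len e) w e v) = \<alpha> v / k * w v))"
proof -
  interpret compact_metric_graph G len by fact
  have G: "fin_digraph G" "loopfree_digraph G" by unfold_locales
  define E where "E = arcs G"
  have E: "finite E" "E \<noteq> {}" using arcs_nonempty by (auto simp: E_def)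
  define L \<mu> where "L = Max (len ` E)" and "\<mu> = Min (len ` E)"
  have "L \<in> len ` E" "\<mu> \<in> len ` E" using E by (auto simp: L_def \<mu>_def)
  then obtain e0 where e0: "e0 \<in> E" "len e0 = L" and "\<mu> > 0" using len_pos by (auto simp: E_def)
  have lens: "\<mu> \<le> len e" "len e \<le> L" if "e \<in> E" for e using that E by (auto simp: L_def \<mu>_def)
  have L: "L > 0" using e0 len_pos by (auto simp: E_def)
  \<comment> \<open>Past \<open>K\<close> the phase of \<open>e\<close> advances
    \<open>rat e\<close> times as fast as that of the longest arc; \<open>\<rho>\<close> is the
    slowest relative speed.\<close>
  define \<rho> where "\<rho> = \<mu> / L"
  have \<rho>: "0 < \<rho>" "\<rho> \<le> 1" using \<open>\<mu> > 0\<close> L lens[OF e0(1)] by (auto simp: \<rho>_def)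
  define rat where "rat e = len e / L" for e
  have rat: "\<rho> \<le> rat e" "rat e \<le> 1" "len e = rat e * L" if "e \<in> E" for e
    using lens[OF that] L by (auto simp: rat_def \<rho>_def divide_right_mono)
  define n m where "n = real (card E)" and "m = real (card (verts G))"
  have nm: "n \<ge> 0" "m \<ge> 0" by (auto simp: n_def m_def)
  obtain v0 where v0: "v0 \<in> VD" using VD(2) by auto
  then have v0V: "v0 \<in> verts G" using VD(1) by auto
  obtain C :: real where C: "C > 0" and "\<forall>u. u v0 = 0 \<longrightarrow>
      (\<Sum>v\<in>verts G. (u v)\<^sup>2) \<le> C * (\<Sum>e\<in>arcs G. (u (tail G e) - u (head G e))\<^sup>2)"
    using poincare_inequality[OF G(1) con v0V] by (elim exE conjE) (rule that)
  note poin = this(2)[rule_format]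
  \<comment> \<open>On unit vectors vanishing at \<open>v0\<close> the difference energy is at least
    \<open>1 / C\<close>, so at phases up to \<open>\<tau>\<close> the form is at least
    \<open>1 / (C * \<tau>) - 2 * n - 1 \<ge> 1\<close>.\<close>
  define \<tau> where "\<tau> = min 1 (1 / (C * (2 * n + 2)))"
  have \<tau>: "0 < \<tau>" "\<tau> \<le> 1" using C nm by (auto simp: \<tau>_def)
  have \<tau>C: "1 / (C * \<tau>) \<ge> 2 * n + 2"
  proof -
    have "\<tau> \<le> 1 / (C * (2 * n + 2))" by (simp add: \<tau>_def)
    moreover have "0 < C * (2 * n + 2)" using C nm by (intro mult_pos_pos) auto
    ultimately have "\<tau> * (C * (2 * n + 2)) \<le> 1" by (simp only: pos_le_divide_eq)
    then have "(2 * n + 2) * (C * \<tau>) \<le> 1" by (simp only: mult_ac)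
    moreover have "0 < C * \<tau>" using C \<tau> by simp
    ultimately show ?thesis by (simp only: pos_le_divide_eq)
  qed
  \<comment> \<open>By \<open>b\<close> every phase has advanced at least
    \<open>pi / 4 * \<rho> = 2 * c\<close> past \<open>d e\<close>; the error
    \<open>\<epsilon> \<le> c / 2\<close> leaves at least \<open>c\<close>.\<close>
  define c where "c = \<rho> * pi / 8"
  have c: "0 < c" "c \<le> pi / 2" using \<rho> pi_gt_zero by (auto simp: c_def)
  \<comment> \<open>\<open>N\<close> outweighs the at most \<open>2 / sin c\<close> from each arc
    and the at most 1 per vertex from the couplings; \<open>\<phi>\<close> is the obtuse angle with
    cotangent \<open>- N\<close>.\<close>
  define N where "N = 2 * n / sin c + m + 1"
  define \<phi> where "\<phi> = pi / 2 + arctan N"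
  have "sin c > 0" using c pi_gt_zero by (intro sin_gt_zero) auto
  then have "N > 0" using nm by (auto simp: N_def intro: add_nonneg_pos add_nonneg_nonneg)
  then have \<phi>: "pi / 2 < \<phi>" "\<phi> < pi" using arctan_bounded[of N] by (auto simp: \<phi>_def)
  \<comment> \<open>The three bounds keep all phases, in this order, positive at \<open>a\<close>,
    below \<open>pi\<close> at \<open>b\<close>, and at least \<open>c\<close> at
    \<open>b\<close>.\<close>
  define \<epsilon> where "\<epsilon> = min (\<tau> * \<rho> / 4) (min ((pi - \<phi>) / 4) (c / 2))"
  have \<epsilon>: "0 < \<epsilon>" "\<epsilon> \<le> \<tau> * \<rho> / 4" "\<epsilon> \<le> (pi - \<phi>) / 4" "\<epsilon> \<le> c / 2"
    unfolding \<epsilon>_def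
    by (simp add: \<tau> \<rho> \<phi> c, rule min.cobounded1, rule min.coboundedI2[OF min.cobounded1],
        rule min.coboundedI2[OF min.cobounded2])
  \<comment> \<open>Beyond the sum of all \<open>\<bar>\<alpha> v\<bar>\<close> every scaled
    coupling is at most 1 in absolute value.\<close>
  obtain K p where K: "K \<ge> max (R + 1) (\<bar>\<Sum>v\<in>verts G. \<bar>\<alpha> v\<bar>\<bar> + 1)"
    and p: "\<And>e. e \<in> E \<Longrightarrow> \<bar>K * len e - 2 * pi * of_int (p e)\<bar> < \<epsilon>"
    using simultaneous_recurrence[OF E(1) \<epsilon>(1)] by metis
  define d where "d e = K * len e - 2 * pi * of_int (p e)" for e
  have d: "- \<epsilon> < d e" "d e < \<epsilon>" if "e \<in> E" for e using p[OF that] by (auto simp: d_def abs_less_iff)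
  define \<theta> where "\<theta> e k = k * len e - 2 * pi * of_int (p e)" for e k
  \<comment> \<open>\<open>b\<close> absorbs the error \<open>d e0\<close>, so that the longest arc
    has phase exactly \<open>\<phi>\<close> there; at \<open>a\<close> its phase exceeds the error
    by \<open>\<tau> / 2\<close>.\<close>
  define a b where "a = K + \<tau> / (2 * L)" and "b = K + (\<phi> - d e0) / L"
  have \<tau>\<rho>: "\<tau> * \<rho> \<le> 1 * 1" using \<tau> \<rho> by (intro mult_mono) auto
  have gap: "\<phi> - d e0 \<ge> pi / 4" "\<phi> - d e0 \<le> \<phi> + \<epsilon>"
    using d[OF e0(1)] \<phi> \<epsilon>(2) \<tau>\<rho> pi_gt3 by linarith+
  have "\<tau> / 2 \<le> \<phi> - d e0" using gap \<tau> pi_gt3 by linarith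
  then have ab: "a \<le> b" using L by (simp add: a_def b_def divide_simps)
  have \<theta>a: "\<theta> e a = d e + \<tau> / 2 * rat e" and \<theta>b: "\<theta> e b = d e + (\<phi> - d e0) * rat e" if "e \<in> E" for e
    using L rat(3)[OF that] by (auto simp: \<theta>_def a_def b_def d_def field_simps)
  have boundsa: "0 < \<theta> e a \<and> \<theta> e a \<le> \<tau>" if e: "e \<in> E" for e
  proof -
    have "\<tau> / 2 * \<rho> \<le> \<tau> / 2 * rat e" "\<tau> / 2 * rat e \<le> \<tau> / 2 * 1"
      using rat[OF e] \<tau> by (intro mult_left_mono; simp)+
    moreover have "\<tau> * \<rho> \<le> \<tau> * 1" "0 < \<tau> * \<rho>" using \<tau> \<rho> by (auto intro: mult_left_mono)
    ultimately show ?thesis using d[OF e] \<epsilon>(2) unfolding \<theta>a[OF e] by linarith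
  qed
  have boundsb: "c \<le> \<theta> e b \<and> \<theta> e b < pi" if e: "e \<in> E" for e
  proof -
    have pos: "0 \<le> \<phi> - d e0" using gap(1) pi_gt_zero by linarith
    have "pi / 4 * \<rho> \<le> (\<phi> - d e0) * rat e"
      using pos rat(1)[OF e] gap(1) \<rho>(1) by (intro mult_mono) simp_all
    moreover have "2 * c = pi / 4 * \<rho>" by (simp add: c_def)
    ultimately have "2 * c \<le> (\<phi> - d e0) * rat e" by (simp only:)
    moreover have "(\<phi> - d e0) * rat e \<le> \<phi> + \<epsilon>"
      using mult_left_le[OF rat(2)[OF e] pos] gap(2) by (rule order_trans)
    moreover have "\<phi> + \<epsilon> + \<epsilon> < pi" using \<epsilon>(3) \<phi>(2) by (simp add: field_simps)
    ultimately show ?thesis using d[OF e] \<epsilon>(4) c(1) unfolding \<theta>b[OF e] by (intro conjI) linarith+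
  qed
  have K': "R + 1 \<le> K" "\<bar>\<Sum>v\<in>verts G. \<bar>\<alpha> v\<bar>\<bar> + 1 \<le> K" using K by (simp_all only: max.bounded_iff)
  then have Kpos: "K > R" "K > 0" by linarith+
  have aK: "a \<ge> K" using L \<tau> by (simp add: a_def)
  have \<theta>pos: "sin (\<theta> e k) > 0" if e: "e \<in> arcs G" and k: "k \<in> {a..b}" for e k
  proof -
    have "len e > 0" using e len_pos by simp
    then have "\<theta> e a \<le> \<theta> e k" "\<theta> e k \<le> \<theta> e b"
      using k by (auto simp: \<theta>_def)
    then show ?thesis using boundsa[of e] boundsb[of e] e by (intro sin_gt_zero) (auto simp: E_def)
  qed
  have \<beta>1: "\<bar>\<alpha> v / k\<bar> \<le> 1" if "v \<in> verts G" "k \<ge> a" for v k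
  proof -
    have "\<bar>\<alpha> v\<bar> \<le> (\<Sum>v\<in>verts G. \<bar>\<alpha> v\<bar>)" using that by (intro member_le_sum) auto
    then have "\<bar>\<alpha> v\<bar> \<le> K" using K'(2) by linarith
    then show ?thesis using that aK Kpos by (simp add: abs_divide)
  qed
  \<comment> \<open>The test vector is the indicator of the non-Dirichlet ends of the longest arc;
    at least one exists because no arc joins two Dirichlet vertices.\<close>
  define u0 where "u0 v = (if v \<in> {tail G e0, head G e0} - VD then 1 else 0 :: real)" for v
  have e0V: "tail G e0 \<in> verts G" "head G e0 \<in> verts G" using e0 by (auto simp: E_def)
  have "\<exists>k\<in>{a..b}. \<exists>w. (\<forall>v\<in>VD. w v = 0) \<and> (\<forall>v\<in>verts G - VD. w v > 0 \<and>
     (\<Sum>e\<in>incident_arcs G v. arc_flux G (\<lambda>e. \<theta> e k) w e v) = \<alpha> v / k * w v)"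
  proof (rule first_positive_null_vector[where \<beta> = "\<lambda>v k. \<alpha> v / k" and ?u0.0 = u0])
    show "continuous_on {a..b} (\<theta> e)" for e unfolding \<theta>_def by (intro continuous_intros)
    show "continuous_on {a..b} (\<lambda>k. \<alpha> v / k)" for v
      using aK Kpos by (intro continuous_intros) auto
    show "graph_form G (\<lambda>e. \<theta> e a) (\<lambda>v. \<alpha> v / a) u > 0"
      if u: "\<And>v. v \<in> VD \<Longrightarrow> u v = 0" "(\<Sum>v\<in>verts G. (u v)\<^sup>2) = 1" for u
    proof -
      define D where "D = (\<Sum>e\<in>arcs G. (u (tail G e) - u (head G e))\<^sup>2)"
      have "1 \<le> C * D" using poin[of u] u(1)[OF v0] u(2) by (simp add: D_def)
      then have "1 / (C * \<tau>) \<le> D / \<tau>" using C \<tau> by (simp add: field_simps)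
      moreover have "D / \<tau> - 2 * card (arcs G) - 1 \<le> graph_form G (\<lambda>e. \<theta> e a) (\<lambda>v. \<alpha> v / a) u"
        unfolding D_def
      proof (rule graph_form_small_angle[OF G(1) \<tau>(2)])
        show "0 < \<theta> e a \<and> \<theta> e a \<le> \<tau>" if "e \<in> arcs G" for e using boundsa that by (simp add: E_def)
        show "\<alpha> v / a \<le> 1" if "v \<in> verts G" for v using abs_le_D1[OF \<beta>1[OF that order_refl]] .
      qed (rule u(2))
      ultimately show ?thesis using \<tau>C by (simp add: n_def E_def)
    qed
    show "u0 v = 0" if "v \<notin> verts G - VD" for v using that e0V by (auto simp: u0_def)
    have ends: "tail G e0 \<notin> VD \<or> head G e0 \<notin> VD" using VD(4)[of e0] e0 by (auto simp: E_def)
    then show "\<exists>v\<in>verts G. u0 v \<noteq> 0" using e0V by (auto simp: u0_def)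
    have u01: "u0 v \<in> {0, 1}" for v by (simp add: u0_def)
    have "(\<Sum>e\<in>arcs G. arc_form (\<theta> e b) (u0 (tail G e)) (u0 (head G e))) =
        arc_form (\<theta> e0 b) (u0 (tail G e0)) (u0 (head G e0)) +
        (\<Sum>e\<in>arcs G - {e0}. arc_form (\<theta> e b) (u0 (tail G e)) (u0 (head G e)))"
      using e0 by (intro sum.remove) (auto simp: E_def)
    also have "\<dots> \<le> - N + (\<Sum>e\<in>arcs G - {e0}. 2 / sin c)"
    proof (intro add_mono sum_mono)
      have "\<theta> e0 b = \<phi>" using \<theta>b[OF e0(1)] e0 L by (simp add: rat_def)
      moreover have "u0 (tail G e0) \<noteq> 0 \<or> u0 (head G e0) \<noteq> 0" using ends by (auto simp: u0_def)
      ultimately show "arc_form (\<theta> e0 b) (u0 (tail G e0)) (u0 (head G e0)) \<le> - N"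
        unfolding \<phi>_def using arc_form_obtuse_le[OF u01 u01] by simp
      show "arc_form (\<theta> e b) (u0 (tail G e)) (u0 (head G e)) \<le> 2 / sin c" if "e \<in> arcs G - {e0}" for e
        using boundsb[of e] that c by (intro arc_form_indicator_le u01) (simp_all add: E_def)
    qed
    also have "(\<Sum>e\<in>arcs G - {e0}. 2 / sin c) \<le> (\<Sum>e\<in>arcs G. 2 / sin c)"
      using \<open>sin c > 0\<close> by (intro sum_mono2) auto
    also have "\<dots> = 2 * n / sin c" by (simp add: n_def E_def)
    finally have 1: "(\<Sum>e\<in>arcs G. arc_form (\<theta> e b) (u0 (tail G e)) (u0 (head G e))) \<le> - N + 2 * n / sin c"
      by simp
    have "(\<Sum>v\<in>verts G. - (\<alpha> v / b * (u0 v)\<^sup>2)) \<le> (\<Sum>v\<in>verts G. 1)"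
    proof (rule sum_mono)
      fix v assume v: "v \<in> verts G"
      have "- (\<alpha> v / b) \<le> 1" using abs_le_D2[OF \<beta>1[OF v ab]] .
      then show "- (\<alpha> v / b * (u0 v)\<^sup>2) \<le> 1" by (simp add: u0_def)
    qed
    then have "- (\<Sum>v\<in>verts G. \<alpha> v / b * (u0 v)\<^sup>2) \<le> m" by (simp add: m_def sum_negf)
    then show "graph_form G (\<lambda>e. \<theta> e b) (\<lambda>v. \<alpha> v / b) u0 \<le> 0"
      unfolding graph_form_def using 1 by (simp add: N_def)
  qed (fact G con ab VD \<theta>pos)+
  then obtain k w where k: "k \<in> {a..b}" and w: "\<forall>v\<in>VD. w v = 0" "\<forall>v\<in>verts G - VD. w v > 0 \<and>
     (\<Sum>e\<in>incident_arcs G v. arc_flux G (\<lambda>e. \<theta> e k) w e v) = \<alpha> v / k * w v" by (elim bexE exE conjE) (rule that)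
  have "arc_flux G (\<lambda>e. \<theta> e k) w = arc_flux G (\<lambda>e. k * len e) w"
    by (intro ext) (simp add: arc_flux_def \<theta>_def cos_sin_minus_2pi_int)
  moreover have "sin (k * len e) > 0" if "e \<in> arcs G" for e
    using \<theta>pos[OF that k] by (simp add: \<theta>_def cos_sin_minus_2pi_int)
  moreover have "k > R" "k > 0" using k aK Kpos by auto
  ultimately show ?thesis using w by auto
qed

lemma tree_nonvanishing_solution:
  fixes G :: "('v, 'e) pre_digraph" and \<alpha> :: "'v \<Rightarrow> real"
  assumes cmg: "compact_metric_graph G len" and tree: "grown_tree G r (verts G) (arcs G)"
  shows "\<exists>k>R. 0 < k \<and>
    (\<exists>u q. discrete_solution G (\<lambda>e. k * len e) (verts G) (arcs G) (\<lambda>v. \<alpha> v / k) u q \<and> (\<forall>v\<in>verts G. u v \<noteq> 0)) \<and>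
    (\<forall>u q. discrete_solution G (\<lambda>e. k * len e) (verts G) (arcs G) (\<lambda>v. \<alpha> v / k) u q \<longrightarrow> u r = 0 \<longrightarrow>
       (\<forall>v\<in>verts G. u v = 0) \<and> (\<forall>e\<in>arcs G. q e (tail G e) = 0))"
proof -
  interpret compact_metric_graph G len by fact
  define E where "E = arcs G"
  have E: "finite E" "E \<noteq> {}" using arcs_nonempty by (auto simp: E_def)
  define L \<mu> where "L = Max (len ` E)" and "\<mu> = Min (len ` E)"
  have "L \<in> len ` E" "\<mu> \<in> len ` E" using E by (auto simp: L_def \<mu>_def)
  then have L: "L > 0" and \<mu>: "\<mu> > 0" using len_pos by (auto simp: E_def)
  have lens: "\<mu> \<le> len e" "len e \<le> L" if "e \<in> E" for e using that E by (auto simp: L_def \<mu>_def)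
  \<comment> \<open>\<open>\<eta>\<close> bounds the phases, half from the window and half from the
    recurrence error, and also the couplings; this makes
    \<open>(B + \<eta>) * 3 ^ card (verts G) \<le> 1\<close>.\<close>
  define \<eta> :: real where "\<eta> = 1 / (2 * 3 ^ card (verts G))"
  have \<eta>: "\<eta> > 0" by (simp add: \<eta>_def)
  define \<delta> where "\<delta> = \<eta> / (2 * L)"
  have \<delta>: "\<delta> > 0" "\<delta> * L = \<eta> / 2" using \<eta> L by (auto simp: \<delta>_def)
  \<comment> \<open>At the window ends every phase has moved by at least \<open>2 * \<tau>\<close>
    from \<open>d e\<close>, whose size is below \<open>\<epsilon> \<le> \<tau>\<close>, so a margin
    of \<open>\<tau>\<close> remains on the correct side of zero. The couplings may use up half of
    it.\<close>
  define \<tau> where "\<tau> = \<delta> * \<mu> / 2"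
  have \<tau>: "\<tau> > 0" using \<delta> \<mu> by (simp add: \<tau>_def)
  define \<epsilon> where "\<epsilon> = min (\<eta> / 2) \<tau>"
  have \<epsilon>: "\<epsilon> > 0" "\<epsilon> \<le> \<eta> / 2" "\<epsilon> \<le> \<tau>" using \<eta> \<tau> by (auto simp: \<epsilon>_def)
  define B where "B = min \<eta> (\<tau> / 2)"
  have B: "B > 0" "B \<le> \<eta>" "B \<le> \<tau> / 2" using \<eta> \<tau> by (auto simp: B_def)
  define A where "A = (\<Sum>v\<in>verts G. \<bar>\<alpha> v\<bar>)"
  have A: "A \<ge> 0" by (auto simp: A_def intro: sum_nonneg)
  \<comment> \<open>The added \<open>\<delta>\<close> keeps the left end \<open>K - \<delta>\<close>
    above all thresholds; \<open>A / B\<close> forces the scaled couplings below \<open>B\<close>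
    across the window.\<close>
  obtain K p where K: "K \<ge> max (R + 1) (max 1 (A / B)) + \<delta>"
    and p: "\<And>e. e \<in> E \<Longrightarrow> \<bar>K * len e - 2 * pi * of_int (p e)\<bar> < \<epsilon>"
    using simultaneous_recurrence[OF E(1) \<epsilon>(1)] by metis
  define d where "d e = K * len e - 2 * pi * of_int (p e)" for e
  have d: "- \<epsilon> < d e" "d e < \<epsilon>" if "e \<in> E" for e using p[OF that] by (auto simp: d_def abs_less_iff)
  define \<theta> where "\<theta> e k = k * len e - 2 * pi * of_int (p e)" for e k
  define a b where "a = K - \<delta>" and "b = K + \<delta>"
  have a: "a > R" "a \<ge> 1" "a \<ge> A / B" using K by (auto simp: a_def)
  have \<delta>len: "2 * \<tau> \<le> \<delta> * len e" "\<delta> * len e \<le> \<eta> / 2" if "e \<in> E" for e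
    using lens[OF that] \<delta> mult_left_mono[of \<mu> "len e" \<delta>] mult_left_mono[of "len e" L \<delta>] by (auto simp: \<tau>_def)
  have \<theta>eq: "\<theta> e k = d e + (k - K) * len e" for e k by (simp add: \<theta>_def d_def algebra_simps)
  have \<alpha>bound: "\<bar>\<alpha> v / k\<bar> \<le> B" if v: "v \<in> verts G" and k: "k \<in> {a..b}" for v k
  proof -
    have "\<bar>\<alpha> v\<bar> \<le> A" unfolding A_def using v by (intro member_le_sum) auto
    also have "A \<le> k * B"
    proof -
      have "A / B \<le> k" using a(3) k by simp
      then show ?thesis using B(1) by (simp add: pos_divide_le_eq)
    qed
    finally show ?thesis using a(2) k by (simp add: abs_divide pos_divide_le_eq mult.commute)
  qed
  have "\<exists>k\<in>{a..b}.
    (\<exists>u q. discrete_solution G (\<lambda>e. \<theta> e k) (verts G) (arcs G) (\<lambda>v. \<alpha> v / k) u q \<and> (\<forall>v\<in>verts G. u v \<noteq> 0)) \<and>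
    (\<forall>u q. discrete_solution G (\<lambda>e. \<theta> e k) (verts G) (arcs G) (\<lambda>v. \<alpha> v / k) u q \<longrightarrow> u r = 0 \<longrightarrow>
       (\<forall>v\<in>verts G. u v = 0) \<and> (\<forall>e\<in>arcs G. q e (tail G e) = 0))"
  proof (rule grown_tree_solution[where h = \<eta> and B = B and \<tau> = \<tau> and \<theta> = \<theta> and \<beta> = "\<lambda>v k. \<alpha> v / k"])
    show "a \<le> b" using \<delta> by (simp add: a_def b_def)
    show "(B + \<eta>) * 3 ^ card (verts G) \<le> 1"
    proof -
      have "(B + \<eta>) * 3 ^ card (verts G) \<le> (\<eta> + \<eta>) * 3 ^ card (verts G)"
        using B by (intro mult_right_mono) auto
      also have "\<dots> = 1" by (simp add: \<eta>_def)
      finally show ?thesis .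
    qed
    show "continuous_on {a..b} (\<theta> e)" for e unfolding \<theta>_def by (intro continuous_intros)
    show "\<bar>\<theta> e k\<bar> \<le> \<eta>" if e: "e \<in> arcs G" and k: "k \<in> {a..b}" for e k
    proof -
      have eE: "e \<in> E" using e by (simp add: E_def)
      have "\<bar>(k - K) * len e\<bar> = \<bar>k - K\<bar> * len e" using len_pos[OF e] by (simp add: abs_mult)
      also have "\<dots> \<le> \<delta> * len e" using k len_pos[OF e] by (intro mult_right_mono) (auto simp: a_def b_def)
      finally show ?thesis using \<delta>len[OF eE] d[OF eE] \<epsilon> unfolding \<theta>eq by linarith
    qed
    show "\<theta> e a \<le> -\<tau>" if "e \<in> arcs G" for e
    proof -
      have eE: "e \<in> E" using that by (simp add: E_def)
      have "\<theta> e a = d e - \<delta> * len e" unfolding \<theta>eq by (simp add: a_def)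
      then show ?thesis using \<delta>len[OF eE] d[OF eE] \<epsilon> by linarith
    qed
    show "\<tau> \<le> \<theta> e b" if "e \<in> arcs G" for e
    proof -
      have eE: "e \<in> E" using that by (simp add: E_def)
      have "\<theta> e b = d e + \<delta> * len e" unfolding \<theta>eq by (simp add: b_def)
      then show ?thesis using \<delta>len[OF eE] d[OF eE] \<epsilon> by linarith
    qed
    show "continuous_on {a..b} (\<lambda>k. \<alpha> v / k)" for v using a by (intro continuous_intros) auto
    have ab: "a \<in> {a..b}" "b \<in> {a..b}" using \<delta> by (auto simp: a_def b_def)
    show "\<alpha> v / a \<le> \<tau> / 2" if "v \<in> verts G" for v
      using \<alpha>bound[OF that ab(1)] B(3) by linarith
    show "- \<tau> / 2 \<le> \<alpha> v / b" if "v \<in> verts G" for v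
      using \<alpha>bound[OF that ab(2)] B(3) by linarith
    show "arcs G = {} \<Longrightarrow> \<alpha> r / a \<le> 0 \<and> 0 \<le> \<alpha> r / b" using arcs_nonempty by simp
  qed (use tree \<tau> \<eta> B \<alpha>bound in \<open>simp_all only: less_imp_le\<close>)
  then obtain k where k: "k \<in> {a..b}" and sol:
    "(\<exists>u q. discrete_solution G (\<lambda>e. \<theta> e k) (verts G) (arcs G) (\<lambda>v. \<alpha> v / k) u q \<and> (\<forall>v\<in>verts G. u v \<noteq> 0)) \<and>
    (\<forall>u q. discrete_solution G (\<lambda>e. \<theta> e k) (verts G) (arcs G) (\<lambda>v. \<alpha> v / k) u q \<longrightarrow> u r = 0 \<longrightarrow>
       (\<forall>v\<in>verts G. u v = 0) \<and> (\<forall>e\<in>arcs G. q e (tail G e) = 0))" by (elim bexE) (rule that)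
  have "discrete_solution G (\<lambda>e. \<theta> e k) (verts G) (arcs G) (\<lambda>v. \<alpha> v / k) =
      discrete_solution G (\<lambda>e. k * len e) (verts G) (arcs G) (\<lambda>v. \<alpha> v / k)"
    by (intro ext) (simp add: discrete_solution_def arc_relation_def \<theta>_def cos_sin_minus_2pi_int)
  moreover have "k > R" "k > 0" using k a by auto
  ultimately show ?thesis using sol by (intro exI[of _ k]) simp
qed

section \<open>Eigenfunctions of the graph\<close>

lemma trig_boundary_data:
  assumes l: "0 < len e" and f: "\<And>x. x \<in> {0..len e} \<Longrightarrow> f e x = trig_fun k A B x"
    and ends: "tail G e \<noteq> head G e"
  shows "trace_at G len f e (tail G e) = A"
    and "outward_derivative G len f e (tail G e) = - of_real k * B"
    and "trace_at G len f e (head G e) = of_real (cos (k * len e)) * A + of_real (sin (k * len e)) * B"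
    and "outward_derivative G len f e (head G e) =
      of_real k * (of_real (cos (k * len e)) * B - of_real (sin (k * len e)) * A)"
proof -
  have "vector_derivative (f e) (at x within {0..len e}) = trig_fun k (of_real k * B) (- of_real k * A) x"
    if x: "x \<in> {0..len e}" for x
  proof -
    have "(f e has_vector_derivative trig_fun k (of_real k * B) (- of_real k * A) x) (at x within {0..len e})"
      using has_vector_derivative_at_within[OF trig_fun_has_vector_derivative]
      by (rule has_vector_derivative_transform[OF x, rotated]) (rule f)
    then show ?thesis using vector_derivative_within_cbox[of 0 "len e" x] l x by (simp add: box_real)
  qed
  from this[of 0] this[of "len e"] f[of 0] f[of "len e"] l ends
  show "trace_at G len f e (tail G e) = A"
    and "outward_derivative G len f e (tail G e) = - of_real k * B"
    and "trace_at G len f e (head G e) = of_real (cos (k * len e)) * A + of_real (sin (k * len e)) * B"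
    and "outward_derivative G len f e (head G e) =
      of_real k * (of_real (cos (k * len e)) * B - of_real (sin (k * len e)) * A)"
    by (simp_all add: trace_at_def outward_derivative_def trig_fun_def algebra_simps)
qed

text \<open>At the tail the outward derivative is minus the derivative in the arc coordinate, hence
  the sign of \<open>q\<close>. The head data follow from \<open>arc_relation\<close>.\<close>

definition graph_function :: "('v, 'e) pre_digraph \<Rightarrow> real \<Rightarrow> ('v \<Rightarrow> complex) \<Rightarrow> ('e \<Rightarrow> 'v \<Rightarrow> complex) \<Rightarrow>
    'e \<Rightarrow> real \<Rightarrow> complex" where
  "graph_function G k u q e = trig_fun k (u (tail G e)) (- q e (tail G e))"

context
  fixes G :: "('v, 'e) pre_digraph" and len :: "'e \<Rightarrow> real" and k :: real
  assumes cmg: "compact_metric_graph G len" and k: "0 < k"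
begin

interpretation compact_metric_graph G len by (fact cmg)

lemma graph_function_boundary_data:
  assumes rel: "\<forall>e\<in>arcs G. arc_relation (k * len e) (u (tail G e)) (q e (tail G e)) (u (head G e)) (q e (head G e))"
    and e: "e \<in> incident_arcs G v"
  shows "trace_at G len (graph_function G k u q) e v = u v"
    and "outward_derivative G len (graph_function G k u q) e v = of_real k * q e v"
proof -
  have ea: "e \<in> arcs G" and v: "v = tail G e \<or> v = head G e" using e by (auto simp: incident_arcs_iff)
  note bd = trig_boundary_data[of len e "graph_function G k u q" k "u (tail G e)" "- q e (tail G e)" G, OF len_pos[OF ea]]
  have ne: "tail G e \<noteq> head G e" using no_loops[OF ea] .
  have gf: "graph_function G k u q e x = trig_fun k (u (tail G e)) (- q e (tail G e)) x" for x
    by (simp add: graph_function_def)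
  have r: "u (head G e) = of_real (cos (k * len e)) * u (tail G e) - of_real (sin (k * len e)) * q e (tail G e)"
    "q e (head G e) = - of_real (sin (k * len e)) * u (tail G e) - of_real (cos (k * len e)) * q e (tail G e)"
    using rel ea unfolding arc_relation_def by blast+
  show "trace_at G len (graph_function G k u q) e v = u v"
    using v bd(1,3)[OF gf ne] r(1) by auto
  show "outward_derivative G len (graph_function G k u q) e v = of_real k * q e v"
    using v
  proof
    assume "v = tail G e"
    then show ?thesis using bd(2)[OF gf ne] by simp
  next
    assume "v = head G e"
    then show ?thesis by (simp only: bd(4)[OF gf ne] r(2)) (simp add: algebra_simps)
  qed
qed

lemma graph_function_in_eigenspace:
  assumes rel: "\<forall>e\<in>arcs G. arc_relation (k * len e) (u (tail G e)) (q e (tail G e)) (u (head G e)) (q e (head G e))"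
    and dir: "\<forall>v\<in>VD. u v = 0"
    and vert: "\<forall>v\<in>verts G - VD. (\<Sum>e\<in>incident_arcs G v. q e v) = of_real (\<alpha> v / k) * u v"
  shows "graph_function G k u q \<in> eigenspace G len VD \<alpha> (complex_of_real (k\<^sup>2))"
proof -
  note bd = graph_function_boundary_data[OF rel]
  have weak: "weak_derivative (len e) (graph_function G k u q e)
        (trig_fun k (of_real k * - q e (tail G e)) (- of_real k * u (tail G e)))"
      "weak_derivative (len e) (trig_fun k (of_real k * - q e (tail G e)) (- of_real k * u (tail G e)))
        (\<lambda>x. - (complex_of_real (k\<^sup>2) * graph_function G k u q e x))" if "e \<in> arcs G" for e
    unfolding graph_function_def trig_fun_second_derivative[symmetric]
    using len_pos[OF that] by (intro trig_fun_weak_derivative; simp)+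
  have H2: "sobolev_H2 (len e) (graph_function G k u q e)" if "e \<in> arcs G" for e
    unfolding sobolev_H2_def using weak[OF that] by blast
  have cont: "continuous_on {0..len e} (graph_function G k u q e)" for e
    unfolding graph_function_def by (rule continuous_on_trig_fun)
  have "vanishes_at G len (graph_function G k u q) v" if "v \<in> VD" for v
    unfolding vanishes_at_def using bd(1) dir that by simp
  moreover have "delta_condition G len (\<alpha> v) (graph_function G k u q) v" if "v \<in> verts G - VD" for v
  proof -
    have "(\<Sum>e\<in>incident_arcs G v. outward_derivative G len (graph_function G k u q) e v) =
        of_real k * (\<Sum>e\<in>incident_arcs G v. q e v)"
      unfolding sum_distrib_left by (intro sum.cong refl bd(2))
    also have "\<dots> = of_real k * (of_real (\<alpha> v / k) * u v)" using vert that by simp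
    also have "\<dots> = of_real (\<alpha> v) * u v" using k by (simp add: of_real_divide)
    finally have s: "(\<Sum>e\<in>incident_arcs G v. outward_derivative G len (graph_function G k u q) e v) =
        of_real (\<alpha> v) * u v" .
    show ?thesis unfolding delta_condition_def by (rule exI[of _ "u v"]) (simp add: s bd(1))
  qed
  ultimately have dom: "graph_function G k u q \<in> laplacian_domain G len VD \<alpha>"
    unfolding laplacian_domain_def using H2 cont by simp
  show ?thesis
    unfolding eigenspace_def neg_laplacian_def mem_Collect_eq
  proof (intro conjI ballI)
    show "graph_function G k u q \<in> laplacian_domain G len VD \<alpha>" by (rule dom)
    fix e assume "e \<in> arcs G"
    from weak[OF this] show "\<exists>f'. weak_derivative (len e) (graph_function G k u q e) f' \<and>
        weak_derivative (len e) f' (\<lambda>x. - (complex_of_real (k\<^sup>2) * graph_function G k u q e x))"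
      by (intro exI conjI)
  qed
qed

lemma graph_function_eigenfunction:
  assumes rel: "\<forall>e\<in>arcs G. arc_relation (k * len e) (u (tail G e)) (q e (tail G e)) (u (head G e)) (q e (head G e))"
    and dir: "\<forall>v\<in>VD. u v = 0"
    and vert: "\<forall>v\<in>verts G - VD. (\<Sum>e\<in>incident_arcs G v. q e v) = of_real (\<alpha> v / k) * u v"
    and fs: "full_support G len (graph_function G k u q)"
  shows "eigenfunction G len VD \<alpha> (complex_of_real (k\<^sup>2)) (graph_function G k u q)"
proof -
  obtain e where e: "e \<in> arcs G" using arcs_nonempty by auto
  have "\<exists>x\<in>{0..len e}. graph_function G k u q e x \<noteq> 0"
    using fs e unfolding full_support_def by (rule bspec)
  then have "\<exists>e\<in>arcs G. \<exists>x\<in>{0..len e}. graph_function G k u q e x \<noteq> 0" using e by (rule bexI)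
  then show ?thesis
    unfolding eigenfunction_def using graph_function_in_eigenspace[OF rel dir vert] by simp
qed

lemma graph_function_full_support:
  assumes rel: "\<forall>e\<in>arcs G. arc_relation (k * len e) (u (tail G e)) (q e (tail G e)) (u (head G e)) (q e (head G e))"
    and nz: "\<And>e. e \<in> arcs G \<Longrightarrow> u (tail G e) \<noteq> 0 \<or> u (head G e) \<noteq> 0"
  shows "full_support G len (graph_function G k u q)"
  unfolding full_support_def
proof
  fix e assume e: "e \<in> arcs G"
  then have inc: "e \<in> incident_arcs G (tail G e)" "e \<in> incident_arcs G (head G e)"
    by (simp_all add: incident_arcs_iff)
  have "graph_function G k u q e 0 = u (tail G e)" "graph_function G k u q e (len e) = u (head G e)"
    using graph_function_boundary_data(1)[OF rel inc(1)] graph_function_boundary_data(1)[OF rel inc(2)]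
      no_loops[OF e] by (simp_all add: trace_at_def split: if_splits)
  moreover have "0 \<in> {0..len e}" "len e \<in> {0..len e}" using len_pos[OF e] by auto
  ultimately show "\<exists>x\<in>{0..len e}. graph_function G k u q e x \<noteq> 0" using nz[OF e] by metis
qed

text \<open>The converse of the construction, required for multiplicity one: \<open>u\<close> is the
  common trace supplied by the coupling condition, \<open>q\<close> the outward derivative over
  \<open>k\<close>, and regularity on each arc gives \<open>arc_relation\<close>.\<close>

lemma eigenspace_graph_function:
  assumes g: "g \<in> eigenspace G len {} \<alpha> (complex_of_real (k\<^sup>2))"
  shows "\<exists>u q. discrete_solution G (\<lambda>e. k * len e) (verts G) (arcs G) (\<lambda>v. \<alpha> v / k) u q \<and>
    (\<forall>e\<in>arcs G. \<forall>x\<in>{0..len e}. g e x = graph_function G k u q e x)"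
proof -
  have dom: "g \<in> laplacian_domain G len {} \<alpha>"
    and weak: "\<And>e. e \<in> arcs G \<Longrightarrow> \<exists>f'. weak_derivative (len e) (g e) f' \<and>
      weak_derivative (len e) f' (\<lambda>x. - (complex_of_real (k\<^sup>2) * g e x))"
    using g unfolding eigenspace_def neg_laplacian_def mem_Collect_eq by blast+
  have cont: "continuous_on {0..len e} (g e)" if "e \<in> arcs G" for e
    using dom that unfolding laplacian_domain_def by blast
  have "\<exists>AB. \<forall>x\<in>{0..len e}. g e x = trig_fun k (fst AB) (snd AB) x" if e: "e \<in> arcs G" for e
  proof -
    obtain f' where "weak_derivative (len e) (g e) f'"
      "weak_derivative (len e) f' (\<lambda>x. - (complex_of_real (k\<^sup>2) * g e x))" using weak[OF e] by blast
    from weak_solution_trig[OF k len_pos[OF e] cont[OF e] this]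
    obtain A B where "\<forall>x\<in>{0..len e}. g e x = trig_fun k A B x" by blast
    then show ?thesis by (intro exI[of _ "(A, B)"]) simp
  qed
  then have "\<forall>e\<in>arcs G. \<exists>AB. \<forall>x\<in>{0..len e}. g e x = trig_fun k (fst AB) (snd AB) x" by (rule ballI)
  from bchoice[OF this] obtain AB where AB: "\<forall>e\<in>arcs G. \<forall>x\<in>{0..len e}. g e x = trig_fun k (fst (AB e)) (snd (AB e)) x"
    by (elim exE) (rule that)
  have "\<forall>v\<in>verts G. \<exists>c. (\<forall>e\<in>incident_arcs G v. trace_at G len g e v = c) \<and>
      (\<Sum>e\<in>incident_arcs G v. outward_derivative G len g e v) = of_real (\<alpha> v) * c"
    using dom unfolding laplacian_domain_def delta_condition_def by simp
  from bchoice[OF this] obtain u where u: "\<And>v e. v \<in> verts G \<Longrightarrow> e \<in> incident_arcs G v \<Longrightarrow> trace_at G len g e v = u v"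
    "\<And>v. v \<in> verts G \<Longrightarrow> (\<Sum>e\<in>incident_arcs G v. outward_derivative G len g e v) = of_real (\<alpha> v) * u v"
    by (elim exE) blast
  define q where "q e v = outward_derivative G len g e v / of_real k" for e v
  have arc: "arc_relation (k * len e) (u (tail G e)) (q e (tail G e)) (u (head G e)) (q e (head G e)) \<and>
      u (tail G e) = fst (AB e) \<and> q e (tail G e) = - snd (AB e)" if e: "e \<in> arcs G" for e
  proof -
    have inc: "e \<in> incident_arcs G (tail G e)" "e \<in> incident_arcs G (head G e)"
      using e by (simp_all add: incident_arcs_iff)
    have ge: "g e x = trig_fun k (fst (AB e)) (snd (AB e)) x" if "x \<in> {0..len e}" for x
      using AB e that by blast
    note bd = trig_boundary_data[of len e g k "fst (AB e)" "snd (AB e)" G, OF len_pos[OF e] ge no_loops[OF e]]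
    have k0: "complex_of_real k \<noteq> 0" using k by simp
    have ut: "u (tail G e) = fst (AB e)" using bd(1) u(1)[OF tail_in_verts[OF e] inc(1)] by simp
    have uh: "u (head G e) = of_real (cos (k * len e)) * fst (AB e) + of_real (sin (k * len e)) * snd (AB e)"
      using bd(3) u(1)[OF head_in_verts[OF e] inc(2)] by simp
    have qt: "q e (tail G e) = - snd (AB e)" using bd(2) k0 by (simp add: q_def)
    have qh: "q e (head G e) = of_real (cos (k * len e)) * snd (AB e) - of_real (sin (k * len e)) * fst (AB e)"
      using bd(4) k0 by (simp add: q_def)
    show ?thesis unfolding arc_relation_def ut uh qt qh by simp
  qed
  have vsum: "(\<Sum>e\<in>arcs G \<inter> incident_arcs G v. q e v) = of_real (\<alpha> v / k) * u v" if v: "v \<in> verts G" for v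
  proof -
    have "arcs G \<inter> incident_arcs G v = incident_arcs G v" by (auto simp: incident_arcs_iff)
    then have "(\<Sum>e\<in>arcs G \<inter> incident_arcs G v. q e v) =
        (\<Sum>e\<in>incident_arcs G v. outward_derivative G len g e v) / of_real k"
      by (simp add: q_def sum_divide_distrib)
    then show ?thesis using u(2)[OF v] by (simp add: of_real_divide)
  qed
  have "discrete_solution G (\<lambda>e. k * len e) (verts G) (arcs G) (\<lambda>v. \<alpha> v / k) u q"
    unfolding discrete_solution_def by (intro conjI ballI vsum conjunct1[OF arc])
  moreover have "g e x = graph_function G k u q e x" if "e \<in> arcs G" "x \<in> {0..len e}" for e x
    using AB arc[OF that(1)] that by (simp add: graph_function_def)
  ultimately show ?thesis by (intro exI[of _ u] exI[of _ q]) simp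
qed

lemma discrete_solution_graph_function:
  assumes sol: "discrete_solution G (\<lambda>e. k * len e) (verts G) (arcs G) (\<lambda>v. \<alpha> v / k) u q"
  shows "\<forall>e\<in>arcs G. arc_relation (k * len e) (u (tail G e)) (q e (tail G e)) (u (head G e)) (q e (head G e))"
    and "\<forall>v\<in>verts G - {}. (\<Sum>e\<in>incident_arcs G v. q e v) = of_real (\<alpha> v / k) * u v"
proof -
  have "arcs G \<inter> incident_arcs G v = incident_arcs G v" for v by (auto simp: incident_arcs_iff)
  then show "\<forall>v\<in>verts G - {}. (\<Sum>e\<in>incident_arcs G v. q e v) = of_real (\<alpha> v / k) * u v"
    using sol unfolding discrete_solution_def by simp
  show "\<forall>e\<in>arcs G. arc_relation (k * len e) (u (tail G e)) (q e (tail G e)) (u (head G e)) (q e (head G e))"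
    using sol unfolding discrete_solution_def by simp
qed

end

section \<open>Simple eigenvalues of trees\<close>

lemma discrete_solution_diff_scale:
  assumes "discrete_solution G \<theta> W F \<beta> u q" "discrete_solution G \<theta> W F \<beta> u' q'"
  shows "discrete_solution G \<theta> W F \<beta> (\<lambda>v. u' v - c * u v) (\<lambda>e v. q' e v - c * q e v)"
proof -
  have "arc_relation t (x' - c * x) (y' - c * y) (z' - c * z) (w' - c * w)"
    if "arc_relation t x y z w" "arc_relation t x' y' z' w'" for t x y z w x' y' z' w'
    using that unfolding arc_relation_def by (elim conjE, simp only:) (simp add: algebra_simps)
  note lin = this
  show ?thesis unfolding discrete_solution_def
  proof (intro conjI ballI)
    show "arc_relation (\<theta> e) (u' (tail G e) - c * u (tail G e)) (q' e (tail G e) - c * q e (tail G e))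
        (u' (head G e) - c * u (head G e)) (q' e (head G e) - c * q e (head G e))" if "e \<in> F" for e
      by (rule lin) (use assms that in \<open>simp_all add: discrete_solution_def\<close>)
    fix v assume v: "v \<in> W"
    have "(\<Sum>e\<in>F \<inter> incident_arcs G v. q' e v - c * q e v) =
        (\<Sum>e\<in>F \<inter> incident_arcs G v. q' e v) - c * (\<Sum>e\<in>F \<inter> incident_arcs G v. q e v)"
      by (simp only: sum_subtractf sum_distrib_left)
    also have "\<dots> = of_real (\<beta> v) * u' v - c * (of_real (\<beta> v) * u v)"
      using assms v by (simp add: discrete_solution_def)
    finally show "(\<Sum>e\<in>F \<inter> incident_arcs G v. q' e v - c * q e v) = of_real (\<beta> v) * (u' v - c * u v)"
      by (simp add: right_diff_distrib mult.left_commute)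
  qed
qed

lemma less_square:
  fixes k :: real
  assumes "k > max R 1"
  shows "k\<^sup>2 > R"
proof -
  have "k * 1 \<le> k * k" using assms by (intro mult_left_mono) auto
  then have "k \<le> k\<^sup>2" by (simp only: power2_eq_square mult_1_right)
  then show ?thesis using assms by simp
qed

lemma tree_simple_eigenvalue:
  fixes G :: "('v, 'e) pre_digraph"
  assumes cmg: "compact_metric_graph G len" and tree: "undirected_tree G"
  shows "\<exists>x>R. \<exists>\<psi>. simple_eigenvalue G len {} \<alpha> (complex_of_real x) \<and>
     eigenfunction G len {} \<alpha> (complex_of_real x) \<psi> \<and> (\<forall>v\<in>verts G. \<not> vanishes_at G len \<psi> v)"
proof -
  interpret compact_metric_graph G len by fact
  have con: "Digraph_Component.connected G" using tree by (simp add: undirected_tree_def)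
  obtain e0 where "e0 \<in> arcs G" using arcs_nonempty by auto
  then have r: "tail G e0 \<in> verts G" by (rule tail_in_verts)
  define r where "r = tail G e0"
  have grown: "grown_tree G r (verts G) (arcs G)"
    using undirected_tree_grown[OF tree fin_digraph_axioms r] by (simp add: r_def)
  obtain k u q where k: "k > max R 1"
    and sol: "discrete_solution G (\<lambda>e. k * len e) (verts G) (arcs G) (\<lambda>v. \<alpha> v / k) u q" "\<forall>v\<in>verts G. u v \<noteq> 0"
    and uniq: "\<forall>u q. discrete_solution G (\<lambda>e. k * len e) (verts G) (arcs G) (\<lambda>v. \<alpha> v / k) u q \<longrightarrow> u r = 0 \<longrightarrow>
       (\<forall>v\<in>verts G. u v = 0) \<and> (\<forall>e\<in>arcs G. q e (tail G e) = 0)"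
    using tree_nonvanishing_solution[OF cmg grown, of "max R 1" \<alpha>] by (elim exE conjE) (rule that)
  have kp: "0 < k" using k by simp
  note sol' = discrete_solution_graph_function[OF cmg kp sol(1)]
  have rz: "u r \<noteq> 0" using sol(2) r by (simp add: r_def)
  define \<psi> where "\<psi> = graph_function G k u q"
  have fs: "full_support G len \<psi>" unfolding \<psi>_def
    by (rule graph_function_full_support[OF cmg kp sol'(1)]) (simp add: sol(2))
  have ef: "eigenfunction G len {} \<alpha> (complex_of_real (k\<^sup>2)) \<psi>" unfolding \<psi>_def
    by (rule graph_function_eigenfunction[OF cmg kp sol'(1) _ sol'(2)]) (simp_all add: fs[unfolded \<psi>_def])
  have nv: "\<not> vanishes_at G len \<psi> v" if v: "v \<in> verts G" for v
  proof -
    obtain e where e: "e \<in> incident_arcs G v"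
      using connected_incident_arc[OF con loopfree_digraph_axioms arcs_nonempty v] by metis
    then have "trace_at G len \<psi> e v = u v"
      unfolding \<psi>_def by (rule graph_function_boundary_data(1)[OF cmg kp sol'(1)])
    then show ?thesis using e sol(2) v unfolding vanishes_at_def by fastforce
  qed
  have "\<exists>c. \<forall>e\<in>arcs G. \<forall>x\<in>{0..len e}. g e x = c * \<psi> e x"
    if g: "g \<in> eigenspace G len {} \<alpha> (complex_of_real (k\<^sup>2))" for g
  proof -
    obtain u' q' where uq': "discrete_solution G (\<lambda>e. k * len e) (verts G) (arcs G) (\<lambda>v. \<alpha> v / k) u' q'"
      and gf: "\<forall>e\<in>arcs G. \<forall>x\<in>{0..len e}. g e x = graph_function G k u' q' e x"
      using eigenspace_graph_function[OF cmg kp g] by (elim exE conjE) (rule that)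
    \<comment> \<open>Scaling by the ratio of root values makes the difference vanish at the root,
      hence at all vertices and in all tail fluxes; tail data determine the function on an
      arc.\<close>
    define c where "c = u' r / u r"
    have diff: "discrete_solution G (\<lambda>e. k * len e) (verts G) (arcs G) (\<lambda>v. \<alpha> v / k)
        (\<lambda>v. u' v - c * u v) (\<lambda>e v. q' e v - c * q e v)"
      by (rule discrete_solution_diff_scale[OF sol(1) uq'])
    have root: "u' r - c * u r = 0" using rz by (simp add: c_def)
    have z: "(\<forall>v\<in>verts G. u' v - c * u v = 0) \<and> (\<forall>e\<in>arcs G. q' e (tail G e) - c * q e (tail G e) = 0)"
      by (rule mp[OF mp[OF spec[OF spec[OF uniq]] diff] root])
    have "g e x = c * \<psi> e x" if e: "e \<in> arcs G" and x: "x \<in> {0..len e}" for e x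
    proof -
      have "u' (tail G e) = c * u (tail G e)" "q' e (tail G e) = c * q e (tail G e)"
        using z tail_in_verts[OF e] e by simp_all
      moreover have "g e x = graph_function G k u' q' e x" using gf e x by blast
      ultimately show ?thesis
        by (simp add: \<psi>_def graph_function_def trig_fun_def algebra_simps)
    qed
    then show ?thesis by blast
  qed
  then have "simple_eigenvalue G len {} \<alpha> (complex_of_real (k\<^sup>2))"
    unfolding simple_eigenvalue_def using ef by (intro exI[of _ \<psi>]) simp
  moreover have "k\<^sup>2 > R"
    using k by (rule less_square)
  ultimately show ?thesis using ef nv by (intro exI[of _ "k\<^sup>2"] conjI exI[of _ \<psi>]) simp_all
qed

section \<open>Eigenvalues in the presence of Dirichlet vertices\<close>

lemma opposite_end_simps:
  "opposite_end G e (tail G e) = head G e"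
  "tail G e \<noteq> head G e \<Longrightarrow> opposite_end G e (head G e) = tail G e"
  by (simp_all add: opposite_end_def)

text \<open>The first equation is the definition of the flux at the tail. The second follows after
  multiplication by \<open>sin (\<theta> e)\<close> and the Pythagorean identity.\<close>

lemma arc_flux_arc_relation:
  assumes "tail G e \<noteq> head G e" "sin (\<theta> e) \<noteq> 0"
  shows "arc_relation (\<theta> e) (of_real (w (tail G e))) (of_real (arc_flux G \<theta> w e (tail G e)))
    (of_real (w (head G e))) (of_real (arc_flux G \<theta> w e (head G e)))"
proof -
  let ?c = "cos (\<theta> e)" and ?s = "sin (\<theta> e)" and ?x = "w (tail G e)" and ?y = "w (head G e)"
  have "?s * arc_flux G \<theta> w e (tail G e) = ?c * ?x - ?y"
    using assms by (simp add: arc_flux_def opposite_end_simps)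
  then have 1: "?y = ?c * ?x - ?s * arc_flux G \<theta> w e (tail G e)" by simp
  have "?s * (arc_flux G \<theta> w e (head G e)) = ?c * ?y - ?x"
    using assms by (simp add: arc_flux_def opposite_end_simps)
  also have "\<dots> = ?c * (?c * ?x - ?s * arc_flux G \<theta> w e (tail G e)) - (?s\<^sup>2 + ?c\<^sup>2) * ?x"
    unfolding 1[symmetric] by (simp only: sin_cos_squared_add mult_1)
  also have "\<dots> = ?s * (- ?s * ?x - ?c * arc_flux G \<theta> w e (tail G e))"
    by algebra
  finally have 2: "arc_flux G \<theta> w e (head G e) = - ?s * ?x - ?c * arc_flux G \<theta> w e (tail G e)"
    using assms(2) by (simp only: mult_cancel_left) simp
  show ?thesis unfolding arc_relation_def
  proof
    show "complex_of_real ?y = of_real ?c * of_real ?x - of_real ?s * of_real (arc_flux G \<theta> w e (tail G e))"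
      by (subst 1) simp
    show "complex_of_real (arc_flux G \<theta> w e (head G e)) =
        - of_real ?s * of_real ?x - of_real ?c * of_real (arc_flux G \<theta> w e (tail G e))"
      unfolding 2 by simp
  qed
qed

lemma dirichlet_eigenvalue:
  fixes G :: "('v, 'e) pre_digraph"
  assumes cmg: "compact_metric_graph G len" and con: "Digraph_Component.connected G"
    and VD: "VD \<subseteq> verts G" "VD \<noteq> {}" "\<And>v. v \<in> VD \<Longrightarrow> vertex_degree G v = 1"
      "\<And>e. e \<in> arcs G \<Longrightarrow> tail G e \<in> VD \<Longrightarrow> head G e \<notin> VD"
  shows "\<exists>x>R. \<exists>\<psi>. eigenfunction G len VD \<alpha> (complex_of_real x) \<psi> \<and> full_support G len \<psi>"
proof -
  interpret compact_metric_graph G len by fact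
  have "\<exists>k>max R 1. 0 < k \<and> (\<forall>e\<in>arcs G. sin (k * len e) > 0) \<and> (\<exists>w. (\<forall>v\<in>VD. w v = 0) \<and>
    (\<forall>v\<in>verts G - VD. w v > 0 \<and>
      (\<Sum>e\<in>incident_arcs G v. arc_flux G (\<lambda>e. k * len e) w e v) = \<alpha> v / k * w v))"
    by (rule dirichlet_positive_solution[OF cmg con VD])
  then obtain k w where k: "k > max R 1" "0 < k" and sin: "\<forall>e\<in>arcs G. sin (k * len e) > 0"
    and w: "\<forall>v\<in>VD. w v = 0" "\<forall>v\<in>verts G - VD. w v > 0 \<and>
      (\<Sum>e\<in>incident_arcs G v. arc_flux G (\<lambda>e. k * len e) w e v) = \<alpha> v / k * w v"
    by (elim exE conjE) (rule that)
  define u where "u v = complex_of_real (w v)" for v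
  define q where "q e v = complex_of_real (arc_flux G (\<lambda>e. k * len e) w e v)" for e v
  have rel: "\<forall>e\<in>arcs G. arc_relation (k * len e) (u (tail G e)) (q e (tail G e)) (u (head G e)) (q e (head G e))"
  proof
    fix e assume e: "e \<in> arcs G"
    have "sin (k * len e) \<noteq> 0" using sin e by force
    then show "arc_relation (k * len e) (u (tail G e)) (q e (tail G e)) (u (head G e)) (q e (head G e))"
      unfolding u_def q_def by (rule arc_flux_arc_relation[OF no_loops[OF e]])
  qed
  have dir: "\<forall>v\<in>VD. u v = 0" using w(1) by (simp add: u_def)
  have vert: "\<forall>v\<in>verts G - VD. (\<Sum>e\<in>incident_arcs G v. q e v) = of_real (\<alpha> v / k) * u v"
  proof
    fix v assume v: "v \<in> verts G - VD"
    have "(\<Sum>e\<in>incident_arcs G v. q e v) = of_real (\<Sum>e\<in>incident_arcs G v. arc_flux G (\<lambda>e. k * len e) w e v)"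
      unfolding q_def by simp
    also have "\<dots> = of_real (\<alpha> v / k * w v)" using w(2) v by simp
    also have "\<dots> = of_real (\<alpha> v / k) * u v" by (simp add: u_def)
    finally show "(\<Sum>e\<in>incident_arcs G v. q e v) = of_real (\<alpha> v / k) * u v" .
  qed
  have fs: "full_support G len (graph_function G k u q)"
  proof (rule graph_function_full_support[OF cmg k(2) rel])
    fix e assume e: "e \<in> arcs G"
    have "u v \<noteq> 0" if "v \<in> verts G - VD" for v
    proof -
      have "w v > 0" using w(2) that by blast
      then show ?thesis by (simp add: u_def)
    qed
    \<comment> \<open>Every arc has a non-Dirichlet end, where the value is positive; this is what
      gives full support.\<close>
    moreover have "tail G e \<notin> VD \<or> head G e \<notin> VD" using VD(4)[OF e] by blast
    ultimately show "u (tail G e) \<noteq> 0 \<or> u (head G e) \<noteq> 0"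
      using tail_in_verts[OF e] head_in_verts[OF e] by blast
  qed
  have "k\<^sup>2 > R"
    using k(1) by (rule less_square)
  then show ?thesis
    using graph_function_eigenfunction[OF cmg k(2) rel dir vert fs] fs by blast
qed

text \<open>Both ends of such an arc have degree one, so by connectedness it is the whole graph. No
  vertex carries a coupling, and sines with \<open>k * len a\<close> a multiple of \<open>pi\<close>
  are eigenfunctions.\<close>

lemma dirichlet_interval_eigenvalue:
  fixes G :: "('v, 'e) pre_digraph"
  assumes cmg: "compact_metric_graph G len" and con: "Digraph_Component.connected G"
    and VD: "VD \<subseteq> verts G" "\<And>v. v \<in> VD \<Longrightarrow> vertex_degree G v = 1"
    and a: "a \<in> arcs G" "tail G a \<in> VD" "head G a \<in> VD"
  shows "\<exists>x>R. \<exists>\<psi>. eigenfunction G len VD \<alpha> (complex_of_real x) \<psi> \<and> full_support G len \<psi>"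
proof -
  interpret compact_metric_graph G len by fact
  have only: "e = a" if e: "e \<in> incident_arcs G v" and v: "v \<in> {tail G a, head G a}" for e v
  proof -
    have "vertex_degree G v = 1" using v a VD(2) by auto
    then obtain b where "incident_arcs G v = {b}" by (metis vertex_degree_def card_1_singletonE)
    moreover have "a \<in> incident_arcs G v" using a(1) v by (auto simp: incident_arcs_iff)
    ultimately show ?thesis using e by auto
  qed
  have two: "verts G \<subseteq> {tail G a, head G a}"
  proof (rule connected_closed_verts[OF con, of "tail G a"])
    fix e assume e: "e \<in> arcs G"
    have "e = a" if "tail G e \<in> {tail G a, head G a} \<or> head G e \<in> {tail G a, head G a}"
      using that only[of e "tail G e"] only[of e "head G e"] e by (auto simp: incident_arcs_iff)
    then show "tail G e \<in> {tail G a, head G a} \<longleftrightarrow> head G e \<in> {tail G a, head G a}" by blast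
  qed (use a in auto)
  then have VDall: "verts G - VD = {}" using a by auto
  have onlya: "e = a" if e: "e \<in> arcs G" for e
  proof (rule only)
    show "tail G e \<in> {tail G a, head G a}" using tail_in_verts[OF e] two by blast
  qed (simp add: incident_arcs_iff e)
  have arcs: "arcs G = {a}" using onlya a(1) by blast
  define l where "l = len a"
  have l: "l > 0" using len_pos a(1) by (simp add: l_def)
  obtain n :: nat where n: "max R 1 * l / pi < real n" using reals_Archimedean2 by blast
  define k where "k = real n * pi / l"
  have "max R 1 * l < real n * pi" using n by (simp only: pos_divide_less_eq[OF pi_gt_zero])
  then have k: "k > max R 1" unfolding k_def by (simp only: pos_less_divide_eq[OF l])
  then have kp: "k > 0" by simp
  have kl: "k * l = real n * pi" using l by (simp add: k_def)
  define u where "u = (\<lambda>_ :: 'v. 0 :: complex)"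
  \<comment> \<open>Normalised outward derivative 1 at the tail, that is, the arc function
    \<open>- sin (k * x)\<close>; the value at the head is dictated by
    \<open>arc_relation\<close>.\<close>
  define q where "q = (\<lambda>(_ :: 'e) v. if v = tail G a then 1 else - complex_of_real (cos (k * l)))"
  have rel: "\<forall>e\<in>arcs G. arc_relation (k * len e) (u (tail G e)) (q e (tail G e)) (u (head G e)) (q e (head G e))"
    using no_loops[OF a(1)] unfolding arcs arc_relation_def u_def q_def
    by (simp add: l_def[symmetric] kl sin_npi)
  have dir: "\<forall>v\<in>VD. u v = 0" by (simp add: u_def)
  have vert: "\<forall>v\<in>verts G - VD. (\<Sum>e\<in>incident_arcs G v. q e v) = of_real (\<alpha> v / k) * u v"
    by (simp add: VDall)
  have fs: "full_support G len (graph_function G k u q)"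
    unfolding full_support_def arcs
  proof
    fix e assume "e \<in> {a}"
    then have e: "e = a" by simp
    define x where "x = min l (1 / k)"
    have x: "0 < x" "x \<le> l" "k * x \<le> 1" using l kp by (auto simp: x_def min_def field_simps)
    have "sin (k * x) > 0" using x kp pi_gt3 by (intro sin_gt_zero) auto
    then have "graph_function G k u q a x \<noteq> 0"
      by (simp add: graph_function_def trig_fun_def u_def q_def)
    then show "\<exists>x\<in>{0..len e}. graph_function G k u q e x \<noteq> 0"
      using x unfolding e l_def[symmetric] by (intro bexI[of _ x]) auto
  qed
  have "k\<^sup>2 > R"
    using k by (rule less_square)
  then show ?thesis
    using graph_function_eigenfunction[OF cmg kp rel dir vert fs] fs by blast
qed

text \<open>Eigenvalues above every bound suffice: dependent choice takes each one above its
  predecessor, and the functions are chosen afterwards.\<close>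

lemma strict_mono_choice:
  fixes P :: "real \<Rightarrow> 'a \<Rightarrow> bool"
  assumes "\<And>R. \<exists>x>R. \<exists>y. P x y"
  shows "\<exists>(lam :: nat \<Rightarrow> real) y. strict_mono lam \<and> (\<forall>n. P (lam n) (y n))"
proof -
  have "\<exists>lam :: nat \<Rightarrow> real. \<forall>n. (\<exists>y. P (lam n) y) \<and> lam n < lam (Suc n)"
  proof (rule dependent_nat_choice)
    show "\<exists>x. \<exists>y. P x y" using assms[of 0] by (elim exE conjE) (intro exI)
    show "\<exists>x'. (\<exists>y. P x' y) \<and> x < x'" for x :: real
      using assms[of x] by (elim exE conjE) (intro exI conjI)
  qed
  then obtain lam :: "nat \<Rightarrow> real" where lam: "\<forall>n. (\<exists>y. P (lam n) y) \<and> lam n < lam (Suc n)" ..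
  then have "\<forall>n. \<exists>y. P (lam n) y" by simp
  from choice[OF this] obtain y where "\<forall>n. P (lam n) (y n)" ..
  moreover have "strict_mono lam" using lam by (simp add: strict_mono_Suc_iff)
  ultimately show ?thesis by (intro exI[of _ lam] exI[of _ y]) simp
qed

theorem theorem3:
  fixes G :: "('v, 'e) pre_digraph"
    and len :: "'e \<Rightarrow> real"
    and VD :: "'v set"
    and \<alpha> :: "'v \<Rightarrow> real"
  assumes "compact_metric_graph G len"
    and "Digraph_Component.connected G"
    and "VD \<subseteq> verts G"
    and "\<And>v. v \<in> VD \<Longrightarrow> vertex_degree G v = 1"
  shows "(undirected_tree G \<and> VD = {} \<longrightarrow>
           (\<exists>(lam :: nat \<Rightarrow> real) (\<psi> :: nat \<Rightarrow> 'e \<Rightarrow> real \<Rightarrow> complex).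
              strict_mono lam \<and>
              (\<forall>k. simple_eigenvalue G len VD \<alpha> (complex_of_real (lam k)) \<and>
                   eigenfunction G len VD \<alpha> (complex_of_real (lam k)) (\<psi> k) \<and>
                   (\<forall>v \<in> verts G. \<not> vanishes_at G len (\<psi> k) v)))) \<and>
         (VD \<noteq> {} \<longrightarrow>
           (\<exists>(lam :: nat \<Rightarrow> real) (\<psi> :: nat \<Rightarrow> 'e \<Rightarrow> real \<Rightarrow> complex).
              strict_mono lam \<and>
              (\<forall>k. eigenfunction G len VD \<alpha> (complex_of_real (lam k)) (\<psi> k) \<and>
                   full_support G len (\<psi> k))))"
proof (intro conjI impI)
  assume *: "undirected_tree G \<and> VD = {}"
  show "\<exists>(lam :: nat \<Rightarrow> real) (\<psi> :: nat \<Rightarrow> 'e \<Rightarrow> real \<Rightarrow> complex). strict_mono lam \<and>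
      (\<forall>k. simple_eigenvalue G len VD \<alpha> (complex_of_real (lam k)) \<and>
           eigenfunction G len VD \<alpha> (complex_of_real (lam k)) (\<psi> k) \<and>
           (\<forall>v \<in> verts G. \<not> vanishes_at G len (\<psi> k) v))"
    unfolding conjunct2[OF *]
    by (rule strict_mono_choice[where P = "\<lambda>x \<psi>. simple_eigenvalue G len {} \<alpha> (complex_of_real x) \<and>
          eigenfunction G len {} \<alpha> (complex_of_real x) \<psi> \<and> (\<forall>v \<in> verts G. \<not> vanishes_at G len \<psi> v)"])
      (rule tree_simple_eigenvalue[OF assms(1) conjunct1[OF *]])
next
  assume ne: "VD \<noteq> {}"
  have "\<exists>x>R. \<exists>\<psi>. eigenfunction G len VD \<alpha> (complex_of_real x) \<psi> \<and> full_support G len \<psi>" for R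
  proof (cases "\<exists>e\<in>arcs G. tail G e \<in> VD \<and> head G e \<in> VD")
    case True
    then obtain e where e: "e \<in> arcs G" "tail G e \<in> VD" "head G e \<in> VD" by auto
    show ?thesis by (rule dirichlet_interval_eigenvalue[OF assms e])
  next
    case False
    then have no: "head G e \<notin> VD" if "e \<in> arcs G" "tail G e \<in> VD" for e using that by auto
    show ?thesis by (rule dirichlet_eigenvalue[OF assms(1-3) ne assms(4) no])
  qed
  then show "\<exists>(lam :: nat \<Rightarrow> real) (\<psi> :: nat \<Rightarrow> 'e \<Rightarrow> real \<Rightarrow> complex). strict_mono lam \<and>
      (\<forall>k. eigenfunction G len VD \<alpha> (complex_of_real (lam k)) (\<psi> k) \<and> full_support G len (\<psi> k))"
    by (rule strict_mono_choice[where P = "\<lambda>x \<psi>. eigenfunction G len VD \<alpha> (complex_of_real x) \<psi> \<and> full_support G len \<psi>"])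
qed

end
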